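(* Consider an internally consistent step predictor-corrector MRI-GARK (SPC-MRI-GARK) method with $s$-stage slow base Runge--Kutta method $(A,b,c)$ and polynomial coupling coefficients $\gamma_i(t)=\sum_{k\ge0}\gamma_i^kt^k$, $\gamma^k=(\gamma^k_1,\dots,\gamma^k_s)^T$, satisfying $b=\bar\gamma$, where $\bar\gamma_i=\int_0^1\gamma_i(\tau)\,d\tau=\sum_{k\ge0}\gamma_i^k/(k+1)$. The method has order four if and only if the slow base method $(A,b,c)$ has order at least four and the following coupling conditions hold: $$\frac16=\sum_{k\ge0}\zeta_k\,(\gamma^k)^Tc,\qquad \frac18=\sum_{k\ge0}\omega_k\,(\gamma^k)^Tc,$$ $$\frac1{12}=\sum_{k\ge0}\zeta_k\,(\gamma^k)^Tc^{\times2},\qquad \frac1{24}=\sum_{k\ge0}\zeta_k\,(\gamma^k)^TA\,c,$$ where $\zeta_k=\frac1{(k+1)(k+2)}$ and $\omega_k=\frac1{(k+1)(k+3)}$.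
   Context: The ODE is $y'=f(t,y)=f^{F}(t,y)+f^{S}(t,y)$, $y(t_0)=y_0\in\mathbb R^d$ ($F$ = fast, $S$ = slow). The slow base method is an $s$-stage Runge--Kutta method $(A,b,c)$ with $A=(a_{i,j})\in\mathbb R^{s\times s}$, $b,c\in\mathbb R^s$, $c=A\mathbf 1_s$, where $\mathbf 1_s$ is the vector of ones. One step of size $H$ of the SPC-MRI-GARK method is $$Y_i=y_n+H\sum_{j=1}^s a_{i,j}f_j,\quad i=1,\dots,s,$$ $$v(0)=y_n,\qquad v'(\theta)=f^{F}(t_n+\theta,v)+\sum_{j=1}^s\gamma_j(\theta/H)\,f^{S}_j,\quad \theta\in[0,H],\qquad y_{n+1}=v(H),$$ where $f_j=f(t_n+c_jH,Y_j)$, $f^S_j=f^S(t_n+c_jH,Y_j)$; the ODE for $v$ is solved exactly (equivalently, by an arbitrarily accurate Runge--Kutta method). The $\gamma_j$ are polynomials, so all sums over $k$ are finite. The method is internally consistent when $(\gamma^0)^T\mathbf 1_s=1$ and $(\gamma^k)^T\mathbf 1_s=0$ for all $k\ge1$. "Order four" means order at least four in the usual sense: for all sufficiently smooth $f^F,f^S$, the local error of one step is $O(H^5)$ as $H\to0$. The notation $x^{\times k}$ denotes the elementwise $k$-th power of a vector. *)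

theory Defs
  imports
    "HOL-Analysis.Analysis"
    "HOL-Computational_Algebra.Polynomial"
    "HOL-Library.Landau_Symbols"
begin

(* Class C^k on the whole space. In finite dimension a differentiable map is C^(k+1) iff each of
   its directional derivatives (for a fixed direction v) is C^k. *)
primrec smooth_class :: "nat \<Rightarrow> ('a::euclidean_space \<Rightarrow> 'b::euclidean_space) \<Rightarrow> bool" where
  "smooth_class 0 f \<longleftrightarrow> continuous_on UNIV f"
| "smooth_class (Suc k) f \<longleftrightarrow> (\<forall>x. f differentiable (at x)) \<and>
     (\<forall>v. smooth_class k (\<lambda>x. frechet_derivative f (at x) v))"

definition ivp_solution ::
  "(real \<Rightarrow> 'a \<Rightarrow> 'a) \<Rightarrow> real \<Rightarrow> 'a \<Rightarrow> real \<Rightarrow> (real \<Rightarrow> 'a::euclidean_space) \<Rightarrow> bool" where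
  "ivp_solution f t0 y0 T y \<longleftrightarrow> y t0 = y0 \<and>
     (\<forall>t\<in>{t0..t0 + T}. (y has_vector_derivative f t (y t)) (at t within {t0..t0 + T}))"

definition rk_stages ::
  "real^'s^'s \<Rightarrow> real^'s \<Rightarrow> (real \<Rightarrow> 'a \<Rightarrow> 'a) \<Rightarrow> real \<Rightarrow> 'a \<Rightarrow> real \<Rightarrow> ('s \<Rightarrow> 'a::euclidean_space) \<Rightarrow> bool"
where
  "rk_stages A c f t y H Y \<longleftrightarrow>
     (\<forall>i. Y i = y + H *\<^sub>R (\<Sum>j\<in>UNIV. (A $ i $ j) *\<^sub>R f (t + c $ j * H) (Y j)))"

(* A need not be strictly lower triangular, so the stages are in general only defined implicitly.
   As usual the solution branch meant is the one that tends to y as H -> 0; for C^1 right-hand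
   sides it exists, and is locally unique, for all small H > 0 (implicit function theorem).
   Other branches (e.g. ones unbounded as H -> 0) are not part of the method. *)
definition rk_stage_branch ::
  "real^'s^'s \<Rightarrow> real^'s \<Rightarrow> (real \<Rightarrow> 'a \<Rightarrow> 'a) \<Rightarrow> real \<Rightarrow> 'a \<Rightarrow> (real \<Rightarrow> 's \<Rightarrow> 'a::euclidean_space) \<Rightarrow> bool"
where
  "rk_stage_branch A c f t y Y \<longleftrightarrow>
     (\<forall>\<^sub>F H in at_right 0. rk_stages A c f t y H (Y H)) \<and>
     (\<forall>i. ((\<lambda>H. Y H i) \<longlongrightarrow> y) (at_right 0))"

definition rk_update ::
  "real^'s \<Rightarrow> real^'s \<Rightarrow> (real \<Rightarrow> 'a \<Rightarrow> 'a) \<Rightarrow> real \<Rightarrow> 'a \<Rightarrow> real \<Rightarrow> ('s \<Rightarrow> 'a::euclidean_space) \<Rightarrow> 'a"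
where
  "rk_update b c f t y H Y = y + H *\<^sub>R (\<Sum>j\<in>UNIV. (b $ j) *\<^sub>R f (t + c $ j * H) (Y j))"

(* Order at least p for problems with states in 'a. "For all sufficiently smooth f" is read as:
   for some k, for all f of class C^k. *)
definition rk_has_order ::
  "'a::euclidean_space itself \<Rightarrow> real^'s^'s \<Rightarrow> real^'s \<Rightarrow> real^'s \<Rightarrow> nat \<Rightarrow> bool" where
  "rk_has_order _ A b c p \<longleftrightarrow>
     (\<exists>k. \<forall>(f :: real \<Rightarrow> 'a \<Rightarrow> 'a) t0 y0 T y Y.
        smooth_class k (\<lambda>(t, x). f t x) \<and> 0 < T \<and> ivp_solution f t0 y0 T y \<and>
        rk_stage_branch A c f t0 y0 Y \<longrightarrow>
        (\<lambda>H. norm (rk_update b c f t0 y0 H (Y H) - y (t0 + H))) \<in> O[at_right 0](\<lambda>H. H ^ (p + 1)))"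

(* The modified fast problem of one step; gamma is the vector of coupling polynomials, and the new
   approximation is v H. *)
definition spc_inner_solution ::
  "(real poly)^'s \<Rightarrow> real^'s \<Rightarrow> (real \<Rightarrow> 'a \<Rightarrow> 'a) \<Rightarrow> (real \<Rightarrow> 'a \<Rightarrow> 'a) \<Rightarrow> real \<Rightarrow> 'a \<Rightarrow> real \<Rightarrow>
   ('s \<Rightarrow> 'a) \<Rightarrow> (real \<Rightarrow> 'a::euclidean_space) \<Rightarrow> bool"
where
  "spc_inner_solution \<gamma> c fF fS t y H Y v \<longleftrightarrow> v 0 = y \<and>
     (\<forall>\<theta>\<in>{0..H}. (v has_vector_derivative
        fF (t + \<theta>) (v \<theta>) + (\<Sum>j\<in>UNIV. poly (\<gamma> $ j) (\<theta> / H) *\<^sub>R fS (t + c $ j * H) (Y j)))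
        (at \<theta> within {0..H}))"

(* The weights b of the base method do not enter the step; they are tied to gamma by the separate
   condition b = gamma_bar. *)
definition spc_has_order ::
  "'a::euclidean_space itself \<Rightarrow> real^'s^'s \<Rightarrow> real^'s \<Rightarrow> (real poly)^'s \<Rightarrow> nat \<Rightarrow> bool" where
  "spc_has_order _ A c \<gamma> p \<longleftrightarrow>
     (\<exists>k. \<forall>(fF :: real \<Rightarrow> 'a \<Rightarrow> 'a) fS t0 y0 T y Y v.
        smooth_class k (\<lambda>(t, x). fF t x) \<and> smooth_class k (\<lambda>(t, x). fS t x) \<and>
        0 < T \<and> ivp_solution (\<lambda>t x. fF t x + fS t x) t0 y0 T y \<and>
        rk_stage_branch A c (\<lambda>t x. fF t x + fS t x) t0 y0 Y \<and>
        (\<forall>\<^sub>F H in at_right 0. spc_inner_solution \<gamma> c fF fS t0 y0 H (Y H) (v H)) \<longrightarrow>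
        (\<lambda>H. norm (v H H - y (t0 + H))) \<in> O[at_right 0](\<lambda>H. H ^ (p + 1)))"

definition gamma_coeff :: "(real poly)^'s \<Rightarrow> nat \<Rightarrow> real^'s" where
  "gamma_coeff \<gamma> k = (\<chi> i. coeff (\<gamma> $ i) k)"

definition gamma_bar :: "(real poly)^'s \<Rightarrow> real^'s" where
  "gamma_bar \<gamma> = (\<chi> i. integral {0..1} (poly (\<gamma> $ i)))"

definition internally_consistent :: "(real poly)^'s \<Rightarrow> bool" where
  "internally_consistent \<gamma> \<longleftrightarrow>
     gamma_coeff \<gamma> 0 \<bullet> 1 = 1 \<and> (\<forall>k\<ge>1. gamma_coeff \<gamma> k \<bullet> 1 = 0)"

definition zeta :: "nat \<Rightarrow> real" where
  "zeta k = 1 / ((real k + 1) * (real k + 2))"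

definition omega :: "nat \<Rightarrow> real" where
  "omega k = 1 / ((real k + 1) * (real k + 3))"

end

theory Submission
  imports Defs
begin

text \<open>
  The idea is to compare one step with a polynomial curve p of degree four that satisfies the full
  equation y' = f(t, y), where f = fF + fS, up to a residual O(s^4). After one step the exact solution and
  p differ by O(H^5) (\<open>approx_solution_error\<close>), so only E = v - p matters. The stages are p(c_i H) + Z_i,
  where Z_i is explicit up to O(H^4) and starts with H^2 times the entries of 2 A c - c^2
  (\<open>stage_expansion\<close>). Inserting this into the inner problem gives, with \<tau> = \<theta> / H,

    E' = N0 E + \<theta> N1 E + H d1(\<tau>) + H^2 d2(\<tau>) + H^3 d3(\<tau>) + O(H^4),

  where N0 + \<theta> N1 is the Jacobian of the fast part along p. Each d_k is a combination of fixed vectors with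
  scalar factors \<Sum>_j \<gamma>_j(\<tau>) w_j - \<tau>^n or \<Sum>_j \<gamma>_j(\<tau>) w_j, for vectors w built from A and c. Integrating against
  the adjoint propagator (\<open>propagated_error\<close>) shows E(H) = O(H^5) as soon as d1, d2 and d3 have mean zero,
  d1 and d2 are orthogonal to 1 - \<tau>, and d1 is orthogonal to (1 - \<tau>)^2 and 1 - \<tau>^2. The mean values
  depend on the coupling polynomials through b = \<gamma>-bar alone, and their vanishing amounts, together with
  consistency, to the order conditions of the base method. The
  weighted conditions are the coupling conditions, because the integrals over [0, 1] of (1 - \<tau>) \<tau>^k and of
  (1 - \<tau>^2) / 2 * \<tau>^k are \<zeta>_k and \<omega>_k. This is the sufficiency (\<open>spc_order_of_moments\<close>).

  It needs the order conditions as equations in A, b and c. They are extracted from the order of the base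
  method by linear, time-dependent test problems with the solution t^m u (\<open>rk_order_4_conditions\<close>), which
  exist in every dimension of the state space.

  For the necessity, the choice fF = 0 turns a step of the method into a step of the base method
  (\<open>spc_order_imp_rk_order\<close>). The coupling conditions come from problems in which fF contains the state x and
  fS contains -x: then f does not depend on the state, stages and solution are explicit, and the error
  is the integral of exp (H - s) against a known polynomial (\<open>spc_linear_test\<close>).
\<close>

section \<open>Functions of class C^k\<close>

lemma smooth_class_continuous: "smooth_class k f \<Longrightarrow> continuous_on UNIV f"
proof (cases k)
  case (Suc n)
  moreover assume "smooth_class k f"
  ultimately have "f differentiable (at x)" for x by simp
  then show ?thesis
    by (simp add: continuous_at_imp_continuous_on differentiable_imp_continuous_within)
qed simp

lemma smooth_class_SucD: "smooth_class (Suc k) f \<Longrightarrow> smooth_class k f"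
proof (induction k arbitrary: f)
  case 0
  then show ?case using smooth_class_continuous[of 1 f] by simp
next
  case (Suc k)
  then show ?case by auto
qed

lemma smooth_class_mono: "smooth_class n f \<Longrightarrow> m \<le> n \<Longrightarrow> smooth_class m f"
proof (induction n)
  case (Suc n)
  then show ?case using smooth_class_SucD[of n f] by (cases "m = Suc n") simp_all
qed simp

lemma smooth_class_const: "smooth_class k (\<lambda>x. a)"
  by (induction k arbitrary: a) auto

lemma smooth_class_bounded_linear:
  assumes "bounded_linear f"
  shows "smooth_class k f"
proof (cases k)
  case 0
  then show ?thesis using linear_continuous_on[OF assms] by simp
next
  case (Suc n)
  have "frechet_derivative f (at x) = f" for x
    using frechet_derivative_at[OF bounded_linear_imp_has_derivative[OF assms]] by metis
  then show ?thesis
    using Suc bounded_linear_imp_differentiable[OF assms] by (simp add: smooth_class_const)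
qed

lemma smooth_class_add:
  "smooth_class k f \<Longrightarrow> smooth_class k g \<Longrightarrow> smooth_class k (\<lambda>x. f x + g x)"
proof (induction k arbitrary: f g)
  case (Suc k)
  have "frechet_derivative (\<lambda>x. f x + g x) (at x) =
      (\<lambda>v. frechet_derivative f (at x) v + frechet_derivative g (at x) v)" for x
    using Suc.prems
    by (intro frechet_derivative_at[symmetric] has_derivative_add)
      (simp_all add: frechet_derivative_works[symmetric])
  with Suc show ?case by simp
qed (simp add: continuous_on_add)

lemma smooth_class_scaleR:
  fixes f :: "'a::euclidean_space \<Rightarrow> real"
  shows "smooth_class k f \<Longrightarrow> smooth_class k g \<Longrightarrow> smooth_class k (\<lambda>x. f x *\<^sub>R g x)"
proof (induction k arbitrary: f g)
  case (Suc k)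
  have "frechet_derivative (\<lambda>x. f x *\<^sub>R g x) (at x) =
      (\<lambda>v. f x *\<^sub>R frechet_derivative g (at x) v + frechet_derivative f (at x) v *\<^sub>R g x)" for x
    using Suc.prems
    by (intro frechet_derivative_at[symmetric] has_derivative_scaleR)
      (simp_all add: frechet_derivative_works[symmetric])
  with Suc show ?case
    by (auto intro!: smooth_class_add Suc.IH intro: smooth_class_SucD differentiable_scaleR)
qed (simp add: continuous_on_scaleR)

lemma smooth_class_power:
  fixes f :: "'a::euclidean_space \<Rightarrow> real"
  shows "smooth_class k f \<Longrightarrow> smooth_class k (\<lambda>x. f x ^ n)"
proof (induction n)
  case (Suc n)
  then show ?case using smooth_class_scaleR[of k f "\<lambda>x. f x ^ n"] by simp
qed (simp add: smooth_class_const)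

lemma smooth_class_diff:
  assumes "smooth_class k f" "smooth_class k g"
  shows "smooth_class k (\<lambda>x. f x - g x)"
proof -
  have "smooth_class k (\<lambda>x. (- 1) *\<^sub>R g x)"
    by (rule smooth_class_scaleR[OF smooth_class_const assms(2)])
  from smooth_class_add[OF assms(1) this] show ?thesis by simp
qed

section \<open>Taylor expansions along polynomial curves\<close>

text \<open>
  The bound is required on the whole interval from -1 to 1, so that one constant serves every small
  step size. Negative arguments matter because nodes of the base method may be negative.
\<close>

definition has_expansion :: "nat \<Rightarrow> (real \<Rightarrow> 'a::real_normed_vector) \<Rightarrow> bool" where
  "has_expansion n g \<longleftrightarrow>
     (\<exists>a C. \<forall>s. \<bar>s\<bar> \<le> 1 \<longrightarrow> norm (g s - (\<Sum>i<n. s ^ i *\<^sub>R a i)) \<le> C * \<bar>s\<bar> ^ n)"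

lemma has_expansionI:
  "(\<And>s. \<bar>s\<bar> \<le> 1 \<Longrightarrow> norm (g s - (\<Sum>i<n. s ^ i *\<^sub>R a i)) \<le> C * \<bar>s\<bar> ^ n) \<Longrightarrow> has_expansion n g"
  unfolding has_expansion_def by blast

lemma has_expansionE:
  assumes "has_expansion n g"
  obtains a C where "C \<ge> 0"
    "\<And>s. \<bar>s\<bar> \<le> 1 \<Longrightarrow> norm (g s - (\<Sum>i<n. s ^ i *\<^sub>R a i)) \<le> C * \<bar>s\<bar> ^ n"
proof -
  obtain a C where a: "\<And>s. \<bar>s\<bar> \<le> 1 \<Longrightarrow> norm (g s - (\<Sum>i<n. s ^ i *\<^sub>R a i)) \<le> C * \<bar>s\<bar> ^ n"
    using assms unfolding has_expansion_def by blast
  have "C \<ge> 0" using order_trans[OF norm_ge_zero a[of 1]] by simp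
  then show thesis using a that by blast
qed

lemma has_expansion_0:
  assumes "continuous_on UNIV g"
  shows "has_expansion 0 g"
proof -
  have "compact (g ` {-1..1})"
    using assms by (intro compact_continuous_image) (auto intro: continuous_on_subset)
  then obtain C where "\<forall>x\<in>g ` {-1..1}. norm x \<le> C"
    by (meson bounded_iff compact_imp_bounded)
  then have "norm (g s - (\<Sum>i<0. s ^ i *\<^sub>R 0)) \<le> C * \<bar>s\<bar> ^ 0" if "\<bar>s\<bar> \<le> 1" for s
    using that by (simp add: abs_le_iff)
  then show ?thesis by (rule has_expansionI)
qed

lemma has_expansion_add:
  assumes "has_expansion n f" "has_expansion n g"
  shows "has_expansion n (\<lambda>s. f s + g s)"
proof -
  obtain a C where a: "\<And>s. \<bar>s\<bar> \<le> 1 \<Longrightarrow> norm (f s - (\<Sum>i<n. s ^ i *\<^sub>R a i)) \<le> C * \<bar>s\<bar> ^ n"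
    using has_expansionE[OF assms(1)] by metis
  obtain b D where b: "\<And>s. \<bar>s\<bar> \<le> 1 \<Longrightarrow> norm (g s - (\<Sum>i<n. s ^ i *\<^sub>R b i)) \<le> D * \<bar>s\<bar> ^ n"
    using has_expansionE[OF assms(2)] by metis
  have "norm (f s + g s - (\<Sum>i<n. s ^ i *\<^sub>R (a i + b i))) \<le> (C + D) * \<bar>s\<bar> ^ n" if "\<bar>s\<bar> \<le> 1" for s
  proof -
    have "f s + g s - (\<Sum>i<n. s ^ i *\<^sub>R (a i + b i)) =
      (f s - (\<Sum>i<n. s ^ i *\<^sub>R a i)) + (g s - (\<Sum>i<n. s ^ i *\<^sub>R b i))"
      by (simp add: scaleR_add_right sum.distrib)
    then show ?thesis
      using norm_triangle_mono[OF a[OF that] b[OF that]] by (simp only: ring_distribs)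
  qed
  then show ?thesis by (rule has_expansionI)
qed

lemma has_expansion_sum:
  "finite B \<Longrightarrow> (\<And>b. b \<in> B \<Longrightarrow> has_expansion n (f b)) \<Longrightarrow> has_expansion n (\<lambda>s. \<Sum>b\<in>B. f b s)"
proof (induction rule: finite_induct)
  case empty
  show ?case unfolding has_expansion_def by (rule exI[of _ "\<lambda>_. 0"], rule exI[of _ 0]) simp
qed (simp add: has_expansion_add)

lemma has_expansion_mono:
  assumes "has_expansion (Suc n) g"
  shows "has_expansion n g"
proof -
  obtain a C where a: "\<And>s. \<bar>s\<bar> \<le> 1 \<Longrightarrow> norm (g s - (\<Sum>i<Suc n. s ^ i *\<^sub>R a i)) \<le> C * \<bar>s\<bar> ^ Suc n"
    using has_expansionE[OF assms(1)] by metis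
  have "norm (g s - (\<Sum>i<n. s ^ i *\<^sub>R a i)) \<le> (\<bar>C\<bar> + norm (a n)) * \<bar>s\<bar> ^ n" if s: "\<bar>s\<bar> \<le> 1" for s
  proof -
    have "g s - (\<Sum>i<n. s ^ i *\<^sub>R a i) = (g s - (\<Sum>i<Suc n. s ^ i *\<^sub>R a i)) + s ^ n *\<^sub>R a n" by simp
    also have "norm \<dots> \<le> C * \<bar>s\<bar> ^ Suc n + \<bar>s\<bar> ^ n * norm (a n)"
      using norm_triangle_mono[OF a[OF s] order_refl, of "s ^ n *\<^sub>R a n"] by (simp add: power_abs)
    also have "C * \<bar>s\<bar> ^ Suc n \<le> \<bar>C\<bar> * \<bar>s\<bar> ^ n"
      using s by (intro mult_mono) (auto simp: mult_left_le_one_le)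
    finally show ?thesis by (simp add: algebra_simps)
  qed
  then show ?thesis by (rule has_expansionI)
qed

lemma has_expansion_times_var:
  assumes "has_expansion n g"
  shows "has_expansion n (\<lambda>s. s *\<^sub>R g s)"
proof -
  obtain a C where a: "\<And>s. \<bar>s\<bar> \<le> 1 \<Longrightarrow> norm (g s - (\<Sum>i<n. s ^ i *\<^sub>R a i)) \<le> C * \<bar>s\<bar> ^ n"
    using has_expansionE[OF assms(1)] by metis
  have "norm (s *\<^sub>R g s - (\<Sum>i<Suc n. s ^ i *\<^sub>R (case i of 0 \<Rightarrow> 0 | Suc j \<Rightarrow> a j)))
      \<le> C * \<bar>s\<bar> ^ Suc n" if "\<bar>s\<bar> \<le> 1" for s
  proof -
    have "s *\<^sub>R g s - (\<Sum>i<Suc n. s ^ i *\<^sub>R (case i of 0 \<Rightarrow> 0 | Suc j \<Rightarrow> a j)) =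
        s *\<^sub>R (g s - (\<Sum>i<n. s ^ i *\<^sub>R a i))"
      by (simp add: sum.lessThan_Suc_shift scaleR_diff_right scaleR_sum_right del: sum.lessThan_Suc)
    then show ?thesis
      using mult_left_mono[OF a[OF that], of "\<bar>s\<bar>"] by (simp add: mult.left_commute)
  qed
  then have "has_expansion (Suc n) (\<lambda>s. s *\<^sub>R g s)" by (rule has_expansionI)
  then show ?thesis by (rule has_expansion_mono)
qed

lemma has_expansion_times_power: "has_expansion n g \<Longrightarrow> has_expansion n (\<lambda>s. s ^ m *\<^sub>R g s)"
proof (induction m)
  case (Suc m)
  then show ?case using has_expansion_times_var[of n "\<lambda>s. s ^ m *\<^sub>R g s"] by simp
qed simp

lemma norm_le_integrated_power:
  fixes g :: "real \<Rightarrow> 'a::real_normed_vector"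
  assumes deriv: "\<And>s. \<bar>s\<bar> \<le> 1 \<Longrightarrow> (g has_vector_derivative h s) (at s)"
    and bound: "\<And>s. \<bar>s\<bar> \<le> 1 \<Longrightarrow> norm (h s) \<le> C * \<bar>s\<bar> ^ n"
    and s: "\<bar>s\<bar> \<le> 1"
  shows "norm (g s - g 0) \<le> C * \<bar>s\<bar> ^ Suc n"
proof -
  have C: "C \<ge> 0" using order_trans[OF norm_ge_zero bound[of 1]] by simp
  have seg: "\<bar>x\<bar> \<le> \<bar>s\<bar>" if "x \<in> closed_segment 0 s" for x
    using that by (auto simp: closed_segment_eq_real_ivl split: if_splits)
  have "norm (g (0 + s) - g 0) \<le> norm s * (C * \<bar>s\<bar> ^ n)"
  proof (rule differentiable_bound_segment[where G = "{-1..1}" and f' = "\<lambda>x t. t *\<^sub>R h x"])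
    fix x assume x: "x \<in> {-1..1::real}"
    then show "(g has_derivative (\<lambda>t. t *\<^sub>R h x)) (at x within {-1..1})"
      using deriv[of x] by (auto simp: has_vector_derivative_def intro: has_derivative_at_withinI)
  next
    fix t :: real assume t: "t \<in> {0..1}"
    have "\<bar>t * s\<bar> \<le> \<bar>s\<bar>" using t by (simp add: abs_mult mult_left_le_one_le)
    then show "0 + t *\<^sub>R s \<in> {-1..1}" using s by (auto simp: abs_le_iff)
  next
    fix t :: real assume t: "t \<in> {0..1}"
    have *: "\<bar>t * s\<bar> \<le> \<bar>s\<bar>" using t by (simp add: abs_mult mult_left_le_one_le)
    have "onorm (\<lambda>r. r *\<^sub>R h (t * s)) = norm (h (t * s))"
      by (simp add: onorm_scaleR_left bounded_linear_ident onorm_id)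
    also have "\<dots> \<le> C * \<bar>t * s\<bar> ^ n" using * s by (intro bound) auto
    also have "\<dots> \<le> C * \<bar>s\<bar> ^ n" using * C by (intro mult_left_mono power_mono) auto
    finally show "onorm (\<lambda>r. r *\<^sub>R h (0 + t *\<^sub>R s)) \<le> C * \<bar>s\<bar> ^ n" by simp
  qed
  then show ?thesis by (simp add: algebra_simps)
qed

lemma has_vector_derivative_power_scaleR:
  fixes v :: "'a::real_normed_vector"
  shows "((\<lambda>s::real. s ^ Suc i *\<^sub>R v) has_vector_derivative s ^ i *\<^sub>R (real (Suc i) *\<^sub>R v)) (at s within S)"
proof -
  have "((\<lambda>s. s ^ Suc i) has_vector_derivative real (Suc i) * s ^ i) (at s within S)"
    using DERIV_pow[of "Suc i" s S] by (simp add: has_real_derivative_iff_has_vector_derivative)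
  from bounded_linear.has_vector_derivative[OF bounded_linear_scaleR_left this, of v]
  show ?thesis by (simp add: mult.commute del: of_nat_Suc power_Suc)
qed

lemma has_expansion_integrate:
  assumes deriv: "\<And>s. (g has_vector_derivative h s) (at s)" and h: "has_expansion n h"
  shows "has_expansion (Suc n) g"
proof -
  obtain a C where a: "\<And>s. \<bar>s\<bar> \<le> 1 \<Longrightarrow> norm (h s - (\<Sum>i<n. s ^ i *\<^sub>R a i)) \<le> C * \<bar>s\<bar> ^ n"
    using has_expansionE[OF h] by metis
  define b where "b i = (case i of 0 \<Rightarrow> g 0 | Suc j \<Rightarrow> (1 / real (Suc j)) *\<^sub>R a j)" for i
  define r where "r s = g s - (\<Sum>i<Suc n. s ^ i *\<^sub>R b i)" for s
  have r: "r s = g s - g 0 - (\<Sum>i<n. s ^ Suc i *\<^sub>R ((1 / real (Suc i)) *\<^sub>R a i))" for s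
    by (simp add: r_def b_def sum.lessThan_Suc_shift del: sum.lessThan_Suc power_Suc of_nat_Suc)
  have summand: "((\<lambda>s. s ^ Suc i *\<^sub>R ((1 / real (Suc i)) *\<^sub>R a i)) has_vector_derivative s ^ i *\<^sub>R a i) (at s)"
    for i s
    using has_vector_derivative_power_scaleR[of i "(1 / real (Suc i)) *\<^sub>R a i" s UNIV]
    by (simp del: of_nat_Suc power_Suc)
  have "(r has_vector_derivative h s - (\<Sum>i<n. s ^ i *\<^sub>R a i)) (at s)" for s
    unfolding r[abs_def]
    by (intro has_vector_derivative_diff has_vector_derivative_sum summand)
      (simp add: has_vector_derivative_diff_const deriv)
  from norm_le_integrated_power[OF this a]
  have "norm (r s - r 0) \<le> C * \<bar>s\<bar> ^ Suc n" if "\<bar>s\<bar> \<le> 1" for s using that by blast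
  moreover have "r 0 = 0" by (simp add: r)
  ultimately show ?thesis unfolding has_expansion_def r_def by auto
qed

text \<open>
  Smoothness is given in terms of directional derivatives; this bounds a derivative by its values in
  finitely many directions.
\<close>

lemma norm_linear_le_Basis:
  fixes L :: "'a::euclidean_space \<Rightarrow> 'b::real_normed_vector"
  assumes "linear L"
  shows "norm (L h) \<le> norm h * (\<Sum>b\<in>Basis. norm (L b))"
proof -
  have "L h = (\<Sum>b\<in>Basis. (h \<bullet> b) *\<^sub>R L b)"
    using linear_sum[OF assms, of "\<lambda>b. (h \<bullet> b) *\<^sub>R b" Basis] linear_cmul[OF assms]
    by (simp add: euclidean_representation)
  also have "norm \<dots> \<le> (\<Sum>b\<in>Basis. norm h * norm (L b))"
    by (rule sum_norm_le) (simp add: Basis_le_norm mult_right_mono)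
  finally show ?thesis by (simp add: sum_distrib_left)
qed

lemma smooth_class_lipschitz:
  assumes F: "smooth_class (Suc 0) F" and K: "compact K" "convex K"
  shows "\<exists>C\<ge>0. \<forall>x\<in>K. \<forall>y\<in>K. norm (F x - F y) \<le> C * norm (x - y)"
proof -
  have der: "(F has_derivative frechet_derivative F (at x)) (at x)" for x
    using F by (simp add: frechet_derivative_works[symmetric])
  have lin: "linear (frechet_derivative F (at x))" for x
    using der has_derivative_linear by blast
  define B where "B x = (\<Sum>b\<in>Basis. norm (frechet_derivative F (at x) b))" for x
  have "continuous_on K B"
    unfolding B_def using F
    by (intro continuous_on_sum continuous_on_norm) (auto intro: continuous_on_subset)
  then have "compact (B ` K)" using K by (intro compact_continuous_image)
  then obtain C0 where C0: "\<And>z. z \<in> B ` K \<Longrightarrow> norm z \<le> C0"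
    using compact_imp_bounded bounded_iff by metis
  define C where "C = max 0 C0"
  have C_nonneg: "C \<ge> 0" by (simp add: C_def)
  have C: "B x \<le> C" if "x \<in> K" for x
    using C0[of "B x"] that by (simp add: C_def)
  have on: "onorm (frechet_derivative F (at x)) \<le> C" if "x \<in> K" for x
  proof (rule onorm_le)
    fix h
    have "norm (frechet_derivative F (at x) h) \<le> norm h * B x"
      unfolding B_def by (rule norm_linear_le_Basis[OF lin])
    also have "\<dots> \<le> norm h * C" using C[OF that] by (rule mult_left_mono) simp
    finally show "norm (frechet_derivative F (at x) h) \<le> C * norm h" by (simp add: mult.commute)
  qed
  have "norm (F x - F y) \<le> C * norm (x - y)" if "x \<in> K" "y \<in> K" for x y
    using differentiable_bound[OF K(2) has_derivative_at_withinI[OF der] on that] by blast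
  then show ?thesis using C_nonneg by blast
qed

text \<open>
  The directional derivatives along the basis vectors are of class C^1, hence Lipschitz on K, and so is
  the full derivative. The mean value inequality on the segment from x to y then produces the square.
\<close>

lemma smooth_class_quadratic_remainder:
  assumes F: "smooth_class (Suc (Suc 0)) F" and K: "compact K" "convex K"
  shows "\<exists>C\<ge>0. \<forall>x\<in>K. \<forall>y\<in>K.
           norm (F y - F x - frechet_derivative F (at x) (y - x)) \<le> C * (norm (y - x))\<^sup>2"
proof -
  let ?D = "\<lambda>x. frechet_derivative F (at x)"
  have der: "(F has_derivative ?D x) (at x)" for x
    using F by (simp add: frechet_derivative_works[symmetric])
  have lin: "linear (?D x)" for x
    using der has_derivative_linear by blast
  have "\<forall>b. \<exists>C\<ge>0. \<forall>x\<in>K. \<forall>y\<in>K. norm (?D x b - ?D y b) \<le> C * norm (x - y)"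
  proof
    fix b
    have "smooth_class (Suc 0) (\<lambda>x. ?D x b)" using F by simp
    from smooth_class_lipschitz[OF this K]
    show "\<exists>C\<ge>0. \<forall>x\<in>K. \<forall>y\<in>K. norm (?D x b - ?D y b) \<le> C * norm (x - y)" .
  qed
  then obtain C where C: "\<And>b. C b \<ge> 0"
      "\<And>b x y. x \<in> K \<Longrightarrow> y \<in> K \<Longrightarrow> norm (?D x b - ?D y b) \<le> C b * norm (x - y)"
    by metis
  define M where "M = (\<Sum>b\<in>Basis. C b)"
  have M: "M \<ge> 0" using C(1) by (auto simp: M_def intro: sum_nonneg)
  have "norm (F y - F x - ?D x (y - x)) \<le> M * (norm (y - x))\<^sup>2" if xy: "x \<in> K" "y \<in> K" for x y
  proof -
    have sub: "closed_segment x y \<subseteq> K" using xy K(2) closed_segment_subset by blast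
    have on: "onorm (\<lambda>h. ?D z h - ?D x h) \<le> M * norm (y - x)" if z: "z \<in> closed_segment x y" for z
    proof (rule onorm_le)
      fix h
      have "linear (\<lambda>h. ?D z h - ?D x h)" using lin linear_compose_sub by blast
      from norm_linear_le_Basis[OF this]
      have *: "norm (?D z h - ?D x h) \<le> norm h * (\<Sum>b\<in>Basis. norm (?D z b - ?D x b))" .
      have "(\<Sum>b\<in>Basis. norm (?D z b - ?D x b)) \<le> (\<Sum>b\<in>Basis. C b * norm (y - x))"
      proof (rule sum_mono)
        fix b :: 'a
        have "norm (?D z b - ?D x b) \<le> C b * norm (z - x)"
          using z sub xy by (intro C(2)) auto
        also have "\<dots> \<le> C b * norm (y - x)"
          using segment_bound(1)[OF z] C(1) by (intro mult_left_mono) auto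
        finally show "norm (?D z b - ?D x b) \<le> C b * norm (y - x)" .
      qed
      also have "\<dots> = M * norm (y - x)" by (simp add: M_def sum_distrib_right)
      finally have "norm h * (\<Sum>b\<in>Basis. norm (?D z b - ?D x b)) \<le> norm h * (M * norm (y - x))"
        by (rule mult_left_mono) simp
      with * show "norm (?D z h - ?D x h) \<le> M * norm (y - x) * norm h"
        by (simp add: mult.commute)
    qed
    have "norm (F y - F x - ?D x (y - x)) \<le> norm (y - x) * (M * norm (y - x))"
    proof (rule differentiable_bound_linearization[where S = "closed_segment x y" and f' = ?D and ?x0.0 = x])
      show "x + t *\<^sub>R (y - x) \<in> closed_segment x y" if "t \<in> {0..1}" for t
        using that by (auto simp: in_segment algebra_simps intro!: exI[of _ t])
    qed (use der on in \<open>auto simp: fun_diff_def intro: has_derivative_at_withinI\<close>)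
    then show ?thesis by (simp add: power2_eq_square mult_ac)
  qed
  with M show ?thesis by blast
qed

text \<open>
  Induction on the smoothness. As the velocity of P is polynomial, the chain rule writes the derivative
  of the composition as a polynomial combination of the functions "directional derivative of F in the
  fixed direction d i, along P". The induction hypothesis expands these, and integration gains an order.
\<close>

lemma has_expansion_compose:
  assumes P: "\<And>s. (P has_vector_derivative (\<Sum>i<m. s ^ i *\<^sub>R d i)) (at s)"
  shows "smooth_class n F \<Longrightarrow> has_expansion n (\<lambda>s. F (P s))"
proof (induction n arbitrary: F)
  case 0
  have "continuous_on UNIV P"
    using P by (meson continuous_at_imp_continuous_on has_vector_derivative_continuous)
  with 0 have "continuous_on UNIV (\<lambda>s. F (P s))"
    by (auto intro: continuous_on_compose2)
  then show ?case by (rule has_expansion_0)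
next
  case (Suc n)
  let ?D = "\<lambda>x. frechet_derivative F (at x)"
  have der: "(F has_derivative ?D x) (at x)" for x
    using Suc.prems by (simp add: frechet_derivative_works[symmetric])
  have lin: "linear (?D x)" for x
    using der has_derivative_linear by blast
  have "((\<lambda>s. F (P s)) has_vector_derivative (\<Sum>i<m. s ^ i *\<^sub>R ?D (P s) (d i))) (at s)" for s
  proof -
    have "((\<lambda>s. F (P s)) has_vector_derivative ?D (P s) (\<Sum>i<m. s ^ i *\<^sub>R d i)) (at s)"
      using vector_derivative_diff_chain_within[OF P[of s], of F "?D (P s)"] der
      by (simp add: o_def has_derivative_at_withinI)
    then show ?thesis by (simp add: linear_sum[OF lin] linear_cmul[OF lin])
  qed
  moreover have "has_expansion n (\<lambda>s. \<Sum>i<m. s ^ i *\<^sub>R ?D (P s) (d i))"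
    using Suc.prems by (intro has_expansion_sum has_expansion_times_power Suc.IH) auto
  ultimately show ?case by (rule has_expansion_integrate)
qed

lemma has_vector_derivative_poly:
  "((\<lambda>s::real. \<Sum>i<Suc n. s ^ i *\<^sub>R a i) has_vector_derivative
     (\<Sum>i<n. s ^ i *\<^sub>R (real (Suc i) *\<^sub>R a (Suc i)))) (at s within S)"
proof -
  have "((\<lambda>s. a 0 + (\<Sum>i<n. s ^ Suc i *\<^sub>R a (Suc i))) has_vector_derivative
      0 + (\<Sum>i<n. s ^ i *\<^sub>R (real (Suc i) *\<^sub>R a (Suc i)))) (at s within S)"
    by (intro has_vector_derivative_add has_vector_derivative_const has_vector_derivative_sum has_vector_derivative_power_scaleR)
  then show ?thesis by (simp add: sum.lessThan_Suc_shift del: sum.lessThan_Suc power_Suc of_nat_Suc)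
qed

text \<open>
  The field F near a polynomial curve p: its values on the curve are expanded in the time s, and its
  increments off the curve are linearized. The linear part is expanded in s as well, L0 + s L1 being the
  state Jacobian of F along p up to terms of order two in s. Perturbations Z of interest are of size H^2,
  for which both error terms are of size H^4.
\<close>

lemma tube_expansion:
  fixes F :: "real \<times> 'a::euclidean_space \<Rightarrow> 'b::euclidean_space" and a :: "nat \<Rightarrow> 'a" and n :: nat
  defines "p \<equiv> \<lambda>s. \<Sum>i<Suc n. s ^ i *\<^sub>R a i"
  assumes F: "smooth_class 4 F"
  obtains \<sigma> L0 L1 C where "C \<ge> 0" "bounded_linear L0" "bounded_linear L1"
    "\<And>s. \<bar>s\<bar> \<le> 1 \<Longrightarrow> norm (F (t0 + s, p s) - (\<Sum>i<4. s ^ i *\<^sub>R \<sigma> i)) \<le> C * \<bar>s\<bar> ^ 4"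
    "\<And>s Z. \<bar>s\<bar> \<le> 1 \<Longrightarrow> norm Z \<le> 1 \<Longrightarrow>
       norm (F (t0 + s, p s + Z) - F (t0 + s, p s) - (L0 Z + s *\<^sub>R L1 Z)) \<le>
         C * (s\<^sup>2 * norm Z + (norm Z)\<^sup>2)"
proof -
  define P where "P s = (t0 + s, p s)" for s
  define d where "d i = ((if i = 0 then 1 else 0 :: real),
      (if i < n then real (Suc i) *\<^sub>R a (Suc i) else 0))" for i
  have P: "(P has_vector_derivative (\<Sum>i<Suc n. s ^ i *\<^sub>R d i)) (at s)" for s
  proof -
    have "(\<Sum>i<Suc n. s ^ i *\<^sub>R d i) = (1, \<Sum>i<n. s ^ i *\<^sub>R (real (Suc i) *\<^sub>R a (Suc i)))"
    proof (rule prod_eqI)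
      have "fst (\<Sum>i<Suc n. s ^ i *\<^sub>R d i) = (\<Sum>i<Suc n. if i = 0 then 1 else 0)"
        unfolding fst_sum by (rule sum.cong) (auto simp: d_def)
      then show "fst (\<Sum>i<Suc n. s ^ i *\<^sub>R d i) =
          fst (1, \<Sum>i<n. s ^ i *\<^sub>R (real (Suc i) *\<^sub>R a (Suc i)))"
        by (simp add: sum.lessThan_Suc_shift del: sum.lessThan_Suc)
      show "snd (\<Sum>i<Suc n. s ^ i *\<^sub>R d i) =
          snd (1, \<Sum>i<n. s ^ i *\<^sub>R (real (Suc i) *\<^sub>R a (Suc i)))"
        by (simp add: snd_sum d_def)
    qed
    moreover have "((\<lambda>s. (t0 + s, p s)) has_vector_derivative
        (0 + 1, \<Sum>i<n. s ^ i *\<^sub>R (real (Suc i) *\<^sub>R a (Suc i)))) (at s)"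
      unfolding p_def
      by (intro has_vector_derivative_Pair has_vector_derivative_add has_vector_derivative_const
          has_vector_derivative_id has_vector_derivative_poly)
    ultimately show ?thesis by (simp add: P_def[abs_def])
  qed
  obtain \<sigma> C1 where \<sigma>: "C1 \<ge> 0"
    "\<And>s. \<bar>s\<bar> \<le> 1 \<Longrightarrow> norm (F (P s) - (\<Sum>i<4. s ^ i *\<^sub>R \<sigma> i)) \<le> C1 * \<bar>s\<bar> ^ 4"
    using has_expansionE[OF has_expansion_compose[OF P F]] by metis
  let ?D = "\<lambda>x. frechet_derivative F (at x)"
  have F1: "smooth_class (Suc 3) F" using F by simp
  then have F': "smooth_class (Suc 2) (\<lambda>x. ?D x v)" for v
    unfolding smooth_class.simps(2)[of 3] by (simp only: numeral_3_eq_3 numeral_2_eq_2)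
  have lin: "linear (?D x)" for x
    using F1 has_derivative_linear unfolding smooth_class.simps(2)[of 3] frechet_derivative_works
    by blast
  have "\<forall>b. \<exists>l c. c \<ge> 0 \<and> (\<forall>s. \<bar>s\<bar> \<le> 1 \<longrightarrow>
      norm (?D (P s) (0, b) - (\<Sum>i<2. s ^ i *\<^sub>R l i)) \<le> c * \<bar>s\<bar> ^ 2)"
  proof
    fix b
    have "has_expansion 2 (\<lambda>s. ?D (P s) (0, b))"
      by (rule has_expansion_compose[OF P smooth_class_SucD[OF F']])
    then obtain l c where "c \<ge> 0" "\<And>s. \<bar>s\<bar> \<le> 1 \<Longrightarrow>
        norm (?D (P s) (0, b) - (\<Sum>i<2. s ^ i *\<^sub>R l i)) \<le> c * \<bar>s\<bar> ^ 2"
      by (rule has_expansionE) blast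
    then show "\<exists>l c. c \<ge> 0 \<and> (\<forall>s. \<bar>s\<bar> \<le> 1 \<longrightarrow>
        norm (?D (P s) (0, b) - (\<Sum>i<2. s ^ i *\<^sub>R l i)) \<le> c * \<bar>s\<bar> ^ 2)"
      by blast
  qed
  from choice[OF this] obtain l where "\<forall>b. \<exists>c. c \<ge> 0 \<and> (\<forall>s. \<bar>s\<bar> \<le> 1 \<longrightarrow>
      norm (?D (P s) (0, b) - (\<Sum>i<2. s ^ i *\<^sub>R l b i)) \<le> c * \<bar>s\<bar> ^ 2)" by blast
  from choice[OF this] obtain c where l: "\<And>b. c b \<ge> 0" "\<And>b s. \<bar>s\<bar> \<le> 1 \<Longrightarrow>
      norm (?D (P s) (0, b) - (\<Sum>i<2. s ^ i *\<^sub>R l b i)) \<le> c b * \<bar>s\<bar> ^ 2"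
    by blast
  define L where "L i Z = (\<Sum>b\<in>Basis. (Z \<bullet> b) *\<^sub>R l b i)" for i :: nat and Z :: 'a
  have L: "bounded_linear (L i)" for i
    unfolding L_def
    by (intro bounded_linear_sum bounded_linear_scaleR_const bounded_linear_inner_left)
  define C2 where "C2 = (\<Sum>b\<in>Basis. c b)"
  have C2: "C2 \<ge> 0" using l(1) by (auto simp: C2_def intro: sum_nonneg)
  have lexp: "norm (?D (P s) (0, Z) - (L 0 Z + s *\<^sub>R L 1 Z)) \<le> C2 * (s\<^sup>2 * norm Z)"
    if s: "\<bar>s\<bar> \<le> 1" for s Z
  proof -
    have Z: "(0, Z) = (\<Sum>b\<in>Basis. (Z \<bullet> b) *\<^sub>R (0 :: real, b))"
      by (simp add: prod_eq_iff fst_sum snd_sum euclidean_representation)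
    have "?D (P s) (0, Z) = (\<Sum>b\<in>Basis. (Z \<bullet> b) *\<^sub>R ?D (P s) (0, b))"
      by (simp only: Z linear_sum[OF lin] linear_cmul[OF lin])
    moreover have "L 0 Z + s *\<^sub>R L 1 Z = (\<Sum>b\<in>Basis. (Z \<bullet> b) *\<^sub>R (\<Sum>i<2. s ^ i *\<^sub>R l b i))"
      by (simp add: L_def numeral_eq_Suc scaleR_sum_right sum.distrib scaleR_add_right mult.commute)
    ultimately have "?D (P s) (0, Z) - (L 0 Z + s *\<^sub>R L 1 Z) =
        (\<Sum>b\<in>Basis. (Z \<bullet> b) *\<^sub>R (?D (P s) (0, b) - (\<Sum>i<2. s ^ i *\<^sub>R l b i)))"
      by (simp only: sum_subtractf scaleR_diff_right)
    also have "norm \<dots> \<le> (\<Sum>b\<in>Basis. norm Z * (c b * s\<^sup>2))"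
    proof (rule sum_norm_le)
      fix b :: 'a assume "b \<in> Basis"
      then have "\<bar>Z \<bullet> b\<bar> \<le> norm Z" by (rule Basis_le_norm)
      then show "norm ((Z \<bullet> b) *\<^sub>R (?D (P s) (0, b) - (\<Sum>i<2. s ^ i *\<^sub>R l b i))) \<le> norm Z * (c b * s\<^sup>2)"
        using l(2)[OF s, of b] by (simp add: mult_mono)
    qed
    also have "\<dots> = C2 * (s\<^sup>2 * norm Z)"
      by (simp add: C2_def sum_distrib_left sum_distrib_right mult_ac)
    finally show ?thesis .
  qed
  have "continuous_on {-1..1} P"
    using P by (meson continuous_at_imp_continuous_on has_vector_derivative_continuous)
  then have "bounded (P ` {-1..1})" by (intro compact_imp_bounded compact_continuous_image) auto
  then obtain R where R: "\<And>s. s \<in> {-1..1} \<Longrightarrow> norm (P s) \<le> R"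
    unfolding bounded_iff by blast
  obtain C3 where C3: "C3 \<ge> 0" "\<And>x y. x \<in> cball 0 (R + 1) \<Longrightarrow> y \<in> cball 0 (R + 1) \<Longrightarrow>
      norm (F y - F x - ?D x (y - x)) \<le> C3 * (norm (y - x))\<^sup>2"
  proof -
    have "smooth_class (Suc (Suc 0)) F" by (rule smooth_class_mono[OF F]) simp
    from smooth_class_quadratic_remainder[OF this compact_cball convex_cball, of 0 "R + 1"]
    show thesis using that by blast
  qed
  define C where "C = C1 + C2 + C3"
  show thesis
  proof (rule that[of C "L 0" "L 1" \<sigma>])
    show "C \<ge> 0" using \<sigma>(1) C2 C3(1) by (simp add: C_def)
    fix s :: real assume s: "\<bar>s\<bar> \<le> 1"
    have "norm (F (P s) - (\<Sum>i<4. s ^ i *\<^sub>R \<sigma> i)) \<le> C1 * \<bar>s\<bar> ^ 4" using \<sigma>(2)[OF s] .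
    also have "\<dots> \<le> C * \<bar>s\<bar> ^ 4" using C2 C3(1) by (intro mult_right_mono) (auto simp: C_def)
    finally show "norm (F (t0 + s, p s) - (\<Sum>i<4. s ^ i *\<^sub>R \<sigma> i)) \<le> C * \<bar>s\<bar> ^ 4"
      by (simp add: P_def)
    fix Z :: 'a assume Z: "norm Z \<le> 1"
    have PZ: "P s + (0, Z) = (t0 + s, p s + Z)" by (simp add: P_def)
    have nP: "norm (P s) \<le> R" using s by (intro R) auto
    have nZ: "norm (0 :: real, Z) = norm Z" by (simp add: norm_Pair)
    have "norm (P s + (0, Z)) \<le> R + 1"
      using norm_triangle_mono[OF nP Z[folded nZ]] .
    then have "norm (F (P s + (0, Z)) - F (P s) - ?D (P s) (0, Z)) \<le> C3 * (norm Z)\<^sup>2"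
      using C3(2)[of "P s" "P s + (0, Z)"] nP nZ by simp
    from norm_triangle_mono[OF this lexp[OF s, of Z]]
    have "norm (F (P s + (0, Z)) - F (P s) - (L 0 Z + s *\<^sub>R L 1 Z)) \<le>
        C3 * (norm Z)\<^sup>2 + C2 * (s\<^sup>2 * norm Z)"
      by (simp only: add_diff_eq diff_add_cancel)
    also have "\<dots> \<le> C * (s\<^sup>2 * norm Z + (norm Z)\<^sup>2)"
      using \<sigma>(1) C2 C3(1) by (simp add: C_def algebra_simps)
    finally show "norm (F (t0 + s, p s + Z) - F (t0 + s, p s) - (L 0 Z + s *\<^sub>R L 1 Z)) \<le>
        C * (s\<^sup>2 * norm Z + (norm Z)\<^sup>2)" by (simp add: PZ) (simp add: P_def)
  qed (use L in auto)
qed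

section \<open>Uniform orders of magnitude as the step size tends to zero\<close>

text \<open>
  The function g is O(H^n) as H tends to 0 from the right, uniformly over the indices in I H. Three kinds
  of indices occur: stages, inner times in {0..H}, and the unit type for plain functions of H (stepO).
\<close>

definition uO :: "(real \<Rightarrow> 'i set) \<Rightarrow> nat \<Rightarrow> (real \<Rightarrow> 'i \<Rightarrow> 'a::real_normed_vector) \<Rightarrow> bool" where
  "uO I n g \<longleftrightarrow> (\<exists>C. \<forall>\<^sub>F H in at_right 0. \<forall>i\<in>I H. norm (g H i) \<le> C * H ^ n)"

abbreviation stepO :: "nat \<Rightarrow> (real \<Rightarrow> 'a::real_normed_vector) \<Rightarrow> bool" where
  "stepO n g \<equiv> uO (\<lambda>_. UNIV :: unit set) n (\<lambda>H _. g H)"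

lemma uOI:
  "\<forall>\<^sub>F H in at_right 0. \<forall>i\<in>I H. norm (g H i) \<le> C * H ^ n \<Longrightarrow> uO I n g"
  unfolding uO_def by blast

lemma eventually_pos: "\<forall>\<^sub>F H in at_right (0::real). 0 < H"
  by (simp add: eventually_at_right_less)

lemma eventually_less: "0 < r \<Longrightarrow> \<forall>\<^sub>F H in at_right (0::real). H < r"
  by (rule eventually_at_rightI[of 0 r]) auto

lemma uOE:
  assumes "uO I n g"
  obtains C where "C \<ge> 0" "\<forall>\<^sub>F H in at_right 0. \<forall>i\<in>I H. norm (g H i) \<le> C * H ^ n"
proof -
  obtain C where C: "\<forall>\<^sub>F H in at_right 0. \<forall>i\<in>I H. norm (g H i) \<le> C * H ^ n"
    using assms unfolding uO_def by blast
  have "\<forall>\<^sub>F H in at_right 0. \<forall>i\<in>I H. norm (g H i) \<le> \<bar>C\<bar> * H ^ n"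
    using C eventually_pos
  proof eventually_elim
    case (elim H)
    then have "C * H ^ n \<le> \<bar>C\<bar> * H ^ n" by (intro mult_right_mono) auto
    with elim(1) show ?case by (meson order_trans)
  qed
  then show thesis using that[of "\<bar>C\<bar>"] by simp
qed

lemma uO_bound:
  assumes "uO I n g" and "\<forall>\<^sub>F H in at_right 0. \<forall>i\<in>I H. norm (f H i) \<le> norm (g H i)"
  shows "uO I n f"
proof -
  obtain C where C: "\<forall>\<^sub>F H in at_right 0. \<forall>i\<in>I H. norm (g H i) \<le> C * H ^ n"
    using assms(1) unfolding uO_def by blast
  have "\<forall>\<^sub>F H in at_right 0. \<forall>i\<in>I H. norm (f H i) \<le> C * H ^ n"
    using C assms(2) by eventually_elim (meson order_trans)
  then show ?thesis by (rule uOI)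
qed

lemma uO_cong:
  assumes "uO I n g" and "\<forall>\<^sub>F H in at_right 0. \<forall>i\<in>I H. f H i = g H i"
  shows "uO I n f"
  by (rule uO_bound[OF assms(1)]) (use assms(2) in eventually_elim, simp)

lemma uO_add:
  assumes "uO I n f" "uO I n g"
  shows "uO I n (\<lambda>H i. f H i + g H i)"
proof -
  obtain C where C: "\<forall>\<^sub>F H in at_right 0. \<forall>i\<in>I H. norm (f H i) \<le> C * H ^ n"
    using assms(1) unfolding uO_def by blast
  obtain D where D: "\<forall>\<^sub>F H in at_right 0. \<forall>i\<in>I H. norm (g H i) \<le> D * H ^ n"
    using assms(2) unfolding uO_def by blast
  have "\<forall>\<^sub>F H in at_right 0. \<forall>i\<in>I H. norm (f H i + g H i) \<le> (C + D) * H ^ n"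
    using C D by eventually_elim (auto simp: ring_distribs intro!: norm_triangle_mono)
  then show ?thesis by (rule uOI)
qed

lemma uO_minus: "uO I n f \<Longrightarrow> uO I n (\<lambda>H i. - f H i)"
  by (simp add: uO_def)

lemma uO_diff: "uO I n f \<Longrightarrow> uO I n g \<Longrightarrow> uO I n (\<lambda>H i. f H i - g H i)"
  using uO_add[of I n f "\<lambda>H i. - g H i"] uO_minus by fastforce

lemma uO_zero: "uO I n (\<lambda>H i. 0)"
proof (rule uOI)
  show "\<forall>\<^sub>F H in at_right 0. \<forall>i\<in>I H. norm (0::'b) \<le> 0 * H ^ n" by simp
qed

lemma uO_sum:
  "finite B \<Longrightarrow> (\<And>b. b \<in> B \<Longrightarrow> uO I n (f b)) \<Longrightarrow> uO I n (\<lambda>H i. \<Sum>b\<in>B. f b H i)"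
  by (induction rule: finite_induct) (simp_all add: uO_zero uO_add)

lemma uO_scaleR:
  assumes "uO I m k" "uO I n g"
  shows "uO I (m + n) (\<lambda>H i. k H i *\<^sub>R g H i)"
proof -
  obtain C where C: "C \<ge> 0" "\<forall>\<^sub>F H in at_right 0. \<forall>i\<in>I H. norm (k H i) \<le> C * H ^ m"
    using uOE[OF assms(1)] by blast
  obtain D where D: "D \<ge> 0" "\<forall>\<^sub>F H in at_right 0. \<forall>i\<in>I H. norm (g H i) \<le> D * H ^ n"
    using uOE[OF assms(2)] by blast
  have "\<forall>\<^sub>F H in at_right 0. \<forall>i\<in>I H. norm (k H i *\<^sub>R g H i) \<le> (C * D) * H ^ (m + n)"
    using C(2) D(2) eventually_pos
  proof eventually_elim
    case (elim H)
    show ?case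
    proof
      fix i assume i: "i \<in> I H"
      have "norm (k H i *\<^sub>R g H i) = norm (k H i) * norm (g H i)" by simp
      also have "\<dots> \<le> (C * H ^ m) * (D * H ^ n)"
        using elim i C(1) by (intro mult_mono) auto
      finally show "norm (k H i *\<^sub>R g H i) \<le> (C * D) * H ^ (m + n)"
        by (simp add: power_add mult_ac)
    qed
  qed
  then show ?thesis by (rule uOI)
qed

lemma uO_const: "uO I 0 (\<lambda>H i. k)"
  by (rule uOI[of _ _ "norm k"]) simp

lemma uO_power: "uO I n (\<lambda>H i. H ^ n)"
  by (rule uOI[of _ _ 1]) (use eventually_pos in eventually_elim, simp)

lemma uO_id: "uO I 1 (\<lambda>H i. H)"
  using uO_power[of I 1] by simp

lemma uO_mono:
  assumes "uO I n g" "m \<le> n"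
  shows "uO I m g"
proof -
  obtain C where C: "C \<ge> 0" "\<forall>\<^sub>F H in at_right 0. \<forall>i\<in>I H. norm (g H i) \<le> C * H ^ n"
    using uOE[OF assms(1)] by blast
  have "\<forall>\<^sub>F H in at_right 0. \<forall>i\<in>I H. norm (g H i) \<le> C * H ^ m"
    using C(2) eventually_pos eventually_less[of 1, simplified]
  proof eventually_elim
    case (elim H)
    then have "H ^ n \<le> H ^ m" using assms(2) by (intro power_decreasing) auto
    then have "C * H ^ n \<le> C * H ^ m" using C(1) by (rule mult_left_mono)
    with elim(1) show ?case by (meson order_trans)
  qed
  then show ?thesis by (rule uOI)
qed

lemma uO_scaleR_const: "uO I n g \<Longrightarrow> uO I n (\<lambda>H i. (r::real) *\<^sub>R g H i)"
  using uO_scaleR[OF uO_const, of I n g r] by simp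

lemma uO_power_scaleR: "uO I n g \<Longrightarrow> uO I (m + n) (\<lambda>H i. H ^ m *\<^sub>R g H i)"
  by (rule uO_scaleR[OF uO_power])

lemma uO_bounded_linear:
  assumes "bounded_linear L" "uO I n g"
  shows "uO I n (\<lambda>H i. L (g H i))"
proof -
  obtain K where K: "\<And>x. norm (L x) \<le> norm x * K" "K \<ge> 0"
    using bounded_linear.nonneg_bounded[OF assms(1)] by blast
  have "uO I n (\<lambda>H i. K *\<^sub>R norm (g H i))"
    by (rule uO_scaleR_const) (use assms(2) in \<open>simp add: uO_def\<close>)
  then show ?thesis
    by (rule uO_bound) (use K in \<open>simp add: mult.commute\<close>)
qed

lemma uO_reindex:
  assumes "uO J n g" and "\<And>H i. i \<in> I H \<Longrightarrow> r H i \<in> J H"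
  shows "uO I n (\<lambda>H i. g H (r H i))"
proof -
  obtain C where "\<forall>\<^sub>F H in at_right 0. \<forall>i\<in>J H. norm (g H i) \<le> C * H ^ n"
    using assms(1) unfolding uO_def by blast
  then have "\<forall>\<^sub>F H in at_right 0. \<forall>i\<in>I H. norm (g H (r H i)) \<le> C * H ^ n"
    by eventually_elim (use assms(2) in blast)
  then show ?thesis by (rule uOI)
qed

lemma uO_at_endpoint:
  assumes "uO (\<lambda>H. {0..H}) n g"
  shows "stepO n (\<lambda>H. g H H)"
proof -
  obtain C where C: "\<forall>\<^sub>F H in at_right 0. \<forall>\<theta>\<in>{0..H}. norm (g H \<theta>) \<le> C * H ^ n"
    using assms unfolding uO_def by blast
  have "\<forall>\<^sub>F H in at_right 0. \<forall>i\<in>(UNIV :: unit set). norm (g H H) \<le> C * H ^ n"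
    using C eventually_pos by eventually_elim simp
  then show ?thesis by (rule uOI)
qed

lemma uO_index_const:
  fixes k :: "'t::finite \<Rightarrow> 'a::real_normed_vector"
  shows "uO (\<lambda>_. UNIV) 0 (\<lambda>H i. k i)"
proof (rule uOI)
  show "\<forall>\<^sub>F H in at_right 0. \<forall>i\<in>UNIV. norm (k i) \<le> (\<Sum>i\<in>UNIV. norm (k i)) * H ^ 0"
    by (auto intro!: always_eventually member_le_sum)
qed

lemma uO_index_monomial:
  fixes k :: "'t::finite \<Rightarrow> 'a::real_normed_vector"
  shows "uO (\<lambda>_. UNIV) n (\<lambda>H i. H ^ n *\<^sub>R k i)"
  using uO_power_scaleR[OF uO_index_const, of n k] by simp

lemma uO_node: "uO (\<lambda>_. UNIV) 1 (\<lambda>H i. c $ i * H)"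
  using uO_index_monomial[of 1 "\<lambda>i. c $ i"] by (simp add: mult.commute)

lemma uO_stage_sum:
  fixes g :: "real \<Rightarrow> 's::finite \<Rightarrow> 'a::real_normed_vector"
  assumes g: "uO (\<lambda>_. UNIV) n g"
  shows "uO (\<lambda>_. UNIV) n (\<lambda>H (i::'t::finite). \<Sum>j\<in>UNIV. k i j *\<^sub>R g H j)"
proof (intro uO_sum)
  fix j :: 's
  have "uO (\<lambda>_. UNIV) n (\<lambda>H (i::'t). g H j)"
    using uO_reindex[OF g, of "\<lambda>_. UNIV" "\<lambda>H (i::'t). j"] by simp
  from uO_scaleR[OF uO_index_const[of "\<lambda>i. k i j"] this]
  show "uO (\<lambda>_. UNIV) n (\<lambda>H i. k i j *\<^sub>R g H j)" by simp
qed simp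

lemma uO_monomial: "uO (\<lambda>_. UNIV) n (\<lambda>H (i::'t::finite). H ^ n * (k i :: real))"
  using uO_index_monomial[of n k] by simp

lemma uO_power_mult:
  fixes g :: "real \<Rightarrow> 'i \<Rightarrow> real"
  shows "uO I n g \<Longrightarrow> uO I (m + n) (\<lambda>H i. H ^ m * g H i)"
  using uO_power_scaleR[of I n g m] by simp

lemma uO_stage_sum_real:
  fixes g :: "real \<Rightarrow> 's::finite \<Rightarrow> real"
  assumes "uO (\<lambda>_. UNIV) n g"
  shows "uO (\<lambda>_. UNIV) n (\<lambda>H (i::'t::finite). \<Sum>j\<in>UNIV. k i j * g H j)"
  using uO_stage_sum[OF assms, of k] by simp

text \<open>
  This extracts order conditions: an error of order n + 1 cannot have a term of order n.
\<close>

lemma uO_monomial_imp_zero: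
  assumes "stepO (Suc n) (\<lambda>H. H ^ n *\<^sub>R x)"
  shows "x = 0"
proof -
  obtain C where "\<forall>\<^sub>F H in at_right 0. \<forall>i\<in>(UNIV :: unit set). norm (H ^ n *\<^sub>R x) \<le> C * H ^ Suc n"
    using assms unfolding uO_def by blast
  then have "\<forall>\<^sub>F H in at_right 0. norm x \<le> C * H"
    using eventually_pos by eventually_elim (simp add: power_abs mult_ac)
  moreover have "((\<lambda>H. C * H) \<longlongrightarrow> C * 0) (at_right 0)" by (intro tendsto_intros)
  ultimately have "norm x \<le> C * 0"
    by (intro tendsto_le[OF trivial_limit_at_right_real _ tendsto_const]) auto
  then show ?thesis by simp
qed

lemma uO_tendsto_0:
  fixes g :: "real \<Rightarrow> 'i \<Rightarrow> 'a::real_normed_vector"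
  assumes "uO (\<lambda>_. UNIV) (Suc n) g"
  shows "((\<lambda>H. g H i) \<longlongrightarrow> 0) (at_right 0)"
proof -
  have "uO (\<lambda>_. UNIV) 1 g" by (rule uO_mono[OF assms]) simp
  then obtain C where "\<forall>\<^sub>F H in at_right 0. \<forall>i\<in>UNIV. norm (g H i) \<le> C * H ^ 1"
    unfolding uO_def by blast
  then have "\<forall>\<^sub>F H in at_right 0. norm (g H i) \<le> C * H"
    by eventually_elim simp
  moreover have "((\<lambda>H. C * H) \<longlongrightarrow> C * 0) (at_right (0::real))" by (intro tendsto_intros)
  ultimately show ?thesis
    using Lim_null_comparison[of "\<lambda>H. g H i" "\<lambda>H. C * H" "at_right 0"] by simp
qed

lemma uO_iff_bigo:
  "stepO n (\<lambda>H. g H) \<longleftrightarrow> (\<lambda>H. norm (g H)) \<in> O[at_right 0](\<lambda>H. H ^ n)"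
proof
  assume "stepO n (\<lambda>H. g H)"
  then obtain C where "\<forall>\<^sub>F H in at_right 0. norm (g H) \<le> C * H ^ n"
    unfolding uO_def by auto
  then have "\<forall>\<^sub>F H in at_right 0. norm (norm (g H)) \<le> C * norm (H ^ n)"
    using eventually_pos by eventually_elim simp
  then show "(\<lambda>H. norm (g H)) \<in> O[at_right 0](\<lambda>H. H ^ n)" by (rule bigoI)
next
  assume "(\<lambda>H. norm (g H)) \<in> O[at_right 0](\<lambda>H. H ^ n)"
  then obtain C where "\<forall>\<^sub>F H in at_right 0. norm (norm (g H)) \<le> C * norm (H ^ n)"
    by (elim landau_o.bigE)
  then have "\<forall>\<^sub>F H in at_right 0. \<forall>i\<in>(UNIV :: unit set). norm (g H) \<le> C * H ^ n"
    using eventually_pos by eventually_elim simp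
  then show "stepO n (\<lambda>H. g H)" by (rule uOI)
qed

section \<open>Solutions of perturbed differential equations\<close>

lemma norm_le_of_derivative_bound:
  fixes E :: "real \<Rightarrow> 'a::euclidean_space"
  assumes der: "\<And>\<theta>. \<theta> \<in> {0..H} \<Longrightarrow> (E has_vector_derivative E' \<theta>) (at \<theta> within {0..H})"
    and t: "t \<in> {0..H}" and B: "\<And>\<theta>. \<theta> \<in> {0<..<t} \<Longrightarrow> norm (E' \<theta>) \<le> B" and "B \<ge> 0"
  shows "norm (E t - E 0) \<le> t * B"
proof (cases "t = 0")
  case False
  with t have t0: "0 < t" by simp
  have "continuous_on {0..H} E"
    using der has_vector_derivative_continuous continuous_on_eq_continuous_within by blast
  then have "continuous_on {0..t} E" using t by (auto elim: continuous_on_subset)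
  moreover have "(E has_derivative (\<lambda>r. r *\<^sub>R E' \<theta>)) (at \<theta>)" if "0 < \<theta>" "\<theta> < t" for \<theta>
    using der[of \<theta>] that t at_within_Icc_at[of 0 \<theta> H] by (simp add: has_vector_derivative_def)
  ultimately obtain \<theta> where "\<theta> \<in> {0<..<t}" "norm (E t - E 0) \<le> norm ((t - 0) *\<^sub>R E' \<theta>)"
    using mvt_general[OF t0, of E "\<lambda>\<theta> r. r *\<^sub>R E' \<theta>"] by blast
  with B[of \<theta>] t0 show ?thesis
    by (auto elim!: order_trans intro: mult_left_mono)
qed simp

text \<open>
  A Gronwall estimate whose hypothesis on the derivative is available only while E stays in the unit
  ball. At the first time t at which E left the ball one would have 1 \<le> t (K + \<epsilon>) < 1, so E never leaves.
  At a maximum point of the norm, with value M, the derivative bound gives M \<le> H (K M + \<epsilon>), and half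
  of M is absorbed by the left-hand side.
\<close>

lemma deviation_bound:
  fixes E :: "real \<Rightarrow> 'a::euclidean_space"
  assumes der: "\<And>\<theta>. \<theta> \<in> {0..H} \<Longrightarrow> (E has_vector_derivative E' \<theta>) (at \<theta> within {0..H})"
    and E0: "E 0 = 0" and K: "K \<ge> 0" "\<epsilon> \<ge> 0"
    and bound: "\<And>\<theta>. \<theta> \<in> {0..H} \<Longrightarrow> norm (E \<theta>) \<le> 1 \<Longrightarrow> norm (E' \<theta>) \<le> K * norm (E \<theta>) + \<epsilon>"
    and small: "H * (K + \<epsilon>) < 1" "H * K \<le> 1 / 2" and \<theta>: "\<theta> \<in> {0..H}"
  shows "norm (E \<theta>) \<le> 2 * H * \<epsilon>"
proof -
  have cont: "continuous_on {0..H} (\<lambda>\<theta>. norm (E \<theta>))"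
    using der has_vector_derivative_continuous continuous_on_eq_continuous_within
    by (blast intro: continuous_on_norm)
  have lt1: "norm (E \<theta>) < 1" if "\<theta> \<in> {0..H}" for \<theta>
  proof (rule ccontr)
    assume "\<not> norm (E \<theta>) < 1"
    define T where "T = {\<theta> \<in> {0..H}. 1 \<le> norm (E \<theta>)}"
    have "T \<noteq> {}" using that \<open>\<not> norm (E \<theta>) < 1\<close> by (auto simp: T_def)
    moreover have "compact T"
    proof -
      have "closed T" unfolding T_def
        by (rule continuous_on_closed_Collect_le[OF continuous_on_const cont closed_atLeastAtMost])
      moreover have "bounded T" by (rule bounded_subset[of "{0..H}"]) (auto simp: T_def)
      ultimately show ?thesis by (simp add: compact_eq_bounded_closed)
    qed
    ultimately obtain t where t: "t \<in> T" "\<And>s. s \<in> T \<Longrightarrow> t \<le> s"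
      using compact_attains_inf[of T] by blast
    have "norm (E t - E 0) \<le> t * (K + \<epsilon>)"
    proof (rule norm_le_of_derivative_bound[OF der])
      show "t \<in> {0..H}" using t(1) by (simp add: T_def)
      fix s assume s: "s \<in> {0<..<t}"
      have sH: "s \<in> {0..H}" using s t(1) by (auto simp: T_def)
      have "s \<notin> T" using t(2)[of s] s by auto
      with sH have "norm (E s) < 1" by (auto simp: T_def)
      moreover from this have "K * norm (E s) \<le> K" using K by (simp add: mult_left_le)
      ultimately show "norm (E' s) \<le> K + \<epsilon>" using bound[OF sH] by simp
    qed (use K in auto)
    also have "\<dots> \<le> H * (K + \<epsilon>)" using t(1) K by (auto simp: T_def intro: mult_right_mono)
    also have "\<dots> < 1" by fact
    finally show False using t(1) E0 by (simp add: T_def)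
  qed
  have "{0..H} \<noteq> {}" using \<theta> by auto
  then obtain t where t: "t \<in> {0..H}" "\<And>s. s \<in> {0..H} \<Longrightarrow> norm (E s) \<le> norm (E t)"
    using continuous_attains_sup[OF compact_Icc _ cont] by blast
  let ?m = "norm (E t)"
  have "norm (E t - E 0) \<le> t * (K * ?m + \<epsilon>)"
  proof (rule norm_le_of_derivative_bound[OF der])
    fix s assume s: "s \<in> {0<..<t}"
    then have sH: "s \<in> {0..H}" using t(1) by auto
    have "norm (E' s) \<le> K * norm (E s) + \<epsilon>" using bound[OF sH] lt1[OF sH] by simp
    also have "\<dots> \<le> K * ?m + \<epsilon>" using t(2)[OF sH] K by (simp add: mult_left_mono)
    finally show "norm (E' s) \<le> K * ?m + \<epsilon>" .
  qed (use K t in auto)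
  also have "\<dots> \<le> H * (K * ?m + \<epsilon>)" using t(1) K by (auto intro: mult_right_mono)
  also have "\<dots> = H * K * ?m + H * \<epsilon>" by (simp add: algebra_simps)
  also have "H * K * ?m \<le> 1 / 2 * ?m" using small(2) by (rule mult_right_mono) simp
  finally have "?m \<le> 2 * H * \<epsilon>" using E0 by simp
  with t(2)[OF \<theta>] show ?thesis by linarith
qed

lemma uO_deviation:
  fixes E E' :: "real \<Rightarrow> real \<Rightarrow> 'a::euclidean_space"
  assumes der: "\<forall>\<^sub>F H in at_right 0. \<forall>\<theta>\<in>{0..H}. (E H has_vector_derivative E' H \<theta>) (at \<theta> within {0..H})"
    and E0: "\<forall>\<^sub>F H in at_right 0. E H 0 = 0"
    and bound: "\<forall>\<^sub>F H in at_right 0. \<forall>\<theta>\<in>{0..H}. norm (E H \<theta>) \<le> 1 \<longrightarrow>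
      norm (E' H \<theta>) \<le> K * norm (E H \<theta>) + C * H ^ n"
    and K: "K \<ge> 0" and C: "C \<ge> 0"
  shows "uO (\<lambda>H. {0..H}) (Suc n) E"
proof -
  have pos: "1 / (2 * (K + C + 1)) > 0" using K C by simp
  have "\<forall>\<^sub>F H in at_right 0. \<forall>\<theta>\<in>{0..H}. norm (E H \<theta>) \<le> (2 * C) * H ^ Suc n"
    using der E0 bound eventually_pos eventually_less[of 1, simplified] eventually_less[OF pos]
  proof eventually_elim
    case (elim H)
    have "K + C + 1 > 0" using K C by simp
    then have KC: "H * (K + C + 1) < 1 / 2" using elim(6) by (simp add: field_simps)
    have HC: "C * H ^ n \<le> C" "H * C \<ge> 0" "H * K \<ge> 0"
      using C K elim(4,5) by (auto simp: mult_left_le power_le_one)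
    show ?case
    proof
      fix \<theta> assume \<theta>: "\<theta> \<in> {0..H}"
      have "norm (E H \<theta>) \<le> 2 * H * (C * H ^ n)"
      proof (rule deviation_bound[where E = "E H" and H = H and K = K and E' = "E' H"])
        have "H * (K + C * H ^ n) \<le> H * (K + C)" using elim(4) HC by (intro mult_left_mono add_left_mono) auto
        then show "H * (K + C * H ^ n) < 1" using KC elim(4) by (simp add: algebra_simps)
        show "H * K \<le> 1 / 2" using KC elim(4) HC by (simp add: algebra_simps)
      qed (use elim K C \<theta> in auto)
      then show "norm (E H \<theta>) \<le> (2 * C) * H ^ Suc n" by (simp add: mult_ac)
    qed
  qed
  then show ?thesis by (rule uOI)
qed

section \<open>Polynomial approximation of the exact solution\<close>

definition poly_curve :: "nat \<Rightarrow> (nat \<Rightarrow> 'a::real_vector) \<Rightarrow> real \<Rightarrow> 'a" where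
  "poly_curve n a s = (\<Sum>i<n. s ^ i *\<^sub>R a i)"

definition poly_curve_deriv :: "(nat \<Rightarrow> 'a::real_vector) \<Rightarrow> nat \<Rightarrow> 'a" where
  "poly_curve_deriv a i = real (Suc i) *\<^sub>R a (Suc i)"

lemma poly_curve_has_vector_derivative:
  "(poly_curve (Suc n) a has_vector_derivative poly_curve n (poly_curve_deriv a) s) (at s within S)"
  unfolding poly_curve_def[abs_def] poly_curve_deriv_def by (rule has_vector_derivative_poly)

lemma continuous_poly_curve:
  fixes a :: "nat \<Rightarrow> 'a::real_normed_vector"
  shows "continuous_on S (poly_curve n a)"
  unfolding poly_curve_def[abs_def] by (intro continuous_intros)

lemma poly_curve_0: "poly_curve (Suc n) a 0 = a 0"
  by (simp add: poly_curve_def sum.lessThan_Suc_shift del: sum.lessThan_Suc)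

text \<open>
  The conclusion of \<open>tube_expansion\<close> without its constants. The coefficients \<sigma> of the field on the curve
  and the Jacobians L0 and L1 remain visible, because the local error is expressed in them.
\<close>

definition expands_along ::
  "(real \<Rightarrow> 'a::euclidean_space \<Rightarrow> 'b::euclidean_space) \<Rightarrow> real \<Rightarrow> (real \<Rightarrow> 'a) \<Rightarrow>
   (nat \<Rightarrow> 'b) \<Rightarrow> ('a \<Rightarrow> 'b) \<Rightarrow> ('a \<Rightarrow> 'b) \<Rightarrow> bool" where
  "expands_along F t0 p \<sigma> L0 L1 \<longleftrightarrow> bounded_linear L0 \<and> bounded_linear L1 \<and>
     (\<exists>C\<ge>0. (\<forall>s. \<bar>s\<bar> \<le> 1 \<longrightarrow> norm (F (t0 + s) (p s) - poly_curve 4 \<sigma> s) \<le> C * \<bar>s\<bar> ^ 4) \<and>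
       (\<forall>s Z. \<bar>s\<bar> \<le> 1 \<longrightarrow> norm Z \<le> 1 \<longrightarrow>
          norm (F (t0 + s) (p s + Z) - F (t0 + s) (p s) - (L0 Z + s *\<^sub>R L1 Z)) \<le>
            C * (s\<^sup>2 * norm Z + (norm Z)\<^sup>2)))"

lemma smooth_imp_expands_along:
  assumes "smooth_class 4 (\<lambda>(t, x). F t x)"
  shows "\<exists>\<sigma> L0 L1. expands_along F t0 (poly_curve (Suc n) a) \<sigma> L0 L1"
proof (rule tube_expansion[OF assms, where ?t0.0 = t0 and n = n and a = a])
  fix \<sigma> L0 L1 C
  assume "C \<ge> 0" "bounded_linear L0" "bounded_linear L1"
    "\<And>s. \<bar>s\<bar> \<le> 1 \<Longrightarrow> norm ((case (t0 + s, \<Sum>i<Suc n. s ^ i *\<^sub>R a i) of (t, x) \<Rightarrow> F t x) -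
        (\<Sum>i<4. s ^ i *\<^sub>R \<sigma> i)) \<le> C * \<bar>s\<bar> ^ 4"
    "\<And>s Z. \<bar>s\<bar> \<le> 1 \<Longrightarrow> norm Z \<le> 1 \<Longrightarrow>
       norm ((case (t0 + s, (\<Sum>i<Suc n. s ^ i *\<^sub>R a i) + Z) of (t, x) \<Rightarrow> F t x) -
          (case (t0 + s, \<Sum>i<Suc n. s ^ i *\<^sub>R a i) of (t, x) \<Rightarrow> F t x) -
          (L0 Z + s *\<^sub>R L1 Z)) \<le> C * (s\<^sup>2 * norm Z + (norm Z)\<^sup>2)"
  then have "expands_along F t0 (poly_curve (Suc n) a) \<sigma> L0 L1"
    unfolding expands_along_def poly_curve_def prod.case by (intro conjI exI[of _ C]) auto
  then show ?thesis by blast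
qed

lemma expands_along_add:
  assumes "expands_along F t0 p \<sigma> L0 L1" "expands_along G t0 p \<tau> N0 N1"
  shows "expands_along (\<lambda>t x. F t x + G t x) t0 p (\<lambda>i. \<sigma> i + \<tau> i)
     (\<lambda>Z. L0 Z + N0 Z) (\<lambda>Z. L1 Z + N1 Z)"
proof -
  obtain C where C: "C \<ge> 0"
    "\<And>s. \<bar>s\<bar> \<le> 1 \<Longrightarrow> norm (F (t0 + s) (p s) - poly_curve 4 \<sigma> s) \<le> C * \<bar>s\<bar> ^ 4"
    "\<And>s Z. \<bar>s\<bar> \<le> 1 \<Longrightarrow> norm Z \<le> 1 \<Longrightarrow>
       norm (F (t0 + s) (p s + Z) - F (t0 + s) (p s) - (L0 Z + s *\<^sub>R L1 Z)) \<le> C * (s\<^sup>2 * norm Z + (norm Z)\<^sup>2)"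
    using assms(1) unfolding expands_along_def by blast
  obtain D where D: "D \<ge> 0"
    "\<And>s. \<bar>s\<bar> \<le> 1 \<Longrightarrow> norm (G (t0 + s) (p s) - poly_curve 4 \<tau> s) \<le> D * \<bar>s\<bar> ^ 4"
    "\<And>s Z. \<bar>s\<bar> \<le> 1 \<Longrightarrow> norm Z \<le> 1 \<Longrightarrow>
       norm (G (t0 + s) (p s + Z) - G (t0 + s) (p s) - (N0 Z + s *\<^sub>R N1 Z)) \<le> D * (s\<^sup>2 * norm Z + (norm Z)\<^sup>2)"
    using assms(2) unfolding expands_along_def by blast
  have "norm (F (t0 + s) (p s) + G (t0 + s) (p s) - poly_curve 4 (\<lambda>i. \<sigma> i + \<tau> i) s) \<le> (C + D) * \<bar>s\<bar> ^ 4"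
    if "\<bar>s\<bar> \<le> 1" for s
  proof -
    have eq: "F (t0 + s) (p s) + G (t0 + s) (p s) - poly_curve 4 (\<lambda>i. \<sigma> i + \<tau> i) s =
      (F (t0 + s) (p s) - poly_curve 4 \<sigma> s) + (G (t0 + s) (p s) - poly_curve 4 \<tau> s)"
      by (simp add: poly_curve_def scaleR_add_right sum.distrib)
    show ?thesis
      unfolding eq ring_distribs by (rule norm_triangle_mono[OF C(2)[OF that] D(2)[OF that]])
  qed
  moreover have "norm (F (t0 + s) (p s + Z) + G (t0 + s) (p s + Z) - (F (t0 + s) (p s) + G (t0 + s) (p s)) -
        (L0 Z + N0 Z + s *\<^sub>R (L1 Z + N1 Z))) \<le> (C + D) * (s\<^sup>2 * norm Z + (norm Z)\<^sup>2)"
    if "\<bar>s\<bar> \<le> 1" "norm Z \<le> 1" for s Z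
  proof -
    have eq: "F (t0 + s) (p s + Z) + G (t0 + s) (p s + Z) - (F (t0 + s) (p s) + G (t0 + s) (p s)) -
        (L0 Z + N0 Z + s *\<^sub>R (L1 Z + N1 Z)) =
      (F (t0 + s) (p s + Z) - F (t0 + s) (p s) - (L0 Z + s *\<^sub>R L1 Z)) +
      (G (t0 + s) (p s + Z) - G (t0 + s) (p s) - (N0 Z + s *\<^sub>R N1 Z))"
      by (simp add: scaleR_add_right)
    show ?thesis
      unfolding eq distrib_right[of C D] by (rule norm_triangle_mono[OF C(3)[OF that] D(3)[OF that]])
  qed
  moreover have "bounded_linear (\<lambda>Z. L0 Z + N0 Z)" "bounded_linear (\<lambda>Z. L1 Z + N1 Z)"
    using assms unfolding expands_along_def by (auto intro: bounded_linear_add)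
  moreover have "C + D \<ge> 0" using C(1) D(1) by simp
  ultimately show ?thesis unfolding expands_along_def by blast
qed

lemma expands_along_lipschitz:
  assumes "expands_along F t0 p \<sigma> L0 L1"
  obtains K where "K \<ge> 0"
    "\<And>s Z. \<bar>s\<bar> \<le> 1 \<Longrightarrow> norm Z \<le> 1 \<Longrightarrow> norm (F (t0 + s) (p s + Z) - F (t0 + s) (p s)) \<le> K * norm Z"
proof -
  obtain C where C: "C \<ge> 0"
    "\<And>s Z. \<bar>s\<bar> \<le> 1 \<Longrightarrow> norm Z \<le> 1 \<Longrightarrow>
       norm (F (t0 + s) (p s + Z) - F (t0 + s) (p s) - (L0 Z + s *\<^sub>R L1 Z)) \<le> C * (s\<^sup>2 * norm Z + (norm Z)\<^sup>2)"
    and L: "bounded_linear L0" "bounded_linear L1"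
    using assms unfolding expands_along_def by blast
  obtain K0 where K0: "K0 \<ge> 0" "\<And>Z. norm (L0 Z) \<le> norm Z * K0"
    using bounded_linear.nonneg_bounded[OF L(1)] by blast
  obtain K1 where K1: "K1 \<ge> 0" "\<And>Z. norm (L1 Z) \<le> norm Z * K1"
    using bounded_linear.nonneg_bounded[OF L(2)] by blast
  show thesis
  proof (rule that[of "2 * C + K0 + K1"])
    show "2 * C + K0 + K1 \<ge> 0" using C(1) K0(1) K1(1) by simp
    fix s :: real and Z :: 'a assume s: "\<bar>s\<bar> \<le> 1" and Z: "norm Z \<le> 1"
    have a: "norm (s *\<^sub>R L1 Z) \<le> norm Z * K1"
      using s K1(2)[of Z] mult_mono[of "\<bar>s\<bar>" 1 "norm (L1 Z)" "norm Z * K1"] by simp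
    have "s\<^sup>2 * norm Z \<le> 1 * norm Z" using s by (intro mult_right_mono) (auto simp: abs_square_le_1)
    moreover have "(norm Z)\<^sup>2 \<le> 1 * norm Z" unfolding power2_eq_square using Z by (intro mult_right_mono) auto
    ultimately have "s\<^sup>2 * norm Z + (norm Z)\<^sup>2 \<le> 2 * norm Z" by simp
    then have b: "C * (s\<^sup>2 * norm Z + (norm Z)\<^sup>2) \<le> C * (2 * norm Z)" using C(1) by (rule mult_left_mono)
    have "norm (F (t0 + s) (p s + Z) - F (t0 + s) (p s)) =
       norm ((F (t0 + s) (p s + Z) - F (t0 + s) (p s) - (L0 Z + s *\<^sub>R L1 Z)) + (L0 Z + s *\<^sub>R L1 Z))"
      by simp
    also have "\<dots> \<le> C * (2 * norm Z) + (norm Z * K0 + norm Z * K1)"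
      by (rule norm_triangle_mono[OF order_trans[OF C(2)[OF s Z] b] norm_triangle_mono[OF K0(2) a]])
    finally show "norm (F (t0 + s) (p s + Z) - F (t0 + s) (p s)) \<le> (2 * C + K0 + K1) * norm Z"
      by (simp add: algebra_simps)
  qed
qed

lemma uO_le_1:
  assumes "uO I (Suc n) g"
  shows "\<forall>\<^sub>F H in at_right 0. \<forall>i\<in>I H. norm (g H i) \<le> 1"
proof -
  have "uO I 1 g" by (rule uO_mono[OF assms]) simp
  then obtain D where D: "D \<ge> 0" "\<forall>\<^sub>F H in at_right 0. \<forall>i\<in>I H. norm (g H i) \<le> D * H ^ 1"
    using uOE by blast
  have D1: "1 / (D + 1) > 0" using D(1) by simp
  show ?thesis using D(2) eventually_pos eventually_less[OF D1]
  proof eventually_elim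
    case (elim H)
    have "(D + 1) * H < 1" using elim(3) D(1) by (simp add: field_simps)
    then have "D * H \<le> 1" using elim(2) by (simp add: algebra_simps)
    then show ?case using elim(1) by fastforce
  qed
qed

lemma uO_local_power:
  assumes h: "\<And>s. \<bar>s\<bar> \<le> 1 \<Longrightarrow> norm (h s) \<le> C * \<bar>s\<bar> ^ n" and C: "C \<ge> 0" and s: "uO I 1 s"
  shows "uO I n (\<lambda>H i. h (s H i))"
proof -
  obtain D where D: "D \<ge> 0" "\<forall>\<^sub>F H in at_right 0. \<forall>i\<in>I H. norm (s H i) \<le> D * H ^ 1"
    using uOE[OF s] by blast
  have "\<forall>\<^sub>F H in at_right 0. \<forall>i\<in>I H. norm (h (s H i)) \<le> (C * D ^ n) * H ^ n"
    using D(2) uO_le_1[OF s[unfolded One_nat_def]]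
  proof eventually_elim
    case (elim H)
    show ?case
    proof
      fix i assume i: "i \<in> I H"
      have si: "\<bar>s H i\<bar> \<le> D * H" "\<bar>s H i\<bar> \<le> 1" using elim i by auto
      have "norm (h (s H i)) \<le> C * \<bar>s H i\<bar> ^ n" by (rule h[OF si(2)])
      also have "\<dots> \<le> C * (D * H) ^ n" using si C by (intro mult_left_mono power_mono) auto
      finally show "norm (h (s H i)) \<le> (C * D ^ n) * H ^ n" by (simp add: power_mult_distrib)
    qed
  qed
  then show ?thesis by (rule uOI)
qed

lemma uO_expand_value:
  assumes F: "expands_along F t0 p \<sigma> L0 L1" and s: "uO I 1 s"
  shows "uO I 4 (\<lambda>H i. F (t0 + s H i) (p (s H i)) - poly_curve 4 \<sigma> (s H i))"
proof -
  obtain C where C: "C \<ge> 0"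
    "\<And>s. \<bar>s\<bar> \<le> 1 \<Longrightarrow> norm (F (t0 + s) (p s) - poly_curve 4 \<sigma> s) \<le> C * \<bar>s\<bar> ^ 4"
    using F unfolding expands_along_def by blast
  show ?thesis by (rule uO_local_power[OF C(2,1) s])
qed

text \<open>
  For Z of size H^2 the remainder of the linearization, of size s^2 |Z| + |Z|^2, is of size H^4.
\<close>

lemma uO_expand_increment:
  assumes F: "expands_along F t0 p \<sigma> L0 L1" and s: "uO I 1 s" and Z: "uO I 2 Z"
  shows "uO I 4 (\<lambda>H i. F (t0 + s H i) (p (s H i) + Z H i) - F (t0 + s H i) (p (s H i)) -
    (L0 (Z H i) + s H i *\<^sub>R L1 (Z H i)))"
proof -
  obtain C where C: "C \<ge> 0"
    "\<And>s Z. \<bar>s\<bar> \<le> 1 \<Longrightarrow> norm Z \<le> 1 \<Longrightarrow>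
       norm (F (t0 + s) (p s + Z) - F (t0 + s) (p s) - (L0 Z + s *\<^sub>R L1 Z)) \<le> C * (s\<^sup>2 * norm Z + (norm Z)\<^sup>2)"
    using F unfolding expands_along_def by blast
  have nZ: "uO I 2 (\<lambda>H i. norm (Z H i))" using Z by (simp add: uO_def)
  have "uO I 4 (\<lambda>H i. C *\<^sub>R (s H i *\<^sub>R s H i *\<^sub>R norm (Z H i) + norm (Z H i) *\<^sub>R norm (Z H i)))"
    using uO_scaleR[OF s uO_scaleR[OF s nZ]] uO_scaleR[OF nZ nZ]
    by (intro uO_scaleR_const uO_add) (simp_all add: numeral_eq_Suc)
  moreover have "\<forall>\<^sub>F H in at_right 0. \<forall>i\<in>I H.
      norm (F (t0 + s H i) (p (s H i) + Z H i) - F (t0 + s H i) (p (s H i)) -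
        (L0 (Z H i) + s H i *\<^sub>R L1 (Z H i))) \<le>
      norm (C *\<^sub>R (s H i *\<^sub>R s H i *\<^sub>R norm (Z H i) + norm (Z H i) *\<^sub>R norm (Z H i)))"
    using uO_le_1[OF s[unfolded One_nat_def]] uO_le_1[OF Z[unfolded numeral_2_eq_2]]
  proof eventually_elim
    case (elim H)
    show ?case
    proof
      fix i assume i: "i \<in> I H"
      then have sZ: "\<bar>s H i\<bar> \<le> 1" "norm (Z H i) \<le> 1" using elim by auto
      have "norm (F (t0 + s H i) (p (s H i) + Z H i) - F (t0 + s H i) (p (s H i)) -
        (L0 (Z H i) + s H i *\<^sub>R L1 (Z H i))) \<le> C * ((s H i)\<^sup>2 * norm (Z H i) + (norm (Z H i))\<^sup>2)"
        by (rule C(2)[OF sZ])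
      also have "\<dots> \<le> C * \<bar>s H i * (s H i * norm (Z H i)) + norm (Z H i) * norm (Z H i)\<bar>"
        using C(1) by (intro mult_left_mono) (auto simp: power2_eq_square mult.assoc)
      finally show "norm (F (t0 + s H i) (p (s H i) + Z H i) - F (t0 + s H i) (p (s H i)) -
        (L0 (Z H i) + s H i *\<^sub>R L1 (Z H i))) \<le>
         norm (C *\<^sub>R (s H i *\<^sub>R s H i *\<^sub>R norm (Z H i) + norm (Z H i) *\<^sub>R norm (Z H i)))"
        using C(1) by simp
    qed
  qed
  ultimately show ?thesis by (rule uO_bound)
qed

text \<open>
  Times s of either sign are included, because the curve is later evaluated at c_i H for arbitrary nodes.
\<close>

definition approx_solution :: "(real \<Rightarrow> 'a \<Rightarrow> 'a) \<Rightarrow> real \<Rightarrow> 'a \<Rightarrow> nat \<Rightarrow> (nat \<Rightarrow> 'a::euclidean_space) \<Rightarrow> bool" where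
  "approx_solution f t0 y0 m a \<longleftrightarrow> a 0 = y0 \<and> (\<exists>C\<ge>0. \<forall>s. \<bar>s\<bar> \<le> 1 \<longrightarrow>
     norm (poly_curve 4 (poly_curve_deriv a) s - f (t0 + s) (poly_curve 5 a s)) \<le> C * \<bar>s\<bar> ^ m)"

lemma smooth_lipschitz_curves:
  fixes F :: "real \<Rightarrow> 'a::euclidean_space \<Rightarrow> 'b::euclidean_space" and p q :: "real \<Rightarrow> 'a"
  assumes F: "smooth_class (Suc 0) (\<lambda>(t, x). F t x)"
    and "continuous_on UNIV p" "continuous_on UNIV q"
  shows "\<exists>K\<ge>0. \<forall>s. \<bar>s\<bar> \<le> 1 \<longrightarrow> norm (F (t0 + s) (p s) - F (t0 + s) (q s)) \<le> K * norm (p s - q s)"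
proof -
  define P where "P = (\<lambda>s. (t0 + s, p s)) ` {-1..1} \<union> (\<lambda>s. (t0 + s, q s)) ` {-1..1}"
  have "compact P"
    unfolding P_def using assms(2,3) by (intro compact_Un compact_continuous_image continuous_intros)
      (auto intro: continuous_on_subset)
  then have "bounded P" by (rule compact_imp_bounded)
  then obtain R where R: "\<And>z. z \<in> P \<Longrightarrow> norm z \<le> R"
    unfolding bounded_iff by blast
  from smooth_class_lipschitz[OF F compact_cball convex_cball, of 0 R] obtain K where K: "K \<ge> 0" "\<And>x y. x \<in> cball 0 R \<Longrightarrow> y \<in> cball 0 R \<Longrightarrow>
      norm ((case x of (t, x) \<Rightarrow> F t x) - (case y of (t, x) \<Rightarrow> F t x)) \<le> K * norm (x - y)"
    by blast
  have "norm (F (t0 + s) (p s) - F (t0 + s) (q s)) \<le> K * norm (p s - q s)" if s: "\<bar>s\<bar> \<le> 1" for s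
  proof -
    have "(t0 + s, p s) \<in> cball 0 R" "(t0 + s, q s) \<in> cball 0 R"
      using R[of "(t0 + s, p s)"] R[of "(t0 + s, q s)"] s by (auto simp: abs_le_iff P_def)
    from K(2)[OF this] show ?thesis by (simp add: norm_Pair)
  qed
  with K(1) show ?thesis by blast
qed

text \<open>
  Picard iteration on polynomials: the derivative of the next curve is the cubic Taylor polynomial of
  the field along the present curve. The integration gains one order in each round, until the accuracy of
  the Taylor polynomial is reached. Such a curve replaces the Taylor polynomial of the exact solution;
  no higher derivatives of the solution have to be computed, and the curve also exists for negative times.
\<close>

lemma approx_solution_exists:
  assumes F: "smooth_class 4 (\<lambda>(t, x). f t x)"
  shows "m \<le> 4 \<Longrightarrow> \<exists>a. approx_solution f t0 y0 m a"
proof (induction m)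
  case 0
  define a where "a i = (if i = 0 then y0 else 0)" for i :: nat
  have "continuous_on UNIV (\<lambda>s. (t0 + s, poly_curve 5 a s))"
    by (intro continuous_intros continuous_poly_curve)
  with smooth_class_continuous[OF F]
  have "continuous_on UNIV (\<lambda>s. f (t0 + s) (poly_curve 5 a s))"
    using continuous_on_compose2[of UNIV "\<lambda>(t, x). f t x" UNIV "\<lambda>s. (t0 + s, poly_curve 5 a s)"] by simp
  then have "continuous_on UNIV (\<lambda>s. poly_curve 4 (poly_curve_deriv a) s - f (t0 + s) (poly_curve 5 a s))"
    by (intro continuous_on_diff continuous_poly_curve)
  from has_expansionE[OF has_expansion_0[OF this]]
  obtain C where "C \<ge> 0" "\<And>s. \<bar>s\<bar> \<le> 1 \<Longrightarrow>
      norm (poly_curve 4 (poly_curve_deriv a) s - f (t0 + s) (poly_curve 5 a s)) \<le> C * \<bar>s\<bar> ^ 0"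
    by (metis (no_types, lifting) diff_zero lessThan_0 sum.empty)
  then have "approx_solution f t0 y0 0 a" unfolding approx_solution_def a_def by auto
  then show ?case by blast
next
  case (Suc m)
  then obtain a C where a0: "a 0 = y0" and C: "C \<ge> 0" "\<And>s. \<bar>s\<bar> \<le> 1 \<Longrightarrow>
      norm (poly_curve 4 (poly_curve_deriv a) s - f (t0 + s) (poly_curve 5 a s)) \<le> C * \<bar>s\<bar> ^ m"
    unfolding approx_solution_def by auto
  have five: "Suc 4 = 5" by simp
  obtain \<sigma> L0 L1 where "expands_along f t0 (poly_curve (Suc 4) a) \<sigma> L0 L1"
    using smooth_imp_expands_along[OF F] by blast
  then obtain D where D: "D \<ge> 0"
    "\<And>s. \<bar>s\<bar> \<le> 1 \<Longrightarrow> norm (f (t0 + s) (poly_curve 5 a s) - poly_curve 4 \<sigma> s) \<le> D * \<bar>s\<bar> ^ 4"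
    unfolding expands_along_def five by blast
  \<comment> \<open>the curve through y0 whose derivative is the Taylor polynomial with coefficients \<sigma>\<close>
  define b where "b i = (case i of 0 \<Rightarrow> y0 | Suc j \<Rightarrow> (1 / real (Suc j)) *\<^sub>R \<sigma> j)" for i
  have b': "poly_curve_deriv b = \<sigma>"
    by (rule ext) (simp add: poly_curve_deriv_def b_def del: of_nat_Suc)
  let ?p = "poly_curve 5 a" and ?q = "poly_curve 5 b"
  have pow: "\<bar>s\<bar> ^ 4 \<le> \<bar>s\<bar> ^ k" if "\<bar>s\<bar> \<le> 1" "k \<le> 4" for s :: real and k
    using that by (intro power_decreasing) auto
  have D': "norm (f (t0 + s) (?p s) - poly_curve 4 \<sigma> s) \<le> D * \<bar>s\<bar> ^ k" if "\<bar>s\<bar> \<le> 1" "k \<le> 4" for s k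
    using D(2)[OF that(1)] mult_left_mono[OF pow[OF that] D(1)] by linarith
  have "norm ((?q s - ?p s) - (?q 0 - ?p 0)) \<le> (D + C) * \<bar>s\<bar> ^ Suc m" if s: "\<bar>s\<bar> \<le> 1" for s
  proof (rule norm_le_integrated_power[OF _ _ s])
    fix s :: real assume s: "\<bar>s\<bar> \<le> 1"
    show "((\<lambda>s. ?q s - ?p s) has_vector_derivative
        poly_curve 4 \<sigma> s - poly_curve 4 (poly_curve_deriv a) s) (at s)"
      using has_vector_derivative_diff[OF poly_curve_has_vector_derivative[of 4 b s UNIV]
          poly_curve_has_vector_derivative[of 4 a s UNIV]]
      by (simp only: b' five)
    have "m \<le> 4" using Suc.prems by simp
    from norm_triangle_mono[OF D'[OF s this] C(2)[OF s]]
    show "norm (poly_curve 4 \<sigma> s - poly_curve 4 (poly_curve_deriv a) s) \<le> (D + C) * \<bar>s\<bar> ^ m"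
      unfolding distrib_right by (subst norm_minus_commute) (simp add: algebra_simps)
  qed
  moreover have "?q 0 - ?p 0 = 0"
    using poly_curve_0[of 4 a] poly_curve_0[of 4 b] a0 by (simp add: b_def)
  ultimately have diff: "norm (?q s - ?p s) \<le> (D + C) * \<bar>s\<bar> ^ Suc m" if "\<bar>s\<bar> \<le> 1" for s
    using that by simp
  have "smooth_class (Suc 0) (\<lambda>(t, x). f t x)" by (rule smooth_class_mono[OF F]) simp
  from smooth_lipschitz_curves[OF this continuous_poly_curve continuous_poly_curve]
  obtain K where K: "K \<ge> 0" "\<And>s. \<bar>s\<bar> \<le> 1 \<Longrightarrow>
      norm (f (t0 + s) (?p s) - f (t0 + s) (?q s)) \<le> K * norm (?p s - ?q s)" by meson
  have "norm (poly_curve 4 (poly_curve_deriv b) s - f (t0 + s) (?q s)) \<le> (D + K * (D + C)) * \<bar>s\<bar> ^ Suc m"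
    if s: "\<bar>s\<bar> \<le> 1" for s
  proof -
    have "norm (f (t0 + s) (?p s) - f (t0 + s) (?q s)) \<le> K * ((D + C) * \<bar>s\<bar> ^ Suc m)"
      using K(2)[OF s] mult_left_mono[OF diff[OF s] K(1)] by (simp only: norm_minus_commute)
    from norm_triangle_mono[OF D'[OF s Suc.prems, unfolded norm_minus_commute[of "f _ _"]] this]
    show ?thesis unfolding b' by (simp add: algebra_simps)
  qed
  moreover have "D + K * (D + C) \<ge> 0" using D(1) K(1) C(1) by simp
  ultimately have "approx_solution f t0 y0 (Suc m) b"
    unfolding approx_solution_def by (auto simp: b_def)
  then show ?case by blast
qed

section \<open>Expansion of the stages\<close>

text \<open>
  The defect, times k, of the simplifying assumption \<Sum>_j a_ij c_j^(k - 1) = c_i^k / k. It is the factor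
  of the k-th coefficient of a curve in the residual of the stage equations.
\<close>

definition stage_defect :: "real^'s^'s \<Rightarrow> real^'s \<Rightarrow> nat \<Rightarrow> real^'s" where
  "stage_defect A c k = (\<chi> i. real k * (\<Sum>j\<in>UNIV. A $ i $ j * c $ j ^ (k - 1)) - c $ i ^ k)"

text \<open>
  The stages are defined implicitly. The factor H in front of their coupling makes it possible to absorb
  the coupling for small H.
\<close>

lemma uO_absorb:
  fixes Z :: "real \<Rightarrow> 's::finite \<Rightarrow> 'a::real_normed_vector"
  assumes R: "uO (\<lambda>_. UNIV) n R"
    and le: "\<forall>\<^sub>F H in at_right 0. \<forall>i. norm (Z H i) \<le> norm (R H i) + H * (K * (\<Sum>j\<in>UNIV. norm (Z H j)))"
  shows "uO (\<lambda>_. UNIV) n Z"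
proof -
  obtain C where C: "C \<ge> 0" "\<forall>\<^sub>F H in at_right 0. \<forall>i\<in>UNIV. norm (R H i) \<le> C * H ^ n"
    using uOE[OF R] by blast
  define N where "N = real (card (UNIV :: 's set))"
  have N: "N \<ge> 0" by (simp add: N_def)
  have pos: "1 / (2 * (N * \<bar>K\<bar> + 1)) > 0" using N by (simp add: add_nonneg_pos)
  have "\<forall>\<^sub>F H in at_right 0. \<forall>i\<in>UNIV. norm (Z H i) \<le> (2 * N * C) * H ^ n"
    using C(2) le eventually_pos eventually_less[OF pos]
  proof eventually_elim
    case (elim H)
    define z where "z = (\<Sum>j\<in>UNIV. norm (Z H j))"
    have z: "z \<ge> 0" by (simp add: z_def sum_nonneg)
    have "N * \<bar>K\<bar> + 1 > 0" using N by (simp add: add_nonneg_pos)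
    then have "H * (N * \<bar>K\<bar> + 1) \<le> 1 / 2" using elim(4) by (simp add: field_simps)
    then have small: "H * (N * \<bar>K\<bar>) \<le> 1 / 2" using elim(3) by (simp add: algebra_simps)
    have "z \<le> (\<Sum>i\<in>(UNIV :: 's set). C * H ^ n + H * (K * z))"
      unfolding z_def using elim(1,2) by (intro sum_mono) (meson UNIV_I add_right_mono order_trans)
    also have "\<dots> = N * (C * H ^ n + H * (K * z))" by (simp add: N_def)
    also have "\<dots> \<le> N * (C * H ^ n + H * (\<bar>K\<bar> * z))"
      using N elim(3) z by (intro mult_left_mono add_left_mono mult_right_mono) auto
    also have "\<dots> = N * C * H ^ n + (H * (N * \<bar>K\<bar>)) * z" by (simp add: algebra_simps)
    also have "(H * (N * \<bar>K\<bar>)) * z \<le> 1 / 2 * z" using small z by (rule mult_right_mono)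
    finally have zle: "z \<le> 2 * N * C * H ^ n" by simp
    have "norm (Z H i) \<le> z" for i unfolding z_def by (rule member_le_sum) auto
    with zle show ?case by (meson order_trans)
  qed
  then show ?thesis by (rule uOI)
qed

text \<open>
  The coefficient of order one drops out because the rows of A sum to c, so the residual starts at H^2.
\<close>

lemma stage_residual_identity:
  fixes A :: "real^'s^'s" and a :: "nat \<Rightarrow> 'a::real_normed_vector"
  assumes c: "\<And>i. (\<Sum>j\<in>UNIV. A $ i $ j) = c $ i"
  shows "a 0 + H *\<^sub>R (\<Sum>j\<in>UNIV. A $ i $ j *\<^sub>R poly_curve 4 (poly_curve_deriv a) (c $ j * H)) -
      poly_curve 5 a (c $ i * H) =
    H ^ 2 *\<^sub>R (stage_defect A c 2 $ i *\<^sub>R a 2) + H ^ 3 *\<^sub>R (stage_defect A c 3 $ i *\<^sub>R a 3) +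
    H ^ 4 *\<^sub>R (stage_defect A c 4 $ i *\<^sub>R a 4)"
proof -
  let ?S = "\<lambda>k. \<Sum>j\<in>UNIV. A $ i $ j * c $ j ^ k"
  have "(\<Sum>j\<in>UNIV. A $ i $ j *\<^sub>R poly_curve 4 (poly_curve_deriv a) (c $ j * H)) =
      (\<Sum>k<4. \<Sum>j\<in>UNIV. (A $ i $ j * c $ j ^ k) *\<^sub>R (H ^ k *\<^sub>R poly_curve_deriv a k))"
    unfolding poly_curve_def scaleR_sum_right
    by (subst sum.swap) (simp add: power_mult_distrib mult_ac)
  also have "\<dots> = (\<Sum>k<4. ?S k *\<^sub>R (H ^ k *\<^sub>R poly_curve_deriv a k))"
    by (simp only: scaleR_sum_left)
  finally have *: "(\<Sum>j\<in>UNIV. A $ i $ j *\<^sub>R poly_curve 4 (poly_curve_deriv a) (c $ j * H)) =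
     (\<Sum>k<4. ?S k *\<^sub>R (H ^ k *\<^sub>R poly_curve_deriv a k))" .
  have "?S 0 = c $ i" by (simp add: c)
  then show ?thesis
    unfolding * unfolding poly_curve_def stage_defect_def poly_curve_deriv_def
    by (simp add: eval_nat_numeral scaleR_add_right scaleR_diff_left)
       (simp add: algebra_simps)
qed

text \<open>
  The deviation Z of the stages from the curve is known more and more precisely by repeated insertion
  into the stage equations: Z = O(H^2) by absorption, then Z = H^2 D_2 a_2 + O(H^3), where D_2 is the
  second stage defect, and one more insertion yields the terms of order three. One of them passes through
  the Jacobian M0 of the right-hand side.
\<close>

lemma stage_expansion:
  fixes A :: "real^'s^'s" and f :: "real \<Rightarrow> 'a::euclidean_space \<Rightarrow> 'a"
  assumes c: "\<And>i. (\<Sum>j\<in>UNIV. A $ i $ j) = c $ i"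
    and br: "rk_stage_branch A c f t0 y0 Y"
    and ap: "approx_solution f t0 y0 4 a"
    and ex: "expands_along f t0 (poly_curve 5 a) \<phi> M0 M1"
  shows "uO (\<lambda>_. UNIV) 4 (\<lambda>H i. Y H i - poly_curve 5 a (c $ i * H) -
     (H ^ 2 *\<^sub>R (stage_defect A c 2 $ i *\<^sub>R a 2) +
      H ^ 3 *\<^sub>R (stage_defect A c 3 $ i *\<^sub>R a 3 + (A *v stage_defect A c 2) $ i *\<^sub>R M0 (a 2))))"
proof -
  let ?p = "poly_curve 5 a" and ?p' = "poly_curve 4 (poly_curve_deriv a)"
  define I where "I = (\<lambda>_::real. UNIV :: 's set)"
  define Z where "Z H i = Y H i - ?p (c $ i * H)" for H i
  define s where "s H i = c $ i * H" for H :: real and i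
  have s: "uO I 1 s" unfolding s_def[abs_def] I_def by (rule uO_node)
  have mon: "uO I k (\<lambda>H i. H ^ k *\<^sub>R g i)" for g :: "'s \<Rightarrow> 'a" and k
    unfolding I_def by (rule uO_index_monomial)
  define W where "W g H i = H *\<^sub>R (\<Sum>j\<in>UNIV. A $ i $ j *\<^sub>R g H j)" for g :: "real \<Rightarrow> 's \<Rightarrow> 'a" and H i
  have weighted: "uO I (Suc n) (W g)" if g: "uO I n g" for g n
    using uO_scaleR[OF uO_id uO_stage_sum[OF g[unfolded I_def], of "\<lambda>i j. A $ i $ j"]]
    by (simp add: I_def W_def[abs_def])
  have W_diff: "W (\<lambda>H j. g H j - h H j) H i = W g H i - W h H i" for g h H i
    by (simp add: W_def scaleR_diff_right sum_subtractf)
  define dF where "dF H j = f (t0 + s H j) (?p (s H j) + Z H j) - f (t0 + s H j) (?p (s H j))" for H j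
  define rF where "rF H j = f (t0 + s H j) (?p (s H j)) - ?p' (s H j)" for H j
  define z2 where "z2 H i = H ^ 2 *\<^sub>R (stage_defect A c 2 $ i *\<^sub>R a 2)" for H :: real and i
  define z3 where "z3 H i = H ^ 3 *\<^sub>R (stage_defect A c 3 $ i *\<^sub>R a 3)" for H :: real and i
  have z2: "uO I 2 z2" and z3: "uO I 3 z3" unfolding z2_def[abs_def] z3_def[abs_def] by (rule mon)+
  define R where "R H i = z2 H i + z3 H i + H ^ 4 *\<^sub>R (stage_defect A c 4 $ i *\<^sub>R a 4) + W rF H i" for H i
  obtain C where C: "C \<ge> 0" "\<And>s. \<bar>s\<bar> \<le> 1 \<Longrightarrow> norm (?p' s - f (t0 + s) (?p s)) \<le> C * \<bar>s\<bar> ^ 4" and a0: "a 0 = y0"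
    using ap unfolding approx_solution_def by blast
  have rF: "uO I 4 rF"
    using uO_minus[OF uO_local_power[OF C(2,1) s]] by (simp add: rF_def[abs_def])
  have R2: "uO I 4 (\<lambda>H i. R H i - (z2 H i + z3 H i))"
  proof -
    have "uO I 4 (\<lambda>H i. H ^ 4 *\<^sub>R (stage_defect A c 4 $ i *\<^sub>R a 4) + W rF H i)"
      by (rule uO_add[OF mon uO_mono[OF weighted[OF rF]]]) simp
    then show ?thesis by (simp add: R_def add.assoc)
  qed
  have eq: "\<forall>\<^sub>F H in at_right 0. \<forall>i. Z H i = R H i + W dF H i"
    using br[unfolded rk_stage_branch_def, THEN conjunct1]
  proof eventually_elim
    case (elim H)
    show ?case
    proof
      fix i
      have "Y H i = y0 + H *\<^sub>R (\<Sum>j\<in>UNIV. A $ i $ j *\<^sub>R f (t0 + c $ j * H) (Y H j))"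
        using elim unfolding rk_stages_def by blast
      also have "(\<lambda>j. f (t0 + c $ j * H) (Y H j)) = (\<lambda>j. ?p' (s H j) + (rF H j + dF H j))"
        by (auto simp: rF_def dF_def Z_def s_def)
      then have "(\<Sum>j\<in>UNIV. A $ i $ j *\<^sub>R f (t0 + c $ j * H) (Y H j)) =
          (\<Sum>j\<in>UNIV. A $ i $ j *\<^sub>R ?p' (s H j)) + ((\<Sum>j\<in>UNIV. A $ i $ j *\<^sub>R rF H j) + (\<Sum>j\<in>UNIV. A $ i $ j *\<^sub>R dF H j))"
        by (simp add: fun_eq_iff scaleR_add_right sum.distrib)
      finally have "Z H i = (a 0 + H *\<^sub>R (\<Sum>j\<in>UNIV. A $ i $ j *\<^sub>R ?p' (c $ j * H)) - ?p (c $ i * H)) +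
          W rF H i + W dF H i"
        by (simp add: Z_def a0 s_def scaleR_add_right W_def)
      then show "Z H i = R H i + W dF H i"
        unfolding stage_residual_identity[OF c] R_def z2_def z3_def .
    qed
  qed
  \<comment> \<open>the branch condition brings Z into the unit ball, where the field is Lipschitz along p\<close>
  have Z1: "\<forall>\<^sub>F H in at_right 0. \<forall>i. norm (Z H i) \<le> 1"
  proof -
    have "\<forall>\<^sub>F H in at_right 0. norm (Z H i) < 1" for i
    proof -
      have "((\<lambda>H. ?p (c $ i * H)) \<longlongrightarrow> ?p (c $ i * 0)) (at_right 0)"
      proof (rule isCont_tendsto_compose[of _ ?p])
        show "isCont ?p (c $ i * 0)"
          using continuous_poly_curve[of UNIV 5 a] by (simp add: continuous_on_eq_continuous_at)
      qed (intro tendsto_intros)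
      then have "((\<lambda>H. ?p (c $ i * H)) \<longlongrightarrow> y0) (at_right 0)"
        using poly_curve_0[of 4 a] by (simp add: a0)
      then have "((\<lambda>H. Z H i) \<longlongrightarrow> y0 - y0) (at_right 0)"
        unfolding Z_def using br unfolding rk_stage_branch_def by (intro tendsto_diff) auto
      then have "((\<lambda>H. norm (Z H i)) \<longlongrightarrow> 0) (at_right 0)" using tendsto_norm_zero by simp
      then show ?thesis by (rule order_tendstoD) simp
    qed
    then have "\<forall>\<^sub>F H in at_right 0. \<forall>i\<in>UNIV. norm (Z H i) < 1" by (intro eventually_ball_finite) auto
    then show ?thesis by eventually_elim (auto intro: less_imp_le)
  qed
  obtain K where K: "K \<ge> 0" "\<And>s Z. \<bar>s\<bar> \<le> 1 \<Longrightarrow> norm Z \<le> 1 \<Longrightarrow>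
      norm (f (t0 + s) (?p s + Z) - f (t0 + s) (?p s)) \<le> K * norm Z"
    using expands_along_lipschitz[OF ex] by blast
  have Z2: "uO I 2 Z"
    unfolding I_def
  proof (rule uO_absorb[where R = R])
    have "uO I 2 (\<lambda>H i. (R H i - (z2 H i + z3 H i)) + (z2 H i + z3 H i))"
      by (rule uO_add[OF uO_mono[OF R2] uO_add[OF z2 uO_mono[OF z3]]]) simp_all
    then show "uO (\<lambda>_. UNIV) 2 R" by (simp add: I_def)
    define B where "B = (\<Sum>i\<in>UNIV. \<Sum>j\<in>UNIV. \<bar>A $ i $ j\<bar>)"
    have B: "\<bar>A $ i $ j\<bar> \<le> B" for i j
    proof -
      have "\<bar>A $ i $ j\<bar> \<le> (\<Sum>j\<in>UNIV. \<bar>A $ i $ j\<bar>)" by (rule member_le_sum) auto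
      also have "\<dots> \<le> B" unfolding B_def by (rule member_le_sum) (auto intro: sum_nonneg)
      finally show ?thesis .
    qed
    show "\<forall>\<^sub>F H in at_right 0. \<forall>i. norm (Z H i) \<le> norm (R H i) + H * ((B * K) * (\<Sum>j\<in>UNIV. norm (Z H j)))"
      using eq Z1 eventually_pos uO_le_1[OF s[unfolded One_nat_def]]
    proof eventually_elim
      case (elim H)
      show ?case
      proof
        fix i
        have "norm (\<Sum>j\<in>UNIV. A $ i $ j *\<^sub>R dF H j) \<le> (\<Sum>j\<in>UNIV. B * (K * norm (Z H j)))"
        proof (rule sum_norm_le)
          fix j
          have "norm (dF H j) \<le> K * norm (Z H j)"
            unfolding dF_def using elim by (intro K(2)) (auto simp: I_def)
          then show "norm (A $ i $ j *\<^sub>R dF H j) \<le> B * (K * norm (Z H j))"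
            using B[of i j] by (simp add: mult_mono')
        qed
        also have "\<dots> = (B * K) * (\<Sum>j\<in>UNIV. norm (Z H j))" by (simp add: sum_distrib_left mult.assoc)
        finally have WdF: "norm (W dF H i) \<le> H * ((B * K) * (\<Sum>j\<in>UNIV. norm (Z H j)))"
          using elim(3) by (simp add: W_def mult_left_mono)
        show "norm (Z H i) \<le> norm (R H i) + H * ((B * K) * (\<Sum>j\<in>UNIV. norm (Z H j)))"
          using elim(1) norm_triangle_mono[OF order_refl WdF, of "R H i"] by simp
      qed
    qed
  qed
  have M: "bounded_linear M0" "bounded_linear M1" using ex unfolding expands_along_def by auto
  have dF4: "uO I 4 (\<lambda>H j. dF H j - (M0 (Z H j) + s H j *\<^sub>R M1 (Z H j)))"
    unfolding dF_def by (rule uO_expand_increment[OF ex s Z2])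
  have dF3: "uO I 3 (\<lambda>H j. dF H j - M0 (Z H j))"
  proof -
    have "uO I 3 (\<lambda>H j. (dF H j - (M0 (Z H j) + s H j *\<^sub>R M1 (Z H j))) + s H j *\<^sub>R M1 (Z H j))"
      using uO_mono[OF dF4, of 3] uO_scaleR[OF s uO_bounded_linear[OF M(2) Z2]]
      by (intro uO_add) (simp_all add: eval_nat_numeral)
    then show ?thesis by simp
  qed
  have Z4: "uO I 4 (\<lambda>H i. Z H i - (z2 H i + z3 H i + W (\<lambda>H j. M0 (Z H j)) H i))"
  proof (rule uO_cong)
    show "uO I 4 (\<lambda>H i. (R H i - (z2 H i + z3 H i)) +
        W (\<lambda>H j. dF H j - M0 (Z H j)) H i)"
      using R2 weighted[OF dF3] by (intro uO_add) simp_all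
    show "\<forall>\<^sub>F H in at_right 0. \<forall>i\<in>I H.
        Z H i - (z2 H i + z3 H i + W (\<lambda>H j. M0 (Z H j)) H i) =
        (R H i - (z2 H i + z3 H i)) +
        W (\<lambda>H j. dF H j - M0 (Z H j)) H i"
      using eq by eventually_elim (simp add: W_diff)
  qed
  have Z3: "uO I 3 (\<lambda>H i. Z H i - z2 H i)"
  proof -
    have "uO I 3 (\<lambda>H i. (Z H i - (z2 H i + z3 H i + W (\<lambda>H j. M0 (Z H j)) H i)) + (z3 H i + W (\<lambda>H j. M0 (Z H j)) H i))"
      using weighted[OF uO_bounded_linear[OF M(1) Z2]]
      by (intro uO_add[OF uO_mono[OF Z4] uO_add[OF z3]]) simp_all
    then show ?thesis by (simp add: algebra_simps)
  qed
  have "uO I 4 (\<lambda>H i. Z H i - (H ^ 2 *\<^sub>R (stage_defect A c 2 $ i *\<^sub>R a 2) +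
      H ^ 3 *\<^sub>R (stage_defect A c 3 $ i *\<^sub>R a 3 + (A *v stage_defect A c 2) $ i *\<^sub>R M0 (a 2))))"
  proof (rule uO_cong)
    show "uO I 4 (\<lambda>H i. (Z H i - (z2 H i + z3 H i + W (\<lambda>H j. M0 (Z H j)) H i)) +
      W (\<lambda>H j. M0 (Z H j - z2 H j)) H i)"
      using Z4 weighted[OF uO_bounded_linear[OF M(1) Z3]] by (intro uO_add) simp_all
    have "W (\<lambda>H j. M0 (z2 H j)) H i = H ^ 3 *\<^sub>R ((A *v stage_defect A c 2) $ i *\<^sub>R M0 (a 2))" for H i
      using M(1) by (simp add: W_def z2_def linear_simps scaleR_sum_right scaleR_sum_left
          matrix_vector_mult_def sum_distrib_left power3_eq_cube power2_eq_square mult_ac)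
    moreover have "M0 (Z H j - z2 H j) = M0 (Z H j) - M0 (z2 H j)" for H j
      using M(1) by (simp add: linear_simps)
    ultimately have "W (\<lambda>H j. M0 (Z H j - z2 H j)) H i = W (\<lambda>H j. M0 (Z H j)) H i -
        H ^ 3 *\<^sub>R ((A *v stage_defect A c 2) $ i *\<^sub>R M0 (a 2))" for H i
      by (simp add: W_diff)
    then show "\<forall>\<^sub>F H in at_right 0. \<forall>i\<in>I H.
        Z H i - (H ^ 2 *\<^sub>R (stage_defect A c 2 $ i *\<^sub>R a 2) +
          H ^ 3 *\<^sub>R (stage_defect A c 3 $ i *\<^sub>R a 3 + (A *v stage_defect A c 2) $ i *\<^sub>R M0 (a 2))) =
        (Z H i - (z2 H i + z3 H i + W (\<lambda>H j. M0 (Z H j)) H i)) +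
      W (\<lambda>H j. M0 (Z H j - z2 H j)) H i"
      by (simp add: z2_def z3_def scaleR_add_right algebra_simps)
  qed
  then show ?thesis by (simp add: I_def Z_def)
qed

section \<open>Propagation of the defect through the inner problem\<close>

lemma uO_rescale:
  fixes d :: "real \<Rightarrow> 'a::real_normed_vector"
  assumes "continuous_on {0..1} d"
  shows "uO (\<lambda>H. {0..H}) 0 (\<lambda>H \<theta>. d (\<theta> / H))"
proof -
  have "bounded (d ` {0..1})"
    using assms by (intro compact_imp_bounded compact_continuous_image) auto
  then obtain C where C: "\<And>\<tau>. \<tau> \<in> {0..1} \<Longrightarrow> norm (d \<tau>) \<le> C"
    unfolding bounded_iff by blast
  have "\<forall>\<^sub>F H in at_right 0. \<forall>\<theta>\<in>{0..H}. norm (d (\<theta> / H)) \<le> C * H ^ 0"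
    using eventually_pos by eventually_elim (auto intro!: C)
  then show ?thesis by (rule uOI)
qed

lemma uO_theta: "uO (\<lambda>H. {0..H}) 1 (\<lambda>H \<theta>. \<theta>)"
  by (rule uOI[of _ _ 1]) (simp add: always_eventually)

lemma has_integral_rescale:
  fixes g :: "real \<Rightarrow> 'a::euclidean_space"
  assumes "(g has_integral i) {0..1}" "0 < H"
  shows "((\<lambda>\<theta>. g (\<theta> / H)) has_integral H *\<^sub>R i) {0..H}"
proof -
  have "(\<lambda>x. x * H) ` {0..1} = {0..H}"
    using assms(2) image_mult_atLeastAtMost_if[of H 0 1] by (simp add: mult.commute)
  with has_integral_affinity[of g i 0 1 "1 / H" 0] assms
  show ?thesis by (simp add: mult.commute)
qed

text \<open>
  The error E of the inner problem satisfies a linear equation with forcing D, and the claim is about its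
  value at the end of the step. The adjoint propagator from \<theta> to H begins with
  1 + (H - \<theta>) N0 + (H - \<theta>)^2 / 2 N0^2 + (H^2 - \<theta>^2) / 2 N1. Applying this to E gives a function Q which agrees
  with E at \<theta> = H and in whose derivative the terms with E cancel up to O(H^4). What is left of the
  derivative is an explicit function of \<theta> / H whose integral over the step is zero, since it is composed of
  the seven integrals that are assumed to vanish.
\<close>

lemma propagated_error:
  fixes E D :: "real \<Rightarrow> real \<Rightarrow> 'a::euclidean_space" and d1 d2 d3 :: "real \<Rightarrow> 'a"
  assumes N: "bounded_linear N0" "bounded_linear N1"
    and der: "\<forall>\<^sub>F H in at_right 0. \<forall>\<theta>\<in>{0..H}.
      (E H has_vector_derivative N0 (E H \<theta>) + \<theta> *\<^sub>R N1 (E H \<theta>) + D H \<theta>) (at \<theta> within {0..H})"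
    and E0: "\<forall>\<^sub>F H in at_right 0. E H 0 = 0"
    and E: "uO (\<lambda>H. {0..H}) 2 E"
    and D: "uO (\<lambda>H. {0..H}) 4 (\<lambda>H \<theta>. D H \<theta> -
      (H *\<^sub>R d1 (\<theta> / H) + H ^ 2 *\<^sub>R d2 (\<theta> / H) + H ^ 3 *\<^sub>R d3 (\<theta> / H)))"
    and cont: "continuous_on {0..1} d1" "continuous_on {0..1} d2" "continuous_on {0..1} d3"
    and int: "(d1 has_integral 0) {0..1}" "(d2 has_integral 0) {0..1}" "(d3 has_integral 0) {0..1}"
      "((\<lambda>\<tau>. (1 - \<tau>) *\<^sub>R d1 \<tau>) has_integral 0) {0..1}" "((\<lambda>\<tau>. (1 - \<tau>) *\<^sub>R d2 \<tau>) has_integral 0) {0..1}"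
      "((\<lambda>\<tau>. (1 - \<tau>)\<^sup>2 *\<^sub>R d1 \<tau>) has_integral 0) {0..1}" "((\<lambda>\<tau>. (1 - \<tau>\<^sup>2) *\<^sub>R d1 \<tau>) has_integral 0) {0..1}"
  shows "stepO 5 (\<lambda>H. E H H)"
proof -
  let ?I = "\<lambda>H. {0..H::real}"
  interpret N0: bounded_linear N0 by fact
  interpret N1: bounded_linear N1 by fact
  note lin = N0.add N0.diff N0.scaleR N1.add N1.diff N1.scaleR
  define l1 where "l1 H \<theta> = H *\<^sub>R d1 (\<theta> / H)" for H \<theta>
  define l2 where "l2 H \<theta> = l1 H \<theta> + H ^ 2 *\<^sub>R d2 (\<theta> / H)" for H \<theta>
  define l3 where "l3 H \<theta> = l2 H \<theta> + H ^ 3 *\<^sub>R d3 (\<theta> / H)" for H \<theta>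
  define M where "M H \<theta> = l3 H \<theta> + (H - \<theta>) *\<^sub>R N0 (l2 H \<theta>) + ((H - \<theta>)\<^sup>2 / 2) *\<^sub>R N0 (N0 (l1 H \<theta>)) +
    ((H\<^sup>2 - \<theta>\<^sup>2) / 2) *\<^sub>R N1 (l1 H \<theta>)" for H \<theta>
  define X where "X H \<theta> = N0 (E H \<theta>) + \<theta> *\<^sub>R N1 (E H \<theta>) + D H \<theta>" for H \<theta>
  define Q where "Q H \<theta> = E H \<theta> + (H - \<theta>) *\<^sub>R N0 (E H \<theta>) + ((H - \<theta>)\<^sup>2 / 2) *\<^sub>R N0 (N0 (E H \<theta>)) +
    ((H\<^sup>2 - \<theta>\<^sup>2) / 2) *\<^sub>R N1 (E H \<theta>)" for H \<theta>
  define Q' where "Q' H \<theta> = X H \<theta> + ((H - \<theta>) *\<^sub>R N0 (X H \<theta>) - N0 (E H \<theta>)) +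
    (((H - \<theta>)\<^sup>2 / 2) *\<^sub>R N0 (N0 (X H \<theta>)) - (H - \<theta>) *\<^sub>R N0 (N0 (E H \<theta>))) +
    (((H\<^sup>2 - \<theta>\<^sup>2) / 2) *\<^sub>R N1 (X H \<theta>) - \<theta> *\<^sub>R N1 (E H \<theta>))" for H \<theta>
  define R where "R H \<theta> = (D H \<theta> - l3 H \<theta>)
    + (H - \<theta>) *\<^sub>R \<theta> *\<^sub>R N0 (N1 (E H \<theta>)) + (H - \<theta>) *\<^sub>R N0 (D H \<theta> - l2 H \<theta>)
    + (1 / 2) *\<^sub>R (H - \<theta>)\<^sup>2 *\<^sub>R N0 (N0 (N0 (E H \<theta>) + \<theta> *\<^sub>R N1 (E H \<theta>) + (D H \<theta> - l1 H \<theta>)))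
    + (1 / 2) *\<^sub>R (H\<^sup>2 - \<theta>\<^sup>2) *\<^sub>R N1 (N0 (E H \<theta>) + \<theta> *\<^sub>R N1 (E H \<theta>) + (D H \<theta> - l1 H \<theta>))" for H \<theta>
  \<comment> \<open>R is O(H^4): a weight of degree k in H and \<theta> always multiplies a function of order 4 - k\<close>
  have QMR: "Q' H \<theta> - M H \<theta> = R H \<theta>" for H \<theta>
    unfolding Q'_def M_def R_def X_def by (simp add: lin algebra_simps diff_divide_distrib)
  have H\<theta>: "uO ?I 1 (\<lambda>H \<theta>. H - \<theta>)" by (rule uO_diff[OF uO_id uO_theta])
  have sq: "uO ?I 2 (\<lambda>H \<theta>. (H - \<theta>)\<^sup>2)"
    using uO_scaleR[OF H\<theta> H\<theta>] by (simp add: power2_eq_square numeral_2_eq_2)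
  have sq': "uO ?I 2 (\<lambda>H \<theta>. H\<^sup>2 - \<theta>\<^sup>2)"
    using uO_scaleR[OF uO_theta uO_theta] by (intro uO_diff uO_power) (simp add: power2_eq_square numeral_2_eq_2)
  have D3: "uO ?I 4 (\<lambda>H \<theta>. D H \<theta> - l3 H \<theta>)" using D by (simp add: l3_def l2_def l1_def)
  have d3: "uO ?I 3 (\<lambda>H \<theta>. H ^ 3 *\<^sub>R d3 (\<theta> / H))" and d2: "uO ?I 2 (\<lambda>H \<theta>. H ^ 2 *\<^sub>R d2 (\<theta> / H))"
    using uO_power_scaleR[OF uO_rescale[OF cont(3)], of 3] uO_power_scaleR[OF uO_rescale[OF cont(2)], of 2]
    by simp_all
  have D2: "uO ?I 3 (\<lambda>H \<theta>. D H \<theta> - l2 H \<theta>)"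
  proof -
    have "uO ?I 3 (\<lambda>H \<theta>. (D H \<theta> - l3 H \<theta>) + H ^ 3 *\<^sub>R d3 (\<theta> / H))"
      by (rule uO_add[OF uO_mono[OF D3] d3]) simp
    then show ?thesis by (simp add: l3_def)
  qed
  have D1: "uO ?I 2 (\<lambda>H \<theta>. D H \<theta> - l1 H \<theta>)"
  proof -
    have "uO ?I 2 (\<lambda>H \<theta>. (D H \<theta> - l2 H \<theta>) + H ^ 2 *\<^sub>R d2 (\<theta> / H))"
      by (rule uO_add[OF uO_mono[OF D2] d2]) simp
    then show ?thesis by (simp add: l2_def)
  qed
  have NE: "uO ?I 2 (\<lambda>H \<theta>. N0 (E H \<theta>) + \<theta> *\<^sub>R N1 (E H \<theta>) + (D H \<theta> - l1 H \<theta>))"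
    using uO_mono[OF uO_scaleR[OF uO_theta uO_bounded_linear[OF N(2) E]], of 2]
    by (intro uO_add uO_bounded_linear[OF N(1) E] D1) simp
  have R: "uO ?I 4 R"
  proof -
    have "uO ?I 4 (\<lambda>H \<theta>. (H - \<theta>) *\<^sub>R \<theta> *\<^sub>R N0 (N1 (E H \<theta>)))"
      using uO_scaleR[OF H\<theta> uO_scaleR[OF uO_theta uO_bounded_linear[OF N(1) uO_bounded_linear[OF N(2) E]]]]
      by (simp add: eval_nat_numeral)
    moreover have "uO ?I 4 (\<lambda>H \<theta>. (H - \<theta>) *\<^sub>R N0 (D H \<theta> - l2 H \<theta>))"
      using uO_scaleR[OF H\<theta> uO_bounded_linear[OF N(1) D2]] by (simp add: eval_nat_numeral)
    moreover have "uO ?I 4 (\<lambda>H \<theta>. (1 / 2) *\<^sub>R (H - \<theta>)\<^sup>2 *\<^sub>R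
        N0 (N0 (N0 (E H \<theta>) + \<theta> *\<^sub>R N1 (E H \<theta>) + (D H \<theta> - l1 H \<theta>))))"
      using uO_scaleR[OF sq uO_bounded_linear[OF N(1) uO_bounded_linear[OF N(1) NE]]]
      by (intro uO_scaleR_const) simp
    moreover have "uO ?I 4 (\<lambda>H \<theta>. (1 / 2) *\<^sub>R (H\<^sup>2 - \<theta>\<^sup>2) *\<^sub>R
        N1 (N0 (E H \<theta>) + \<theta> *\<^sub>R N1 (E H \<theta>) + (D H \<theta> - l1 H \<theta>)))"
      using uO_scaleR[OF sq' uO_bounded_linear[OF N(2) NE]]
      by (intro uO_scaleR_const) simp
    ultimately show ?thesis unfolding R_def[abs_def] using D3 by (intro uO_add)
  qed
  then obtain C where C: "C \<ge> 0" "\<forall>\<^sub>F H in at_right 0. \<forall>\<theta>\<in>{0..H}. norm (R H \<theta>) \<le> C * H ^ 4"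
    using uOE by blast
  have "\<forall>\<^sub>F H in at_right 0. \<forall>u\<in>(UNIV :: unit set). norm (E H H) \<le> C * H ^ 5"
    using C(2) der E0 eventually_pos
  proof eventually_elim
    case (elim H)
    have EX: "(E H has_vector_derivative X H \<theta>) (at \<theta> within {0..H})" if "\<theta> \<in> {0..H}" for \<theta>
      using elim(2) that by (simp add: X_def)
    have "(Q H has_vector_derivative Q' H \<theta>) (at \<theta> within {0..H})" if \<theta>: "\<theta> \<in> {0..H}" for \<theta>
    proof -
      have N0E: "((\<lambda>\<theta>. N0 (E H \<theta>)) has_vector_derivative N0 (X H \<theta>)) (at \<theta> within {0..H})"
        by (rule N0.has_vector_derivative[OF EX[OF \<theta>]])
      have N00E: "((\<lambda>\<theta>. N0 (N0 (E H \<theta>))) has_vector_derivative N0 (N0 (X H \<theta>))) (at \<theta> within {0..H})"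
        by (rule N0.has_vector_derivative[OF N0E])
      have N1E: "((\<lambda>\<theta>. N1 (E H \<theta>)) has_vector_derivative N1 (X H \<theta>)) (at \<theta> within {0..H})"
        by (rule N1.has_vector_derivative[OF EX[OF \<theta>]])
      have w1: "((\<lambda>\<theta>. H - \<theta>) has_real_derivative - 1) (at \<theta> within {0..H})"
        by (auto intro!: derivative_eq_intros)
      have w2: "((\<lambda>\<theta>. (H - \<theta>)\<^sup>2 / 2) has_real_derivative - (H - \<theta>)) (at \<theta> within {0..H})"
        by (auto intro!: derivative_eq_intros)
      have w3: "((\<lambda>\<theta>. (H\<^sup>2 - \<theta>\<^sup>2) / 2) has_real_derivative - \<theta>) (at \<theta> within {0..H})"
        by (auto intro!: derivative_eq_intros)
      note deriv = has_vector_derivative_add[OF has_vector_derivative_add[OF has_vector_derivative_add[OF EX[OF \<theta>]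
          has_vector_derivative_scaleR[OF w1 N0E]] has_vector_derivative_scaleR[OF w2 N00E]]
          has_vector_derivative_scaleR[OF w3 N1E]]
      then show ?thesis unfolding Q_def[abs_def] Q'_def by (simp del: minus_diff_eq)
    qed
    then have "(Q' H has_integral (Q H H - Q H 0)) {0..H}"
      using elim(4) by (intro fundamental_theorem_of_calculus) auto
    moreover have "Q H H - Q H 0 = E H H"
      using elim(3) by (simp add: Q_def N0.zero N1.zero)
    moreover have "(M H has_integral 0) {0..H}"
    proof -
      let ?m = "\<lambda>\<tau>. H *\<^sub>R d1 \<tau> + H ^ 2 *\<^sub>R d2 \<tau> + H ^ 3 *\<^sub>R d3 \<tau>
          + (H * H) *\<^sub>R N0 ((1 - \<tau>) *\<^sub>R d1 \<tau>) + (H * H ^ 2) *\<^sub>R N0 ((1 - \<tau>) *\<^sub>R d2 \<tau>)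
          + (H ^ 3 / 2) *\<^sub>R N0 (N0 ((1 - \<tau>)\<^sup>2 *\<^sub>R d1 \<tau>)) + (H ^ 3 / 2) *\<^sub>R N1 ((1 - \<tau>\<^sup>2) *\<^sub>R d1 \<tau>)"
      have z: "((\<lambda>\<tau>. k *\<^sub>R g \<tau>) has_integral 0) {0..1}" if "(g has_integral 0) {0..1}" for k :: real and g :: "real \<Rightarrow> 'a"
        using has_integral_cmul[OF that, of k] by simp
      have n0: "((\<lambda>\<tau>. N0 (g \<tau>)) has_integral 0) {0..1}" if "(g has_integral 0) {0..1}" for g :: "real \<Rightarrow> 'a"
        using has_integral_linear[OF that N(1)] by (simp add: o_def N0.zero)
      have n1: "((\<lambda>\<tau>. N1 (g \<tau>)) has_integral 0) {0..1}" if "(g has_integral 0) {0..1}" for g :: "real \<Rightarrow> 'a"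
        using has_integral_linear[OF that N(2)] by (simp add: o_def N1.zero)
      have "(?m has_integral 0 + 0 + 0 + 0 + 0 + 0 + 0) {0..1}"
        by (intro has_integral_add z n0 n1 int)
      then have "((\<lambda>\<theta>. ?m (\<theta> / H)) has_integral 0) {0..H}"
        using has_integral_rescale[of ?m 0 H] elim(4) by simp
      moreover have "?m (\<theta> / H) = M H \<theta>" for \<theta>
      proof -
        define \<tau> where "\<tau> = \<theta> / H"
        have \<theta>: "\<theta> = H * \<tau>" using elim(4) by (simp add: \<tau>_def)
        have e: "H - H * \<tau> = H * (1 - \<tau>)" "(H - H * \<tau>)\<^sup>2 / 2 = H\<^sup>2 * (1 - \<tau>)\<^sup>2 / 2"
          "(H\<^sup>2 - (H * \<tau>)\<^sup>2) / 2 = H\<^sup>2 * (1 - \<tau>\<^sup>2) / 2"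
          by (simp_all add: algebra_simps power2_eq_square)
        show ?thesis
          unfolding M_def l3_def l2_def l1_def \<tau>_def[symmetric] unfolding \<theta> e
          by (simp add: N0.add N0.scaleR N1.scaleR scaleR_add_right power2_eq_square power3_eq_cube mult_ac add_ac)
      qed
      ultimately show ?thesis by simp
    qed
    ultimately have "((\<lambda>\<theta>. Q' H \<theta> - M H \<theta>) has_integral (E H H - 0)) {0..H}"
      by (metis has_integral_diff)
    then have "(R H has_integral E H H) {0..H}" by (simp add: QMR)
    then have "norm (E H H) \<le> (C * H ^ 4) * Henstock_Kurzweil_Integration.content {0..H}"
      using elim(1,4) C(1) by (intro has_integral_bound_real[where f = "R H"]) auto
    then show ?case using elim(4) by (simp add: eval_nat_numeral mult_ac)
  qed
  then show ?thesis by (rule uOI)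
qed

text \<open>
  The difference solves an equation with forcing O(H^4), namely the residual of the curve.
\<close>

lemma approx_solution_error:
  fixes f :: "real \<Rightarrow> 'a::euclidean_space \<Rightarrow> 'a"
  assumes ap: "approx_solution f t0 y0 4 a"
    and ex: "expands_along f t0 (poly_curve 5 a) \<phi> M0 M1"
    and y: "ivp_solution f t0 y0 T y" and T: "0 < T"
  shows "stepO 5 (\<lambda>H. y (t0 + H) - poly_curve 5 a H)"
proof -
  let ?p = "poly_curve 5 a" and ?p' = "poly_curve 4 (poly_curve_deriv a)"
  obtain K where K: "K \<ge> 0" "\<And>s Z. \<bar>s\<bar> \<le> 1 \<Longrightarrow> norm Z \<le> 1 \<Longrightarrow>
      norm (f (t0 + s) (?p s + Z) - f (t0 + s) (?p s)) \<le> K * norm Z"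
    using expands_along_lipschitz[OF ex] by blast
  obtain C where C: "C \<ge> 0" "\<And>s. \<bar>s\<bar> \<le> 1 \<Longrightarrow> norm (?p' s - f (t0 + s) (?p s)) \<le> C * \<bar>s\<bar> ^ 4" and a0: "a 0 = y0"
    using ap unfolding approx_solution_def by blast
  have "uO (\<lambda>H. {0..H}) (Suc 4) (\<lambda>H \<theta>. y (t0 + \<theta>) - ?p \<theta>)"
  proof (rule uO_deviation[OF _ _ _ K(1) C(1)])
    show "\<forall>\<^sub>F H in at_right 0. y (t0 + 0) - ?p 0 = 0"
      using y poly_curve_0[of 4 a] a0 by (simp add: ivp_solution_def)
    show "\<forall>\<^sub>F H in at_right 0. \<forall>\<theta>\<in>{0..H}. ((\<lambda>\<theta>. y (t0 + \<theta>) - ?p \<theta>) has_vector_derivative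
        f (t0 + \<theta>) (y (t0 + \<theta>)) - ?p' \<theta>) (at \<theta> within {0..H})"
      using eventually_less[OF T]
    proof (eventually_elim, intro ballI)
      fix H \<theta> :: real assume H: "H < T" and \<theta>: "\<theta> \<in> {0..H}"
      have "(y has_vector_derivative f (t0 + \<theta>) (y (t0 + \<theta>))) (at (t0 + \<theta>) within {t0..t0 + T})"
        using y \<theta> H unfolding ivp_solution_def by auto
      then have "(y has_vector_derivative f (t0 + \<theta>) (y (t0 + \<theta>))) (at (t0 + \<theta>) within (\<lambda>\<theta>. t0 + \<theta>) ` {0..H})"
        using H by (elim has_vector_derivative_within_subset) auto
      moreover have "((\<lambda>\<theta>. t0 + \<theta>) has_vector_derivative 0 + 1) (at \<theta> within {0..H})"
        by (intro has_vector_derivative_add has_vector_derivative_const has_vector_derivative_id)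
      ultimately have "((\<lambda>\<theta>. y (t0 + \<theta>)) has_vector_derivative f (t0 + \<theta>) (y (t0 + \<theta>))) (at \<theta> within {0..H})"
        using vector_diff_chain_within[of "\<lambda>\<theta>. t0 + \<theta>" "0 + 1" \<theta> "{0..H}" y] by (simp add: o_def)
      then show "((\<lambda>\<theta>. y (t0 + \<theta>) - ?p \<theta>) has_vector_derivative f (t0 + \<theta>) (y (t0 + \<theta>)) - ?p' \<theta>) (at \<theta> within {0..H})"
        using poly_curve_has_vector_derivative[of 4 a] by (intro has_vector_derivative_diff) simp_all
    qed
    show "\<forall>\<^sub>F H in at_right 0. \<forall>\<theta>\<in>{0..H}. norm (y (t0 + \<theta>) - ?p \<theta>) \<le> 1 \<longrightarrow>
        norm (f (t0 + \<theta>) (y (t0 + \<theta>)) - ?p' \<theta>) \<le> K * norm (y (t0 + \<theta>) - ?p \<theta>) + C * H ^ 4"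
      using eventually_less[of 1, simplified]
    proof (eventually_elim, intro ballI impI)
      fix H \<theta> :: real assume H: "H < 1" and \<theta>: "\<theta> \<in> {0..H}" and le1: "norm (y (t0 + \<theta>) - ?p \<theta>) \<le> 1"
      have \<theta>1: "\<bar>\<theta>\<bar> \<le> 1" "\<bar>\<theta>\<bar> ^ 4 \<le> H ^ 4" using \<theta> H by (auto intro: power_mono)
      have "norm (?p' \<theta> - f (t0 + \<theta>) (?p \<theta>)) \<le> C * H ^ 4"
        using C(2)[OF \<theta>1(1)] mult_left_mono[OF \<theta>1(2) C(1)] by linarith
      from norm_triangle_mono[OF K(2)[OF \<theta>1(1) le1] this[unfolded norm_minus_commute[of "?p' \<theta>"]]]
      show "norm (f (t0 + \<theta>) (y (t0 + \<theta>)) - ?p' \<theta>) \<le> K * norm (y (t0 + \<theta>) - ?p \<theta>) + C * H ^ 4" by simp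
    qed
  qed
  from uO_at_endpoint[OF this] show ?thesis by simp
qed

section \<open>Moments of the coupling polynomials\<close>

definition coupling :: "(real poly)^'s \<Rightarrow> real^'s \<Rightarrow> real \<Rightarrow> real" where
  "coupling \<gamma> w \<tau> = (\<Sum>j\<in>UNIV. poly (\<gamma> $ j) \<tau> * w $ j)"

definition moment :: "(real \<Rightarrow> real) \<Rightarrow> (real \<Rightarrow> real) \<Rightarrow> real" where
  "moment \<phi> u = integral {0..1} (\<lambda>\<tau>. \<phi> \<tau> * u \<tau>)"

text \<open>
  For \<phi>(\<tau>) = 1, 1 - \<tau> and (1 - \<tau>^2) / 2 these are the inner product of w with the mean weights
  \<gamma>-bar and the sums over k of \<zeta>_k \<gamma>^k \<bullet> w and of \<omega>_k \<gamma>^k \<bullet> w.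
\<close>

abbreviation coupling_moment :: "(real \<Rightarrow> real) \<Rightarrow> (real poly)^'s \<Rightarrow> real^'s \<Rightarrow> real" where
  "coupling_moment \<phi> \<gamma> w \<equiv> moment \<phi> (coupling \<gamma> w)"

lemma has_integral_moment:
  assumes "continuous_on {0..1} \<phi>" "continuous_on {0..1} u"
  shows "((\<lambda>\<tau>. \<phi> \<tau> * u \<tau>) has_integral moment \<phi> u) {0..1}"
  unfolding moment_def
  by (intro integrable_integral integrable_continuous_real continuous_intros assms)

lemma continuous_coupling [continuous_intros]: "continuous_on S (coupling \<gamma> w)"
  unfolding coupling_def[abs_def] by (intro continuous_intros)

lemma coupling_scaleR_sum:
  fixes v :: "'a::real_vector"
  shows "(\<Sum>j\<in>UNIV. poly (\<gamma> $ j) \<tau> *\<^sub>R (x j *\<^sub>R v)) = coupling \<gamma> (\<chi> j. x j) \<tau> *\<^sub>R v"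
  by (simp add: coupling_def scaleR_sum_left)

lemma has_integral_coupling_moment:
  assumes "continuous_on {0..1} \<phi>"
  shows "((\<lambda>\<tau>. \<phi> \<tau> * coupling \<gamma> w \<tau>) has_integral coupling_moment \<phi> \<gamma> w) {0..1}"
  by (rule has_integral_moment[OF assms continuous_coupling])

lemma coupling_moment_scaleR: "coupling_moment \<phi> \<gamma> (r *\<^sub>R w) = r * coupling_moment \<phi> \<gamma> w"
  unfolding moment_def coupling_def
  by (simp add: sum_distrib_left[symmetric] mult.left_commute[of _ r] integral_mult_right)

lemma coupling_moment_diff:
  assumes "continuous_on {0..1} \<phi>"
  shows "coupling_moment \<phi> \<gamma> (v - w) = coupling_moment \<phi> \<gamma> v - coupling_moment \<phi> \<gamma> w"
proof -
  have "(\<lambda>\<tau>. \<phi> \<tau> * coupling \<gamma> (v - w) \<tau>) = (\<lambda>\<tau>. \<phi> \<tau> * coupling \<gamma> v \<tau> - \<phi> \<tau> * coupling \<gamma> w \<tau>)"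
    by (simp add: coupling_def right_diff_distrib sum_subtractf fun_eq_iff)
  then show ?thesis
    using integral_unique[OF has_integral_diff[OF has_integral_coupling_moment[OF assms, of \<gamma> v] has_integral_coupling_moment[OF assms, of \<gamma> w]]]
    by (simp add: moment_def)
qed

lemma has_integral_power_01: "((\<lambda>\<tau>::real. \<tau> ^ k) has_integral 1 / (real k + 1)) {0..1}"
proof -
  have "((\<lambda>\<tau>::real. \<tau> ^ k) has_integral (1 ^ Suc k / real (Suc k) - 0 ^ Suc k / real (Suc k))) {0..1}"
    by (intro fundamental_theorem_of_calculus)
      (auto intro!: derivative_eq_intros simp: has_real_derivative_iff_has_vector_derivative[symmetric] simp del: of_nat_Suc power_Suc)
  then show ?thesis by (simp add: add.commute)
qed

lemma has_integral_zeta: "((\<lambda>\<tau>. (1 - \<tau>) * \<tau> ^ k) has_integral zeta k) {0..1}"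
proof -
  have "((\<lambda>\<tau>::real. \<tau> ^ k - \<tau> ^ Suc k) has_integral 1 / (real k + 1) - 1 / (real (Suc k) + 1)) {0..1}"
    by (intro has_integral_diff has_integral_power_01)
  moreover have "1 / (real k + 1) - 1 / (real (Suc k) + 1) = zeta k"
    by (simp add: zeta_def field_simps)
  ultimately show ?thesis
    by (simp add: left_diff_distrib)
qed

lemma has_integral_omega: "((\<lambda>\<tau>. (1 - \<tau>\<^sup>2) / 2 * \<tau> ^ k) has_integral omega k) {0..1}"
proof -
  have "((\<lambda>\<tau>::real. (1 / 2) * (\<tau> ^ k - \<tau> ^ (k + 2))) has_integral
      (1 / 2) * (1 / (real k + 1) - 1 / (real (k + 2) + 1))) {0..1}"
    by (intro has_integral_mult_right has_integral_diff has_integral_power_01)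
  moreover have "(1 / 2) * (1 / (real k + 1) - 1 / (real (k + 2) + 1)) = omega k"
    by (simp add: omega_def field_simps)
  moreover have "(1 / 2) * (\<tau> ^ k - \<tau> ^ (k + 2)) = (1 - \<tau>\<^sup>2) / 2 * \<tau> ^ k" for \<tau> :: real
    by (simp add: field_simps power_add power2_eq_square)
  ultimately show ?thesis
    by (simp only:)
qed

section \<open>Sufficiency of the order conditions\<close>

lemma slow_stage_expansion:
  fixes A :: "real^'s^'s" and f :: "real \<Rightarrow> 'a::euclidean_space \<Rightarrow> 'a"
  assumes c: "\<And>i. (\<Sum>j\<in>UNIV. A $ i $ j) = c $ i"
    and br: "rk_stage_branch A c f t0 y0 Y"
    and ap: "approx_solution f t0 y0 4 a"
    and ex: "expands_along f t0 (poly_curve 5 a) \<phi> M0 M1"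
    and exS: "expands_along S t0 (poly_curve 5 a) \<sigma> L0 L1"
  shows "uO (\<lambda>_. UNIV) 4 (\<lambda>H j. S (t0 + c $ j * H) (Y H j) -
     (poly_curve 4 \<sigma> (c $ j * H) + H ^ 2 *\<^sub>R (stage_defect A c 2 $ j *\<^sub>R L0 (a 2)) +
      H ^ 3 *\<^sub>R (stage_defect A c 3 $ j *\<^sub>R L0 (a 3) + (A *v stage_defect A c 2) $ j *\<^sub>R L0 (M0 (a 2)) +
         (c $ j * stage_defect A c 2 $ j) *\<^sub>R L1 (a 2))))"
proof -
  let ?p = "poly_curve 5 a"
  define I where "I = (\<lambda>_::real. UNIV :: 's set)"
  define Z where "Z H i = Y H i - ?p (c $ i * H)" for H i
  define s where "s H i = c $ i * H" for H :: real and i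
  define z2 where "z2 H i = H ^ 2 *\<^sub>R (stage_defect A c 2 $ i *\<^sub>R a 2)" for H :: real and i
  define z3 where "z3 H i = H ^ 3 *\<^sub>R (stage_defect A c 3 $ i *\<^sub>R a 3 + (A *v stage_defect A c 2) $ i *\<^sub>R M0 (a 2))"
    for H :: real and i
  have mon: "uO I k (\<lambda>H i. H ^ k *\<^sub>R g i)" for g :: "'s \<Rightarrow> 'a" and k
    unfolding I_def by (rule uO_index_monomial)
  have s: "uO I 1 s" unfolding s_def[abs_def] I_def by (rule uO_node)
  have L: "bounded_linear L0" "bounded_linear L1" using exS unfolding expands_along_def by auto
  interpret L0: bounded_linear L0 by fact
  interpret L1: bounded_linear L1 by fact
  have z2: "uO I 2 z2" and z3: "uO I 3 z3" unfolding z2_def[abs_def] z3_def[abs_def] by (rule mon)+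
  have Z4: "uO I 4 (\<lambda>H i. Z H i - (z2 H i + z3 H i))"
    using stage_expansion[OF c br ap ex] by (simp add: I_def Z_def z2_def z3_def)
  have Z3: "uO I 3 (\<lambda>H i. Z H i - z2 H i)"
  proof -
    have "uO I 3 (\<lambda>H i. (Z H i - (z2 H i + z3 H i)) + z3 H i)"
      by (rule uO_add[OF uO_mono[OF Z4] z3]) simp
    then show ?thesis by simp
  qed
  have Z2: "uO I 2 Z"
  proof -
    have "uO I 2 (\<lambda>H i. (Z H i - z2 H i) + z2 H i)"
      by (rule uO_add[OF uO_mono[OF Z3] z2]) simp
    then show ?thesis by simp
  qed
  have "uO I 4 (\<lambda>H i. (S (t0 + s H i) (?p (s H i) + Z H i) - S (t0 + s H i) (?p (s H i)) - (L0 (Z H i) + s H i *\<^sub>R L1 (Z H i)))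
      + (S (t0 + s H i) (?p (s H i)) - poly_curve 4 \<sigma> (s H i))
      + L0 (Z H i - (z2 H i + z3 H i)) + s H i *\<^sub>R L1 (Z H i - z2 H i))"
    using uO_scaleR[OF s uO_bounded_linear[OF L(2) Z3]]
    by (intro uO_add uO_expand_increment[OF exS s Z2] uO_expand_value[OF exS s] uO_bounded_linear[OF L(1) Z4]) simp
  moreover have "(S (t0 + s H i) (?p (s H i) + Z H i) - S (t0 + s H i) (?p (s H i)) - (L0 (Z H i) + s H i *\<^sub>R L1 (Z H i)))
      + (S (t0 + s H i) (?p (s H i)) - poly_curve 4 \<sigma> (s H i))
      + L0 (Z H i - (z2 H i + z3 H i)) + s H i *\<^sub>R L1 (Z H i - z2 H i) =
      S (t0 + c $ i * H) (Y H i) -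
     (poly_curve 4 \<sigma> (c $ i * H) + H ^ 2 *\<^sub>R (stage_defect A c 2 $ i *\<^sub>R L0 (a 2)) +
      H ^ 3 *\<^sub>R (stage_defect A c 3 $ i *\<^sub>R L0 (a 3) + (A *v stage_defect A c 2) $ i *\<^sub>R L0 (M0 (a 2)) +
         (c $ i * stage_defect A c 2 $ i) *\<^sub>R L1 (a 2)))" for H i
  proof -
    have Y: "?p (s H i) + Z H i = Y H i" by (simp add: Z_def s_def)
    have "L0 (z2 H i + z3 H i) + s H i *\<^sub>R L1 (z2 H i) = H ^ 2 *\<^sub>R (stage_defect A c 2 $ i *\<^sub>R L0 (a 2)) +
      H ^ 3 *\<^sub>R (stage_defect A c 3 $ i *\<^sub>R L0 (a 3) + (A *v stage_defect A c 2) $ i *\<^sub>R L0 (M0 (a 2)) +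
         (c $ i * stage_defect A c 2 $ i) *\<^sub>R L1 (a 2))"
      by (simp add: z2_def z3_def s_def L0.add L0.scaleR L1.scaleR scaleR_add_right power2_eq_square power3_eq_cube mult_ac)
    then show ?thesis
      unfolding Y by (simp add: L0.diff L1.diff scaleR_diff_right s_def algebra_simps)
  qed
  ultimately show ?thesis by (simp add: I_def)
qed

text \<open>
  The slow forcing of the inner problem minus the slow field on the curve, in powers of H with
  coefficients depending on \<tau> = \<theta> / H. Consistency removes the term of order zero.
\<close>

lemma coupled_forcing_identity:
  fixes \<sigma> :: "nat \<Rightarrow> 'a::real_vector"
  assumes "coupling \<gamma> 1 \<tau> = 1"
  shows "(\<Sum>j\<in>UNIV. poly (\<gamma> $ j) \<tau> *\<^sub>R (poly_curve 4 \<sigma> (c $ j * H) + H ^ 2 *\<^sub>R (x2 $ j *\<^sub>R u1) +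
      H ^ 3 *\<^sub>R (x3 $ j *\<^sub>R u2 + x4 $ j *\<^sub>R u3 + (c $ j * x2 $ j) *\<^sub>R u4))) - poly_curve 4 \<sigma> (\<tau> * H) =
    H *\<^sub>R ((coupling \<gamma> c \<tau> - \<tau>) *\<^sub>R \<sigma> 1) +
    H ^ 2 *\<^sub>R ((coupling \<gamma> (\<chi> j. c $ j ^ 2) \<tau> - \<tau> ^ 2) *\<^sub>R \<sigma> 2 + coupling \<gamma> x2 \<tau> *\<^sub>R u1) +
    H ^ 3 *\<^sub>R ((coupling \<gamma> (\<chi> j. c $ j ^ 3) \<tau> - \<tau> ^ 3) *\<^sub>R \<sigma> 3 + coupling \<gamma> x3 \<tau> *\<^sub>R u2 +
       coupling \<gamma> x4 \<tau> *\<^sub>R u3 + coupling \<gamma> (\<chi> j. c $ j * x2 $ j) \<tau> *\<^sub>R u4)"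
proof -
  let ?g = "\<lambda>j. poly (\<gamma> $ j) \<tau>"
  have one: "(\<Sum>j\<in>UNIV. ?g j) = 1" using assms by (simp add: coupling_def)
  have pull: "(\<Sum>j\<in>UNIV. ?g j *\<^sub>R (r *\<^sub>R (x j *\<^sub>R v))) = r *\<^sub>R (coupling \<gamma> (\<chi> j. x j) \<tau> *\<^sub>R v)" for r x and v :: 'a
    unfolding coupling_scaleR_sum[symmetric] scaleR_sum_right by (simp add: mult_ac)
  have curve: "poly_curve 4 \<sigma> (x * H) = \<sigma> 0 + H *\<^sub>R (x *\<^sub>R \<sigma> 1) + H ^ 2 *\<^sub>R (x ^ 2 *\<^sub>R \<sigma> 2) + H ^ 3 *\<^sub>R (x ^ 3 *\<^sub>R \<sigma> 3)" for x
    by (simp add: poly_curve_def eval_nat_numeral mult_ac)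
  have "(\<Sum>j\<in>UNIV. ?g j *\<^sub>R (poly_curve 4 \<sigma> (c $ j * H) + H ^ 2 *\<^sub>R (x2 $ j *\<^sub>R u1) +
      H ^ 3 *\<^sub>R (x3 $ j *\<^sub>R u2 + x4 $ j *\<^sub>R u3 + (c $ j * x2 $ j) *\<^sub>R u4))) =
    (\<Sum>j\<in>UNIV. ?g j) *\<^sub>R \<sigma> 0 + H *\<^sub>R (coupling \<gamma> c \<tau> *\<^sub>R \<sigma> 1) + H ^ 2 *\<^sub>R (coupling \<gamma> (\<chi> j. c $ j ^ 2) \<tau> *\<^sub>R \<sigma> 2) +
    H ^ 3 *\<^sub>R (coupling \<gamma> (\<chi> j. c $ j ^ 3) \<tau> *\<^sub>R \<sigma> 3) + H ^ 2 *\<^sub>R (coupling \<gamma> x2 \<tau> *\<^sub>R u1) +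
    H ^ 3 *\<^sub>R (coupling \<gamma> x3 \<tau> *\<^sub>R u2) + H ^ 3 *\<^sub>R (coupling \<gamma> x4 \<tau> *\<^sub>R u3) +
    H ^ 3 *\<^sub>R (coupling \<gamma> (\<chi> j. c $ j * x2 $ j) \<tau> *\<^sub>R u4)"
    by (simp only: curve scaleR_add_right sum.distrib pull scaleR_sum_left vec_lambda_eta add_ac)
  then show ?thesis
    unfolding curve one by (simp add: scaleR_add_right scaleR_diff_left scaleR_diff_right)
qed

text \<open>
  Each coefficient of the forcing is a scalar function of \<tau>, namely coupling \<gamma> w \<tau> - \<tau>^n or
  coupling \<gamma> w \<tau> for one of the vectors w listed here, times a vector that depends on the problem. The
  conditions on the moments are what \<open>propagated_error\<close> demands of these functions. The weight
  (1 - \<tau>)^2 gives no further condition because it is 2 (1 - \<tau>) - (1 - \<tau>^2).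
\<close>

theorem spc_order_of_moments:
  fixes A :: "real^'s^'s" and c :: "real^'s" and \<gamma> :: "(real poly)^'s"
  assumes c: "\<And>i. (\<Sum>j\<in>UNIV. A $ i $ j) = c $ i"
    and cons: "\<And>\<tau>. coupling \<gamma> 1 \<tau> = 1"
    and quad: "coupling_moment (\<lambda>_. 1) \<gamma> c = 1 / 2" "coupling_moment (\<lambda>_. 1) \<gamma> (\<chi> j. c $ j ^ 2) = 1 / 3"
      "coupling_moment (\<lambda>_. 1) \<gamma> (\<chi> j. c $ j ^ 3) = 1 / 4"
    and stage: "coupling_moment (\<lambda>_. 1) \<gamma> (stage_defect A c 2) = 0" "coupling_moment (\<lambda>_. 1) \<gamma> (stage_defect A c 3) = 0"
      "coupling_moment (\<lambda>_. 1) \<gamma> (A *v stage_defect A c 2) = 0"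
      "coupling_moment (\<lambda>_. 1) \<gamma> (\<chi> j. c $ j * stage_defect A c 2 $ j) = 0"
    and coupl: "coupling_moment (\<lambda>\<tau>. 1 - \<tau>) \<gamma> c = 1 / 6" "coupling_moment (\<lambda>\<tau>. (1 - \<tau>\<^sup>2) / 2) \<gamma> c = 1 / 8"
      "coupling_moment (\<lambda>\<tau>. 1 - \<tau>) \<gamma> (\<chi> j. c $ j ^ 2) = 1 / 12"
      "coupling_moment (\<lambda>\<tau>. 1 - \<tau>) \<gamma> (stage_defect A c 2) = 0"
  shows "spc_has_order TYPE('a::euclidean_space) A c \<gamma> 4"
  unfolding spc_has_order_def
proof (intro exI[of _ 4] allI impI, elim conjE)
  fix G S :: "real \<Rightarrow> 'a \<Rightarrow> 'a" and t0 y0 T y Y v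
  assume smG: "smooth_class 4 (\<lambda>(t, x). G t x)" and smS: "smooth_class 4 (\<lambda>(t, x). S t x)"
    and T: "0 < T" and y: "ivp_solution (\<lambda>t x. G t x + S t x) t0 y0 T y"
    and br: "rk_stage_branch A c (\<lambda>t x. G t x + S t x) t0 y0 Y"
    and v: "\<forall>\<^sub>F H in at_right 0. spc_inner_solution \<gamma> c G S t0 y0 H (Y H) (v H)"
  let ?f = "\<lambda>t x. G t x + S t x" and ?I = "\<lambda>H. {0..H::real}"
  have "smooth_class 4 (\<lambda>(t, x). ?f t x)"
    using smooth_class_add[OF smG smS] by (simp add: case_prod_unfold)
  then obtain a where ap: "approx_solution ?f t0 y0 4 a"
    using approx_solution_exists[of ?f 4 t0 y0] by auto
  let ?p = "poly_curve 5 a" and ?p' = "poly_curve 4 (poly_curve_deriv a)"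
  have five: "Suc 4 = 5" by simp
  obtain \<sigma> L0 L1 where exS: "expands_along S t0 ?p \<sigma> L0 L1"
    using smooth_imp_expands_along[OF smS, of t0 4 a] unfolding five by blast
  obtain \<tau> N0 N1 where exG: "expands_along G t0 ?p \<tau> N0 N1"
    using smooth_imp_expands_along[OF smG, of t0 4 a] unfolding five by blast
  define M0 where "M0 = (\<lambda>Z. N0 Z + L0 Z)"
  have exf: "expands_along ?f t0 ?p (\<lambda>i. \<tau> i + \<sigma> i) M0 (\<lambda>Z. N1 Z + L1 Z)"
    unfolding M0_def by (rule expands_along_add[OF exG exS])
  have N: "bounded_linear N0" "bounded_linear N1" using exG unfolding expands_along_def by auto
  obtain C where C: "C \<ge> 0" "\<And>s. \<bar>s\<bar> \<le> 1 \<Longrightarrow> norm (?p' s - ?f (t0 + s) (?p s)) \<le> C * \<bar>s\<bar> ^ 4" and a0: "a 0 = y0"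
    using ap unfolding approx_solution_def by blast
  let ?x2 = "stage_defect A c 2" and ?x3 = "stage_defect A c 3" and ?x4 = "A *v stage_defect A c 2"
  define W where "W H j = poly_curve 4 \<sigma> (c $ j * H) + H ^ 2 *\<^sub>R (?x2 $ j *\<^sub>R L0 (a 2)) +
      H ^ 3 *\<^sub>R (?x3 $ j *\<^sub>R L0 (a 3) + ?x4 $ j *\<^sub>R L0 (M0 (a 2)) + (c $ j * ?x2 $ j) *\<^sub>R L1 (a 2))" for H j
  define d1 where "d1 \<tau> = (coupling \<gamma> c \<tau> - \<tau>) *\<^sub>R \<sigma> 1" for \<tau>
  define d2 where "d2 \<tau> = (coupling \<gamma> (\<chi> j. c $ j ^ 2) \<tau> - \<tau> ^ 2) *\<^sub>R \<sigma> 2 + coupling \<gamma> ?x2 \<tau> *\<^sub>R L0 (a 2)" for \<tau>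
  define d3 where "d3 \<tau> = (coupling \<gamma> (\<chi> j. c $ j ^ 3) \<tau> - \<tau> ^ 3) *\<^sub>R \<sigma> 3 + coupling \<gamma> ?x3 \<tau> *\<^sub>R L0 (a 3) +
       coupling \<gamma> ?x4 \<tau> *\<^sub>R L0 (M0 (a 2)) + coupling \<gamma> (\<chi> j. c $ j * ?x2 $ j) \<tau> *\<^sub>R L1 (a 2)" for \<tau>
  define D0 where "D0 H \<theta> = (?f (t0 + \<theta>) (?p \<theta>) - ?p' \<theta>) +
      ((\<Sum>j\<in>UNIV. poly (\<gamma> $ j) (\<theta> / H) *\<^sub>R S (t0 + c $ j * H) (Y H j)) - S (t0 + \<theta>) (?p \<theta>))" for H \<theta>
  define low where "low H \<theta> = H *\<^sub>R d1 (\<theta> / H) + H ^ 2 *\<^sub>R d2 (\<theta> / H) + H ^ 3 *\<^sub>R d3 (\<theta> / H)" for H \<theta>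
  have D0: "uO ?I 4 (\<lambda>H \<theta>. D0 H \<theta> - low H \<theta>)"
  proof (rule uO_cong)
    have st: "uO ?I 4 (\<lambda>H \<theta>. S (t0 + c $ j * H) (Y H j) - W H j)" for j
      using uO_reindex[OF slow_stage_expansion[OF c br ap exf exS], where I = ?I and r = "\<lambda>H \<theta>. j"]
      by (simp add: W_def)
    have "uO ?I 4 (\<lambda>H \<theta>. poly (\<gamma> $ j) (\<theta> / H) *\<^sub>R (S (t0 + c $ j * H) (Y H j) - W H j))" for j
      using uO_scaleR[OF uO_rescale st, of "poly (\<gamma> $ j)" j] by (simp add: continuous_intros)
    moreover have "uO ?I 4 (\<lambda>H \<theta>. - (S (t0 + \<theta>) (?p \<theta>) - poly_curve 4 \<sigma> \<theta>))"
      by (rule uO_minus[OF uO_expand_value[OF exS uO_theta]])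
    moreover have "uO ?I 4 (\<lambda>H \<theta>. - (?p' \<theta> - ?f (t0 + \<theta>) (?p \<theta>)))"
      by (rule uO_minus[OF uO_local_power[OF C(2,1) uO_theta]])
    ultimately show "uO ?I 4 (\<lambda>H \<theta>. - (?p' \<theta> - ?f (t0 + \<theta>) (?p \<theta>)) +
        (\<Sum>j\<in>UNIV. poly (\<gamma> $ j) (\<theta> / H) *\<^sub>R (S (t0 + c $ j * H) (Y H j) - W H j)) +
        - (S (t0 + \<theta>) (?p \<theta>) - poly_curve 4 \<sigma> \<theta>))"
      by (intro uO_add uO_sum) simp_all
    show "\<forall>\<^sub>F H in at_right 0. \<forall>\<theta>\<in>{0..H}. D0 H \<theta> - low H \<theta> = - (?p' \<theta> - ?f (t0 + \<theta>) (?p \<theta>)) +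
        (\<Sum>j\<in>UNIV. poly (\<gamma> $ j) (\<theta> / H) *\<^sub>R (S (t0 + c $ j * H) (Y H j) - W H j)) +
        - (S (t0 + \<theta>) (?p \<theta>) - poly_curve 4 \<sigma> \<theta>)"
      using eventually_pos
    proof eventually_elim
      case (elim H)
      have "low H \<theta> = (\<Sum>j\<in>UNIV. poly (\<gamma> $ j) (\<theta> / H) *\<^sub>R W H j) - poly_curve 4 \<sigma> \<theta>" for \<theta>
        using coupled_forcing_identity[OF cons, of "\<theta> / H" \<sigma> c H ?x2 "L0 (a 2)" ?x3 "L0 (a 3)" ?x4 "L0 (M0 (a 2))" "L1 (a 2)"] elim
        by (simp add: low_def W_def d1_def d2_def d3_def)
      then show ?case
        by (simp add: D0_def scaleR_diff_right sum_subtractf)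
    qed
  qed
  have cont: "continuous_on {0..1} d1" "continuous_on {0..1} d2" "continuous_on {0..1} d3"
    unfolding d1_def d2_def d3_def by (intro continuous_intros)+
  have low: "uO ?I 1 low"
  proof -
    have "uO ?I 1 (\<lambda>H \<theta>. H ^ 1 *\<^sub>R d1 (\<theta> / H))" "uO ?I 2 (\<lambda>H \<theta>. H ^ 2 *\<^sub>R d2 (\<theta> / H))" "uO ?I 3 (\<lambda>H \<theta>. H ^ 3 *\<^sub>R d3 (\<theta> / H))"
      using uO_power_scaleR[OF uO_rescale[OF cont(1)], of 1] uO_power_scaleR[OF uO_rescale[OF cont(2)], of 2]
        uO_power_scaleR[OF uO_rescale[OF cont(3)], of 3] by simp_all
    then show ?thesis unfolding low_def[abs_def]
      by (intro uO_add) (auto elim: uO_mono)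
  qed
  have D01: "uO ?I 1 D0"
  proof -
    have "uO ?I 1 (\<lambda>H \<theta>. (D0 H \<theta> - low H \<theta>) + low H \<theta>)" by (rule uO_add[OF uO_mono[OF D0] low]) simp
    then show ?thesis by simp
  qed
  define E where "E H \<theta> = v H \<theta> - ?p \<theta>" for H \<theta>
  define dG where "dG \<theta> e = G (t0 + \<theta>) (?p \<theta> + e) - G (t0 + \<theta>) (?p \<theta>)" for \<theta> e
  have derE: "\<forall>\<^sub>F H in at_right 0. \<forall>\<theta>\<in>{0..H}. (E H has_vector_derivative dG \<theta> (E H \<theta>) + D0 H \<theta>) (at \<theta> within {0..H})"
    using v
  proof eventually_elim
    case (elim H)
    show ?case
    proof
      fix \<theta> assume \<theta>: "\<theta> \<in> {0..H}"
      have "(v H has_vector_derivative G (t0 + \<theta>) (v H \<theta>) +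
          (\<Sum>j\<in>UNIV. poly (\<gamma> $ j) (\<theta> / H) *\<^sub>R S (t0 + c $ j * H) (Y H j))) (at \<theta> within {0..H})"
        using elim \<theta> unfolding spc_inner_solution_def by blast
      from has_vector_derivative_diff[OF this poly_curve_has_vector_derivative[of 4 a, unfolded five]]
      show "(E H has_vector_derivative dG \<theta> (E H \<theta>) + D0 H \<theta>) (at \<theta> within {0..H})"
        by (simp add: E_def[abs_def] dG_def D0_def algebra_simps)
    qed
  qed
  have E0: "\<forall>\<^sub>F H in at_right 0. E H 0 = 0"
    using v by eventually_elim (use poly_curve_0[of 4 a] a0 in \<open>simp add: E_def spc_inner_solution_def\<close>)
  \<comment> \<open>crude bound first: it makes the remainder of the linearization of G negligible\<close>
  have E2: "uO ?I 2 E"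
  proof -
    obtain K where K: "K \<ge> 0" "\<And>s Z. \<bar>s\<bar> \<le> 1 \<Longrightarrow> norm Z \<le> 1 \<Longrightarrow>
        norm (G (t0 + s) (?p s + Z) - G (t0 + s) (?p s)) \<le> K * norm Z"
      using expands_along_lipschitz[OF exG] by blast
    obtain B where B: "B \<ge> 0" "\<forall>\<^sub>F H in at_right 0. \<forall>\<theta>\<in>{0..H}. norm (D0 H \<theta>) \<le> B * H ^ 1"
      using uOE[OF D01] by blast
    have "uO ?I (Suc 1) E"
    proof (rule uO_deviation[OF derE E0 _ K(1) B(1)])
      show "\<forall>\<^sub>F H in at_right 0. \<forall>\<theta>\<in>{0..H}. norm (E H \<theta>) \<le> 1 \<longrightarrow>
          norm (dG \<theta> (E H \<theta>) + D0 H \<theta>) \<le> K * norm (E H \<theta>) + B * H ^ 1"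
        using B(2) eventually_less[of 1, simplified]
      proof (eventually_elim, intro ballI impI)
        fix H \<theta> :: real
        assume BH: "\<forall>\<theta>\<in>{0..H}. norm (D0 H \<theta>) \<le> B * H ^ 1" and H: "H < 1"
          and \<theta>: "\<theta> \<in> {0..H}" and le1: "norm (E H \<theta>) \<le> 1"
        have "\<bar>\<theta>\<bar> \<le> 1" using \<theta> H by auto
        from K(2)[OF this le1] have "norm (dG \<theta> (E H \<theta>)) \<le> K * norm (E H \<theta>)" by (simp add: dG_def)
        moreover have "norm (D0 H \<theta>) \<le> B * H ^ 1" using BH \<theta> by blast
        ultimately show "norm (dG \<theta> (E H \<theta>) + D0 H \<theta>) \<le> K * norm (E H \<theta>) + B * H ^ 1"
          by (rule norm_triangle_mono)
      qed
    qed
    then show ?thesis by (simp add: numeral_2_eq_2)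
  qed
  define D where "D H \<theta> = (dG \<theta> (E H \<theta>) - (N0 (E H \<theta>) + \<theta> *\<^sub>R N1 (E H \<theta>))) + D0 H \<theta>" for H \<theta>
  have D: "uO ?I 4 (\<lambda>H \<theta>. D H \<theta> - (H *\<^sub>R d1 (\<theta> / H) + H ^ 2 *\<^sub>R d2 (\<theta> / H) + H ^ 3 *\<^sub>R d3 (\<theta> / H)))"
  proof -
    have "uO ?I 4 (\<lambda>H \<theta>. (dG \<theta> (E H \<theta>) - (N0 (E H \<theta>) + \<theta> *\<^sub>R N1 (E H \<theta>))) + (D0 H \<theta> - low H \<theta>))"
      unfolding dG_def by (rule uO_add[OF uO_expand_increment[OF exG uO_theta E2] D0])
    then show ?thesis by (simp add: D_def low_def add_diff_eq)
  qed
  have derE': "\<forall>\<^sub>F H in at_right 0. \<forall>\<theta>\<in>{0..H}.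
      (E H has_vector_derivative N0 (E H \<theta>) + \<theta> *\<^sub>R N1 (E H \<theta>) + D H \<theta>) (at \<theta> within {0..H})"
    using derE by eventually_elim (simp add: D_def)
  have mom: "((\<lambda>\<tau>. (\<phi> \<tau> * (coupling \<gamma> w \<tau> - \<tau> ^ n)) *\<^sub>R x) has_integral 0) {0..1}"
    if "continuous_on {0..1} \<phi>" "((\<lambda>\<tau>. \<phi> \<tau> * \<tau> ^ n) has_integral coupling_moment \<phi> \<gamma> w) {0..1}" for \<phi> w n and x :: 'a
    using has_integral_scaleR_left[OF has_integral_diff[OF has_integral_coupling_moment[OF that(1), of \<gamma> w] that(2)], of x]
    by (simp add: right_diff_distrib)
  have mom0: "((\<lambda>\<tau>. (\<phi> \<tau> * coupling \<gamma> w \<tau>) *\<^sub>R x) has_integral 0) {0..1}"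
    if "continuous_on {0..1} \<phi>" "coupling_moment \<phi> \<gamma> w = 0" for \<phi> w and x :: 'a
    using has_integral_scaleR_left[OF has_integral_coupling_moment[OF that(1), of \<gamma> w], of x] that(2) by simp
  note c1 = continuous_on_const
  have cm: "continuous_on {0..1::real} (\<lambda>\<tau>. 1 - \<tau>)" "continuous_on {0..1::real} (\<lambda>\<tau>. (1 - \<tau>\<^sup>2) / 2)"
    by (intro continuous_intros; simp)+
  have i1: "((\<lambda>\<tau>::real. 1 * \<tau> ^ 1) has_integral coupling_moment (\<lambda>_. 1) \<gamma> c) {0..1}"
    and i2: "((\<lambda>\<tau>::real. 1 * \<tau> ^ 2) has_integral coupling_moment (\<lambda>_. 1) \<gamma> (\<chi> j. c $ j ^ 2)) {0..1}"
    and i3: "((\<lambda>\<tau>::real. 1 * \<tau> ^ 3) has_integral coupling_moment (\<lambda>_. 1) \<gamma> (\<chi> j. c $ j ^ 3)) {0..1}"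
    using has_integral_power_01[of 1] has_integral_power_01[of 2] has_integral_power_01[of 3] by (simp_all add: quad)
  have i4: "((\<lambda>\<tau>::real. (1 - \<tau>) * \<tau> ^ 1) has_integral coupling_moment (\<lambda>\<tau>. 1 - \<tau>) \<gamma> c) {0..1}"
    and i5: "((\<lambda>\<tau>::real. (1 - \<tau>) * \<tau> ^ 2) has_integral coupling_moment (\<lambda>\<tau>. 1 - \<tau>) \<gamma> (\<chi> j. c $ j ^ 2)) {0..1}"
    using has_integral_zeta[of 1] has_integral_zeta[of 2] by (simp_all only: coupl) (simp_all add: zeta_def)
  have i6: "((\<lambda>\<tau>::real. (1 - \<tau>\<^sup>2) / 2 * \<tau> ^ 1) has_integral coupling_moment (\<lambda>\<tau>. (1 - \<tau>\<^sup>2) / 2) \<gamma> c) {0..1}"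
    using has_integral_omega[of 1] by (simp only: coupl) (simp add: omega_def)
  have int1: "(d1 has_integral 0) {0..1}" using mom[OF c1 i1, of "\<sigma> 1"] by (simp add: d1_def[abs_def])
  have int2: "(d2 has_integral 0) {0..1}"
    using has_integral_add[OF mom[OF c1 i2, of "\<sigma> 2"] mom0[OF c1 stage(1), of "L0 (a 2)"]] by (simp add: d2_def[abs_def])
  have int3: "(d3 has_integral 0) {0..1}"
    using has_integral_add[OF has_integral_add[OF has_integral_add[OF mom[OF c1 i3, of "\<sigma> 3"]
       mom0[OF c1 stage(2), of "L0 (a 3)"]] mom0[OF c1 stage(3), of "L0 (M0 (a 2))"]] mom0[OF c1 stage(4), of "L1 (a 2)"]]
    by (simp add: d3_def[abs_def])
  have int4: "((\<lambda>\<tau>. (1 - \<tau>) *\<^sub>R d1 \<tau>) has_integral 0) {0..1}"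
    using mom[OF cm(1) i4, of "\<sigma> 1"] by (simp add: d1_def[abs_def])
  have int5: "((\<lambda>\<tau>. (1 - \<tau>) *\<^sub>R d2 \<tau>) has_integral 0) {0..1}"
    using has_integral_add[OF mom[OF cm(1) i5, of "\<sigma> 2"] mom0[OF cm(1) coupl(4), of "L0 (a 2)"]]
    by (simp add: d2_def[abs_def] scaleR_add_right)
  have int7: "((\<lambda>\<tau>. (1 - \<tau>\<^sup>2) *\<^sub>R d1 \<tau>) has_integral 0) {0..1}"
    using has_integral_cmul[OF mom[OF cm(2) i6, of "\<sigma> 1"], of 2] by (simp add: d1_def[abs_def])
  have int6: "((\<lambda>\<tau>. (1 - \<tau>)\<^sup>2 *\<^sub>R d1 \<tau>) has_integral 0) {0..1}"
  proof -
    have "((\<lambda>\<tau>. 2 *\<^sub>R (1 - \<tau>) *\<^sub>R d1 \<tau> - (1 - \<tau>\<^sup>2) *\<^sub>R d1 \<tau>) has_integral 2 *\<^sub>R 0 - 0) {0..1}"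
      by (intro has_integral_diff has_integral_cmul int4 int7)
    moreover have "2 *\<^sub>R (1 - \<tau>) *\<^sub>R d1 \<tau> - (1 - \<tau>\<^sup>2) *\<^sub>R d1 \<tau> = (1 - \<tau>)\<^sup>2 *\<^sub>R d1 \<tau>" for \<tau>
    proof -
      have e: "(1 - \<tau>)\<^sup>2 = 2 * (1 - \<tau>) - (1 - \<tau>\<^sup>2)"
        by (simp add: power2_eq_square algebra_simps)
      show ?thesis unfolding e scaleR_diff_left[of "2 * (1 - \<tau>)"] by simp
    qed
    ultimately show ?thesis by simp
  qed
  have "stepO 5 (\<lambda>H. E H H)"
    by (rule propagated_error[OF N derE' E0 E2 D cont int1 int2 int3 int4 int5 int6 int7])
  from uO_diff[OF this approx_solution_error[OF ap exf y T]]
  have "stepO 5 (\<lambda>H. v H H - y (t0 + H))" by (simp add: E_def)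
  then show "(\<lambda>H. norm (v H H - y (t0 + H))) \<in> O[at_right 0](\<lambda>H. H ^ (4 + 1))"
    by (simp add: uO_iff_bigo)
qed

section \<open>Order conditions of the base method from linear test problems\<close>

text \<open>
  For small H the right-hand side is a contraction in z.
\<close>

lemma linear_stages_solvable:
  fixes B :: "real \<Rightarrow> 's::finite \<Rightarrow> 's \<Rightarrow> real" and r :: "real \<Rightarrow> 's \<Rightarrow> real"
  assumes B: "\<forall>\<^sub>F H in at_right 0. \<forall>i j. \<bar>B H i j\<bar> \<le> K"
  obtains \<zeta> where "\<forall>\<^sub>F H in at_right 0. \<forall>i. \<zeta> H i = H * (\<Sum>j\<in>UNIV. B H i j * \<zeta> H j) + r H i"
proof -
  define N where "N = real (card (UNIV :: 's set))"
  have N: "N \<ge> 0" by (simp add: N_def)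
  have pos: "1 / (2 * (N * (N * \<bar>K\<bar>) + 1)) > 0" using N by (simp add: add_nonneg_pos)
  have "\<forall>\<^sub>F H in at_right 0. \<exists>z. \<forall>i. z i = H * (\<Sum>j\<in>UNIV. B H i j * z j) + r H i"
    using B eventually_pos eventually_less[OF pos]
  proof eventually_elim
    case (elim H)
    define f where "f x = (\<chi> i. H * (\<Sum>j\<in>UNIV. B H i j * x $ j) + r H i)" for x :: "real^'s"
    have "N * (N * \<bar>K\<bar>) + 1 > 0" using N by (simp add: add_nonneg_pos)
    then have "H * (N * (N * \<bar>K\<bar>) + 1) \<le> 1 / 2" using elim(3) by (simp add: field_simps)
    then have small: "H * (N * (N * \<bar>K\<bar>)) \<le> 1 / 2" using elim(2) by (simp add: algebra_simps)
    have "dist (f x) (f y) \<le> 1 / 2 * dist x y" for x y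
    proof -
      have "norm (f x - f y) \<le> (\<Sum>i\<in>UNIV. \<bar>(f x - f y) $ i\<bar>)" by (rule norm_le_l1_cart)
      also have "\<dots> \<le> (\<Sum>i\<in>(UNIV :: 's set). H * (N * (\<bar>K\<bar> * norm (x - y))))"
      proof (rule sum_mono)
        fix i
        have "(f x - f y) $ i = H * (\<Sum>j\<in>UNIV. B H i j * (x - y) $ j)"
          by (simp add: f_def algebra_simps sum_subtractf)
        also have "\<bar>\<dots>\<bar> = H * \<bar>\<Sum>j\<in>UNIV. B H i j * (x - y) $ j\<bar>" using elim(2) by (simp add: abs_mult)
        also have "\<bar>\<Sum>j\<in>UNIV. B H i j * (x - y) $ j\<bar> \<le> (\<Sum>j\<in>(UNIV :: 's set). \<bar>K\<bar> * norm (x - y))"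
        proof (rule order_trans[OF sum_abs], rule sum_mono)
          fix j
          have "\<bar>B H i j\<bar> \<le> \<bar>K\<bar>" using elim(1) abs_ge_self order_trans by blast
          moreover have "\<bar>(x - y) $ j\<bar> \<le> norm (x - y)" by (rule component_le_norm_cart)
          ultimately show "\<bar>B H i j * (x - y) $ j\<bar> \<le> \<bar>K\<bar> * norm (x - y)"
            unfolding abs_mult by (intro mult_mono) auto
        qed
        finally show "\<bar>(f x - f y) $ i\<bar> \<le> H * (N * (\<bar>K\<bar> * norm (x - y)))"
          using elim(2) by (simp add: N_def)
      qed
      also have "\<dots> = H * (N * (N * \<bar>K\<bar>)) * norm (x - y)" by (simp add: N_def algebra_simps)
      also have "\<dots> \<le> 1 / 2 * norm (x - y)" using small by (rule mult_right_mono) simp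
      finally show ?thesis by (simp add: dist_norm)
    qed
    then have "\<exists>!x. f x = x" by (intro banach_fix_type[of "1 / 2"]) auto
    then obtain x where "f x = x" by blast
    then have "x $ i = H * (\<Sum>j\<in>UNIV. B H i j * x $ j) + r H i" for i
      by (metis (no_types, lifting) f_def sum.cong vec_lambda_beta)
    then show ?case by (intro exI[of _ "\<lambda>i. x $ i"]) blast
  qed
  moreover define P where "P H z \<longleftrightarrow> (\<forall>i. z i = H * (\<Sum>j\<in>UNIV. B H i j * z j) + r H i)" for H z
  ultimately have "\<forall>\<^sub>F H in at_right 0. \<exists>z. P H z" by simp
  then have *: "\<forall>\<^sub>F H in at_right 0. P H (SOME z. P H z)"
  proof eventually_elim
    case (elim H)
    then show ?case by (rule someI_ex)
  qed
  define \<zeta> where "\<zeta> H = (SOME z. P H z)" for H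
  have "\<forall>\<^sub>F H in at_right 0. P H (\<zeta> H)" using * by (simp only: \<zeta>_def)
  then show thesis unfolding P_def by (rule that)
qed

text \<open>
  The test equation is x' = w(t) (x - t^m u) + m t^(m - 1) u with w(t) = w0 + w1 t and a unit vector u. Its
  solution is t^m u, and its stages are (c_i H)^m u + \<zeta>_i u, where \<zeta> solves linear equations driven by the
  stage defect of order m. The time-dependent factor w makes this scalar equation rich enough to separate
  the conditions up to order four, whatever the dimension of the state space.
\<close>

lemma rk_linear_test:
  fixes A :: "real^'s^'s" and b c :: "real^'s" and w0 w1 :: real
  assumes ord: "rk_has_order TYPE('a::euclidean_space) A b c 4" and m: "m \<ge> 1"
  obtains \<zeta> where
    "\<forall>\<^sub>F H in at_right 0. \<forall>i. \<zeta> H i =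
       H * (\<Sum>j\<in>UNIV. A $ i $ j * ((w0 + w1 * (c $ j * H)) * \<zeta> H j)) + H ^ m * stage_defect A c m $ i"
    "uO (\<lambda>_. UNIV) m \<zeta>"
    "stepO 5 (\<lambda>H. H * (\<Sum>j\<in>UNIV. b $ j * ((w0 + w1 * (c $ j * H)) * \<zeta> H j)) +
       H ^ m * (real m * (\<Sum>j\<in>UNIV. b $ j * c $ j ^ (m - 1)) - 1))"
proof -
  obtain m' where m': "m = Suc m'" using m by (cases m) auto
  define w where "w s = w0 + w1 * s" for s
  define K where "K = (\<Sum>i\<in>UNIV. \<Sum>j\<in>UNIV. \<bar>A $ i $ j\<bar> * (\<bar>w0\<bar> + \<bar>w1\<bar> * \<bar>c $ j\<bar>))"
  have Bbound: "\<forall>\<^sub>F H in at_right 0. \<forall>i j. \<bar>A $ i $ j * w (c $ j * H)\<bar> \<le> K"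
    using eventually_pos eventually_less[of 1, simplified]
  proof eventually_elim
    case (elim H)
    show ?case
    proof (intro allI)
      fix i j
      have "\<bar>w (c $ j * H)\<bar> \<le> \<bar>w0\<bar> + \<bar>w1 * (c $ j * H)\<bar>" unfolding w_def by (rule abs_triangle_ineq)
      also have "\<bar>w1 * (c $ j * H)\<bar> = (\<bar>w1\<bar> * \<bar>c $ j\<bar>) * H" using elim by (simp add: abs_mult)
      also have "\<dots> \<le> \<bar>w1\<bar> * \<bar>c $ j\<bar>" using elim by (intro mult_left_le) auto
      finally have "\<bar>A $ i $ j * w (c $ j * H)\<bar> \<le> \<bar>A $ i $ j\<bar> * (\<bar>w0\<bar> + \<bar>w1\<bar> * \<bar>c $ j\<bar>)"
        unfolding abs_mult by (intro mult_left_mono) auto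
      also have "\<dots> \<le> (\<Sum>j\<in>UNIV. \<bar>A $ i $ j\<bar> * (\<bar>w0\<bar> + \<bar>w1\<bar> * \<bar>c $ j\<bar>))"
        by (rule member_le_sum) auto
      also have "\<dots> \<le> K" unfolding K_def by (rule member_le_sum) (auto intro: sum_nonneg)
      finally show "\<bar>A $ i $ j * w (c $ j * H)\<bar> \<le> K" .
    qed
  qed
  from linear_stages_solvable[OF this, of "\<lambda>H i. H ^ m * stage_defect A c m $ i"]
  obtain \<zeta> where "\<forall>\<^sub>F H in at_right 0. \<forall>i. \<zeta> H i =
      H * (\<Sum>j\<in>UNIV. A $ i $ j * w (c $ j * H) * \<zeta> H j) + H ^ m * stage_defect A c m $ i" by blast
  then have \<zeta>: "\<forall>\<^sub>F H in at_right 0. \<forall>i. \<zeta> H i =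
      H * (\<Sum>j\<in>UNIV. A $ i $ j * (w (c $ j * H) * \<zeta> H j)) + H ^ m * stage_defect A c m $ i"
    by (simp add: mult.assoc)
  have \<zeta>m: "uO (\<lambda>_. UNIV) m \<zeta>"
  proof (rule uO_absorb[where R = "\<lambda>H i. H ^ m * stage_defect A c m $ i" and K = K])
    show "uO (\<lambda>_. UNIV) m (\<lambda>H i. H ^ m * stage_defect A c m $ i)"
      by (rule uO_monomial)
    show "\<forall>\<^sub>F H in at_right 0. \<forall>i. norm (\<zeta> H i) \<le>
        norm (H ^ m * stage_defect A c m $ i) + H * (K * (\<Sum>j\<in>UNIV. norm (\<zeta> H j)))"
      using \<zeta> Bbound eventually_pos
    proof eventually_elim
      case (elim H)
      show ?case
      proof
        fix i
        have "\<bar>\<Sum>j\<in>UNIV. A $ i $ j * (w (c $ j * H) * \<zeta> H j)\<bar> \<le> (\<Sum>j\<in>UNIV. K * \<bar>\<zeta> H j\<bar>)"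
        proof (rule order_trans[OF sum_abs], rule sum_mono)
          fix j
          have "\<bar>A $ i $ j * (w (c $ j * H) * \<zeta> H j)\<bar> = \<bar>A $ i $ j * w (c $ j * H)\<bar> * \<bar>\<zeta> H j\<bar>"
            by (simp add: abs_mult)
          also have "\<dots> \<le> K * \<bar>\<zeta> H j\<bar>" using elim(2) by (intro mult_right_mono) auto
          finally show "\<bar>A $ i $ j * (w (c $ j * H) * \<zeta> H j)\<bar> \<le> K * \<bar>\<zeta> H j\<bar>" .
        qed
        then have "\<bar>H * (\<Sum>j\<in>UNIV. A $ i $ j * (w (c $ j * H) * \<zeta> H j))\<bar> \<le> H * (K * (\<Sum>j\<in>UNIV. \<bar>\<zeta> H j\<bar>))"
          using elim(3) by (simp add: abs_mult sum_distrib_left[symmetric] mult_left_mono)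
        then show "norm (\<zeta> H i) \<le> norm (H ^ m * stage_defect A c m $ i) + H * (K * (\<Sum>j\<in>UNIV. norm (\<zeta> H j)))"
          using abs_triangle_ineq[of "H * (\<Sum>j\<in>UNIV. A $ i $ j * (w (c $ j * H) * \<zeta> H j))" "H ^ m * stage_defect A c m $ i"]
          by (simp only: elim(1)[rule_format, of i, symmetric] real_norm_def)
      qed
    qed
  qed
  obtain u :: 'a where u: "u \<in> Basis" using nonempty_Basis by blast
  then have nu: "norm u = 1" by simp
  define f where "f t x = w t *\<^sub>R (x - t ^ m *\<^sub>R u) + (real m * t ^ (m - 1)) *\<^sub>R u" for t :: real and x :: 'a
  define Y where "Y H i = ((c $ i * H) ^ m + \<zeta> H i) *\<^sub>R u" for H i
  obtain k where k: "\<And>(f :: real \<Rightarrow> 'a \<Rightarrow> 'a) t0 y0 T y Y.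
        smooth_class k (\<lambda>(t, x). f t x) \<Longrightarrow> 0 < T \<Longrightarrow> ivp_solution f t0 y0 T y \<Longrightarrow>
        rk_stage_branch A c f t0 y0 Y \<Longrightarrow>
        (\<lambda>H. norm (rk_update b c f t0 y0 H (Y H) - y (t0 + H))) \<in> O[at_right 0](\<lambda>H. H ^ (4 + 1))"
    using ord unfolding rk_has_order_def by blast
  have fst: "smooth_class k (fst :: real \<times> 'a \<Rightarrow> real)" and snd: "smooth_class k (snd :: real \<times> 'a \<Rightarrow> 'a)"
    by (rule smooth_class_bounded_linear bounded_linear_fst bounded_linear_snd)+
  have "smooth_class k (\<lambda>z :: real \<times> 'a. (w0 + w1 *\<^sub>R fst z) *\<^sub>R (snd z - fst z ^ m *\<^sub>R u) +
      (real m *\<^sub>R (fst z ^ (m - 1))) *\<^sub>R u)"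
    by (intro smooth_class_add smooth_class_scaleR smooth_class_diff smooth_class_const smooth_class_power fst snd)
  then have smooth: "smooth_class k (\<lambda>(t, x). f t x)"
    by (simp add: f_def w_def case_prod_unfold)
  have fY: "f (0 + c $ j * H) (Y H j) = (w (c $ j * H) * \<zeta> H j + real m * (c $ j * H) ^ (m - 1)) *\<^sub>R u" for H j
    by (simp add: f_def Y_def algebra_simps)
  have ivp: "ivp_solution f 0 0 1 (\<lambda>t. t ^ m *\<^sub>R u)"
    unfolding ivp_solution_def
  proof (intro conjI ballI)
    show "0 ^ m *\<^sub>R u = 0" using m by simp
    fix t :: real
    have "((\<lambda>t. t ^ m) has_vector_derivative real m * t ^ (m - 1)) (at t within {0..0 + 1})"
      using DERIV_pow[of m t "{0..0 + 1}"] by (simp add: has_real_derivative_iff_has_vector_derivative)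
    from bounded_linear.has_vector_derivative[OF bounded_linear_scaleR_left this, of u]
    show "((\<lambda>t. t ^ m *\<^sub>R u) has_vector_derivative f t (t ^ m *\<^sub>R u)) (at t within {0..0 + 1})"
      by (simp add: f_def)
  qed
  have branch: "rk_stage_branch A c f 0 0 Y"
    unfolding rk_stage_branch_def
  proof (intro conjI allI)
    show "\<forall>\<^sub>F H in at_right 0. rk_stages A c f 0 0 H (Y H)"
      using \<zeta>
    proof eventually_elim
      case (elim H)
      have "Y H i = 0 + H *\<^sub>R (\<Sum>j\<in>UNIV. A $ i $ j *\<^sub>R f (0 + c $ j * H) (Y H j))" for i
      proof -
        have "H * (\<Sum>j\<in>UNIV. A $ i $ j * (real m * (c $ j * H) ^ (m - 1))) =
            H ^ m * (real m * (\<Sum>j\<in>UNIV. A $ i $ j * c $ j ^ (m - 1)))"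
          by (simp add: m' power_mult_distrib sum_distrib_left mult_ac)
        moreover have "(\<Sum>j\<in>UNIV. A $ i $ j *\<^sub>R f (0 + c $ j * H) (Y H j)) =
            ((\<Sum>j\<in>UNIV. A $ i $ j * (w (c $ j * H) * \<zeta> H j)) +
             (\<Sum>j\<in>UNIV. A $ i $ j * (real m * (c $ j * H) ^ (m - 1)))) *\<^sub>R u"
          unfolding fY by (simp add: scaleR_sum_left sum.distrib distrib_left scaleR_add_left scaleR_add_right)
        moreover have "\<zeta> H i = H * (\<Sum>j\<in>UNIV. A $ i $ j * (w (c $ j * H) * \<zeta> H j)) + H ^ m * stage_defect A c m $ i"
          using elim by blast
        ultimately show ?thesis
          by (simp add: Y_def stage_defect_def distrib_left power_mult_distrib right_diff_distrib mult.commute[of _ "H ^ m"])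
      qed
      then show ?case unfolding rk_stages_def by blast
    qed
    fix i
    have "((\<lambda>H. \<zeta> H i) \<longlongrightarrow> 0) (at_right 0)" by (rule uO_tendsto_0[OF \<zeta>m[unfolded m']])
    moreover have "((\<lambda>H. (c $ i * H) ^ m) \<longlongrightarrow> (c $ i * 0) ^ m) (at_right 0)" by (intro tendsto_intros)
    ultimately have "((\<lambda>H. Y H i) \<longlongrightarrow> ((c $ i * 0) ^ m + 0) *\<^sub>R u) (at_right 0)"
      unfolding Y_def by (intro tendsto_intros)
    then show "((\<lambda>H. Y H i) \<longlongrightarrow> 0) (at_right 0)" using m' by simp
  qed
  have err: "rk_update b c f 0 0 H (Y H) - (0 + H) ^ m *\<^sub>R u =
     (H * (\<Sum>j\<in>UNIV. b $ j * (w (c $ j * H) * \<zeta> H j)) + H ^ m * (real m * (\<Sum>j\<in>UNIV. b $ j * c $ j ^ (m - 1)) - 1)) *\<^sub>R u" for H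
  proof -
    have "H * (\<Sum>j\<in>UNIV. b $ j * (real m * (c $ j * H) ^ (m - 1))) =
        H ^ m * (real m * (\<Sum>j\<in>UNIV. b $ j * c $ j ^ (m - 1)))"
      by (simp add: m' power_mult_distrib sum_distrib_left mult_ac)
    moreover have "(\<Sum>j\<in>UNIV. b $ j *\<^sub>R f (0 + c $ j * H) (Y H j)) =
        ((\<Sum>j\<in>UNIV. b $ j * (w (c $ j * H) * \<zeta> H j)) +
         (\<Sum>j\<in>UNIV. b $ j * (real m * (c $ j * H) ^ (m - 1)))) *\<^sub>R u"
      unfolding fY by (simp add: scaleR_sum_left sum.distrib distrib_left scaleR_add_left scaleR_add_right)
    ultimately show ?thesis
      by (simp add: rk_update_def distrib_left scaleR_add_left scaleR_add_right scaleR_diff_left right_diff_distrib)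
  qed
  have "stepO 5 (\<lambda>H. H * (\<Sum>j\<in>UNIV. b $ j * (w (c $ j * H) * \<zeta> H j)) +
       H ^ m * (real m * (\<Sum>j\<in>UNIV. b $ j * c $ j ^ (m - 1)) - 1))"
    using k[OF smooth zero_less_one ivp branch] unfolding err uO_iff_bigo by (simp add: nu)
  with \<zeta> \<zeta>m show thesis by (intro that[of \<zeta>]) (simp_all add: w_def)
qed

text \<open>
  The test problems used are w = 0 with m = 2, 3, 4 for the quadrature conditions, w = 1 with m = 3, w = 1
  with m = 2, which gives two conditions at the orders three and four, and w = t with m = 2. The seven
  equations are equivalent to the order conditions of the rooted trees with two, three and four vertices.
\<close>

lemma rk_order_4_conditions:
  fixes A :: "real^'s^'s" and b c :: "real^'s"
  assumes ord: "rk_has_order TYPE('a::euclidean_space) A b c 4"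
  shows rk_quadrature: "\<And>m. 2 \<le> m \<Longrightarrow> m \<le> 4 \<Longrightarrow> real m * (\<Sum>j\<in>UNIV. b $ j * c $ j ^ (m - 1)) = 1"
    and rk_stage_3: "(\<Sum>j\<in>UNIV. b $ j * stage_defect A c 3 $ j) = 0"
    and rk_stage_2: "(\<Sum>j\<in>UNIV. b $ j * stage_defect A c 2 $ j) = 0"
    and rk_A_stage_2: "(\<Sum>j\<in>UNIV. b $ j * (A *v stage_defect A c 2) $ j) = 0"
    and rk_c_stage_2: "(\<Sum>j\<in>UNIV. b $ j * (c $ j * stage_defect A c 2 $ j)) = 0"
proof -
  let ?U = "\<lambda>_. UNIV :: unit set" and ?S = "\<lambda>_. UNIV :: 's set"
  show quad: "real m * (\<Sum>j\<in>UNIV. b $ j * c $ j ^ (m - 1)) = 1" if "2 \<le> m" "m \<le> 4" for m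
  proof -
    have m1: "1 \<le> m" using that by simp
    obtain \<zeta> where "stepO 5 (\<lambda>H. H * (\<Sum>j\<in>UNIV. b $ j * ((0 + 0 * (c $ j * H)) * \<zeta> H j)) +
       H ^ m * (real m * (\<Sum>j\<in>UNIV. b $ j * c $ j ^ (m - 1)) - 1))"
      by (rule rk_linear_test[OF ord m1, of 0 0]) blast
    then have "stepO 5 (\<lambda>H. H ^ m *\<^sub>R (real m * (\<Sum>j\<in>UNIV. b $ j * c $ j ^ (m - 1)) - 1))" by simp
    then have "stepO (Suc m) (\<lambda>H. H ^ m *\<^sub>R (real m * (\<Sum>j\<in>UNIV. b $ j * c $ j ^ (m - 1)) - 1))"
      by (rule uO_mono) (use that in simp)
    from uO_monomial_imp_zero[OF this] show ?thesis by simp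
  qed
  have drop: "stepO 5 (\<lambda>H. H * g H + H ^ m * (real m * (\<Sum>j\<in>UNIV. b $ j * c $ j ^ (m - 1)) - 1)) \<Longrightarrow>
      stepO 5 (\<lambda>H. H * g H)" if "2 \<le> m" "m \<le> 4" for m g
    by (simp add: quad[OF that, simplified])
  show "(\<Sum>j\<in>UNIV. b $ j * stage_defect A c 3 $ j) = 0"
  proof -
    obtain \<zeta> where \<zeta>: "\<forall>\<^sub>F H in at_right 0. \<forall>i. \<zeta> H i =
        H * (\<Sum>j\<in>UNIV. A $ i $ j * ((1 + 0 * (c $ j * H)) * \<zeta> H j)) + H ^ 3 * stage_defect A c 3 $ i"
      and \<zeta>3: "uO ?S 3 \<zeta>"
      and err: "stepO 5 (\<lambda>H. H * (\<Sum>j\<in>UNIV. b $ j * ((1 + 0 * (c $ j * H)) * \<zeta> H j)) +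
       H ^ 3 * (real 3 * (\<Sum>j\<in>UNIV. b $ j * c $ j ^ (3 - 1)) - 1))"
      by (rule rk_linear_test[OF ord, of 3 1 0]) auto
    have d: "uO ?S 4 (\<lambda>H i. \<zeta> H i - H ^ 3 * stage_defect A c 3 $ i)"
    proof (rule uO_cong)
      show "uO ?S 4 (\<lambda>H i. H ^ 1 * (\<Sum>j\<in>UNIV. A $ i $ j * \<zeta> H j))"
        using uO_power_mult[OF uO_stage_sum_real[OF \<zeta>3], of 1] by simp
      show "\<forall>\<^sub>F H in at_right 0. \<forall>i\<in>UNIV. \<zeta> H i - H ^ 3 * stage_defect A c 3 $ i = H ^ 1 * (\<Sum>j\<in>UNIV. A $ i $ j * \<zeta> H j)"
        using \<zeta> by eventually_elim (metis (no_types, lifting) add_diff_cancel_right' add_0_right mult_1 mult_zero_left power_one_right sum.cong)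
    qed
    have "stepO 5 (\<lambda>H. H ^ 1 * (\<Sum>j\<in>UNIV. b $ j * (\<zeta> H j - H ^ 3 * stage_defect A c 3 $ j)))"
      using uO_power_mult[OF uO_stage_sum_real[OF d], of 1] by simp
    from uO_diff[OF drop[OF _ _ err] this]
    have "stepO (Suc 4) (\<lambda>H. H ^ 4 *\<^sub>R (\<Sum>j\<in>UNIV. b $ j * stage_defect A c 3 $ j))"
      by (simp add: right_diff_distrib sum_subtractf sum_distrib_left eval_nat_numeral mult_ac)
    then show ?thesis by (rule uO_monomial_imp_zero)
  qed
  have lin2: "(\<Sum>j\<in>UNIV. b $ j * stage_defect A c 2 $ j) = 0 \<and>
     (\<Sum>j\<in>UNIV. b $ j * (A *v stage_defect A c 2) $ j) = 0"
  proof -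
    let ?D = "stage_defect A c 2"
    obtain \<zeta> where \<zeta>: "\<forall>\<^sub>F H in at_right 0. \<forall>i. \<zeta> H i =
        H * (\<Sum>j\<in>UNIV. A $ i $ j * ((1 + 0 * (c $ j * H)) * \<zeta> H j)) + H ^ 2 * ?D $ i"
      and \<zeta>2: "uO ?S 2 \<zeta>"
      and err: "stepO 5 (\<lambda>H. H * (\<Sum>j\<in>UNIV. b $ j * ((1 + 0 * (c $ j * H)) * \<zeta> H j)) +
       H ^ 2 * (real 2 * (\<Sum>j\<in>UNIV. b $ j * c $ j ^ (2 - 1)) - 1))"
      by (rule rk_linear_test[OF ord, of 2 1 0]) auto
    have \<zeta>': "\<forall>\<^sub>F H in at_right 0. \<forall>i\<in>UNIV. \<zeta> H i - H ^ 2 * ?D $ i = H ^ 1 * (\<Sum>j\<in>UNIV. A $ i $ j * \<zeta> H j)"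
      using \<zeta> by eventually_elim (metis (no_types, lifting) add_diff_cancel_right' add_0_right mult_1 mult_zero_left power_one_right sum.cong)
    have d3: "uO ?S 3 (\<lambda>H i. \<zeta> H i - H ^ 2 * ?D $ i)"
      by (rule uO_cong[OF _ \<zeta>']) (use uO_power_mult[OF uO_stage_sum_real[OF \<zeta>2, of "\<lambda>i j. A $ i $ j"], of 1] in \<open>simp add: eval_nat_numeral\<close>)
    \<comment> \<open>second insertion of \<zeta> into its equation, which brings in A times the defect\<close>
    have d4: "uO ?S 4 (\<lambda>H i. \<zeta> H i - H ^ 2 * ?D $ i - H ^ 3 * (A *v ?D) $ i)"
    proof (rule uO_cong)
      show "uO ?S 4 (\<lambda>H i. H ^ 1 * (\<Sum>j\<in>UNIV. A $ i $ j * (\<zeta> H j - H ^ 2 * ?D $ j)))"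
        using uO_power_mult[OF uO_stage_sum_real[OF d3], of 1] by simp
      show "\<forall>\<^sub>F H in at_right 0. \<forall>i\<in>UNIV. \<zeta> H i - H ^ 2 * ?D $ i - H ^ 3 * (A *v ?D) $ i =
          H ^ 1 * (\<Sum>j\<in>UNIV. A $ i $ j * (\<zeta> H j - H ^ 2 * ?D $ j))"
        using \<zeta>'
      proof eventually_elim
        case (elim H)
        have "(\<Sum>j\<in>UNIV. A $ i $ j * (\<zeta> H j - H ^ 2 * ?D $ j)) =
            (\<Sum>j\<in>UNIV. A $ i $ j * \<zeta> H j) - H ^ 2 * (A *v ?D) $ i" for i
          by (simp add: matrix_vector_mult_def right_diff_distrib sum_subtractf sum_distrib_left mult_ac)
        with elim show ?case by (simp add: right_diff_distrib power2_eq_square power3_eq_cube)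
      qed
    qed
    have tail: "stepO 5 (\<lambda>H. H ^ 1 * (\<Sum>j\<in>UNIV. b $ j * (\<zeta> H j - H ^ 2 * ?D $ j - H ^ 3 * (A *v ?D) $ j)))"
      using uO_power_mult[OF uO_stage_sum_real[OF d4], of 1] by simp
    let ?x = "\<Sum>j\<in>UNIV. b $ j * ?D $ j" and ?y = "\<Sum>j\<in>UNIV. b $ j * (A *v ?D) $ j"
    from uO_diff[OF drop[OF _ _ err] tail]
    have xy: "stepO 5 (\<lambda>H. H ^ 3 *\<^sub>R ?x + H ^ 4 *\<^sub>R ?y)"
      by (simp add: right_diff_distrib sum_subtractf sum_distrib_left eval_nat_numeral mult_ac)
    have y4: "stepO 4 (\<lambda>H. H ^ 4 *\<^sub>R ?y)" using uO_power_scaleR[OF uO_const, of ?U 4 ?y] by simp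
    have "stepO 4 (\<lambda>H. (H ^ 3 *\<^sub>R ?x + H ^ 4 *\<^sub>R ?y) - H ^ 4 *\<^sub>R ?y)"
      by (rule uO_diff[OF uO_mono[OF xy] y4]) simp
    then have "stepO (Suc 3) (\<lambda>H. H ^ 3 *\<^sub>R ?x)" by simp
    then have x: "?x = 0" by (rule uO_monomial_imp_zero)
    with xy have "stepO (Suc 4) (\<lambda>H. H ^ 4 *\<^sub>R ?y)" by simp
    then have "?y = 0" by (rule uO_monomial_imp_zero)
    with x show ?thesis by blast
  qed
  then show "(\<Sum>j\<in>UNIV. b $ j * stage_defect A c 2 $ j) = 0"
    and "(\<Sum>j\<in>UNIV. b $ j * (A *v stage_defect A c 2) $ j) = 0" by blast+
  show "(\<Sum>j\<in>UNIV. b $ j * (c $ j * stage_defect A c 2 $ j)) = 0"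
  proof -
    let ?D = "stage_defect A c 2"
    obtain \<zeta> where \<zeta>: "\<forall>\<^sub>F H in at_right 0. \<forall>i. \<zeta> H i =
        H * (\<Sum>j\<in>UNIV. A $ i $ j * ((0 + 1 * (c $ j * H)) * \<zeta> H j)) + H ^ 2 * ?D $ i"
      and \<zeta>2: "uO ?S 2 \<zeta>"
      and err: "stepO 5 (\<lambda>H. H * (\<Sum>j\<in>UNIV. b $ j * ((0 + 1 * (c $ j * H)) * \<zeta> H j)) +
       H ^ 2 * (real 2 * (\<Sum>j\<in>UNIV. b $ j * c $ j ^ (2 - 1)) - 1))"
      by (rule rk_linear_test[OF ord, of 2 0 1]) auto
    have d: "uO ?S 3 (\<lambda>H i. \<zeta> H i - H ^ 2 * ?D $ i)"
    proof (rule uO_mono[OF uO_cong])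
      show "uO ?S 4 (\<lambda>H i. H ^ 2 * (\<Sum>j\<in>UNIV. (A $ i $ j * c $ j) * \<zeta> H j))"
        using uO_power_mult[OF uO_stage_sum_real[OF \<zeta>2], of 2] by simp
      show "\<forall>\<^sub>F H in at_right 0. \<forall>i\<in>UNIV. \<zeta> H i - H ^ 2 * ?D $ i = H ^ 2 * (\<Sum>j\<in>UNIV. (A $ i $ j * c $ j) * \<zeta> H j)"
        using \<zeta>
      proof eventually_elim
        case (elim H)
        show ?case
        proof
          fix i
          show "\<zeta> H i - H ^ 2 * ?D $ i = H ^ 2 * (\<Sum>j\<in>UNIV. (A $ i $ j * c $ j) * \<zeta> H j)"
            by (subst elim[rule_format, of i]) (simp add: sum_distrib_left power2_eq_square mult_ac)
        qed
      qed
    qed simp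
    have tail: "stepO 5 (\<lambda>H. H ^ 2 * (\<Sum>j\<in>UNIV. (b $ j * c $ j) * (\<zeta> H j - H ^ 2 * ?D $ j)))"
      using uO_power_mult[OF uO_stage_sum_real[OF d], of 2] by simp
    from uO_diff[OF drop[OF _ _ err] tail]
    have "stepO (Suc 4) (\<lambda>H. H ^ 4 *\<^sub>R (\<Sum>j\<in>UNIV. b $ j * (c $ j * ?D $ j)))"
      by (simp add: right_diff_distrib sum_subtractf sum_distrib_left eval_nat_numeral mult_ac)
    then show ?thesis by (rule uO_monomial_imp_zero)
  qed
qed

section \<open>Coupling conditions from a linear test problem\<close>

lemma exp_quadratic_remainder:
  fixes x :: real
  assumes "0 \<le> x" "x \<le> 1"
  shows "\<bar>exp x - (1 + x + x\<^sup>2 / 2)\<bar> \<le> x ^ 3"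
proof -
  obtain t where t: "\<bar>t\<bar> \<le> \<bar>x\<bar>" "exp x = (\<Sum>m<3. x ^ m / fact m) + exp t / fact 3 * x ^ 3"
    using Maclaurin_exp_le[of x 3] by blast
  have "exp t \<le> exp 1" using t(1) assms by simp
  also have "\<dots> \<le> 3" using exp_le .
  finally have "exp t / fact 3 \<le> 1" by (simp add: fact_numeral)
  then have "exp t / fact 3 * x ^ 3 \<le> 1 * x ^ 3" using assms by (intro mult_right_mono) auto
  moreover have "exp x - (1 + x + x\<^sup>2 / 2) = exp t / fact 3 * x ^ 3"
    unfolding t(2) by (simp add: eval_nat_numeral)
  moreover have "exp t / fact 3 * x ^ 3 \<ge> 0" using assms by simp
  ultimately show ?thesis by simp
qed

text \<open>
  Variation of constants: E(H) is the integral of exp (H - s) times the forcing. Replacing the kernel by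
  its quadratic Taylor polynomial and substituting s = H \<tau> turns the powers of H into moments on [0, 1].
\<close>

lemma forced_exponential_expansion:
  fixes u1 u2 :: "real \<Rightarrow> real"
  assumes u: "continuous_on {0..1} u1" "continuous_on {0..1} u2"
  obtains E where
    "\<And>H. 0 < H \<Longrightarrow> E H 0 = 0"
    "\<And>H \<theta>. 0 < H \<Longrightarrow> \<theta> \<in> {0..H} \<Longrightarrow>
       (E H has_real_derivative E H \<theta> + (H * u1 (\<theta> / H) + H\<^sup>2 * u2 (\<theta> / H))) (at \<theta> within {0..H})"
    "stepO 5 (\<lambda>H. E H H -
       (H ^ 2 * moment (\<lambda>_. 1) u1 +
        H ^ 3 * (moment (\<lambda>\<tau>. 1 - \<tau>) u1 + moment (\<lambda>_. 1) u2) +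
        H ^ 4 * (moment (\<lambda>\<tau>. (1 - \<tau>)\<^sup>2 / 2) u1 + moment (\<lambda>\<tau>. 1 - \<tau>) u2)))"
proof -
  define \<delta> where "\<delta> H \<theta> = H * u1 (\<theta> / H) + H\<^sup>2 * u2 (\<theta> / H)" for H \<theta>
  define E where "E H \<theta> = exp \<theta> * integral {0..\<theta>} (\<lambda>s. exp (- s) * \<delta> H s)" for H \<theta>
  have cont: "continuous_on {0..H} (\<delta> H)" if "0 < H" for H
  proof -
    have "continuous_on {0..H} (\<lambda>\<theta>. d (\<theta> / H))" if d: "continuous_on {0..1} d" for d :: "real \<Rightarrow> real"
      using \<open>0 < H\<close> by (intro continuous_on_compose2[OF d] continuous_intros) auto
    from this[OF u(1)] this[OF u(2)] show ?thesis
      unfolding \<delta>_def by (intro continuous_intros)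
  qed
  have E0: "E H 0 = 0" for H by (simp add: E_def)
  have derE: "(E H has_real_derivative E H \<theta> + \<delta> H \<theta>) (at \<theta> within {0..H})" if H: "0 < H" and \<theta>: "\<theta> \<in> {0..H}" for H \<theta>
  proof -
    have "continuous_on {0..H} (\<lambda>s. exp (- s) * \<delta> H s)" using cont[OF H] by (intro continuous_intros)
    from integral_has_real_derivative[OF this \<theta>]
    have "((\<lambda>\<theta>. integral {0..\<theta>} (\<lambda>s. exp (- s) * \<delta> H s)) has_real_derivative exp (- \<theta>) * \<delta> H \<theta>) (at \<theta> within {0..H})" .
    then have "(E H has_real_derivative exp \<theta> * integral {0..\<theta>} (\<lambda>s. exp (- s) * \<delta> H s) + (exp (- \<theta>) * \<delta> H \<theta>) * exp \<theta>) (at \<theta> within {0..H})"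
      unfolding E_def[abs_def] by (intro DERIV_mult DERIV_subset[OF DERIV_exp]) auto
    moreover have "(exp (- \<theta>) * \<delta> H \<theta>) * exp \<theta> = \<delta> H \<theta>" by (simp add: exp_minus field_simps)
    ultimately show ?thesis by (simp add: E_def)
  qed
  obtain B1 where B1: "\<And>\<tau>. \<tau> \<in> {0..1} \<Longrightarrow> norm (u1 \<tau>) \<le> B1"
    using compact_imp_bounded[OF compact_continuous_image[OF u(1) compact_Icc]] unfolding bounded_iff by blast
  obtain B2 where B2: "\<And>\<tau>. \<tau> \<in> {0..1} \<Longrightarrow> norm (u2 \<tau>) \<le> B2"
    using compact_imp_bounded[OF compact_continuous_image[OF u(2) compact_Icc]] unfolding bounded_iff by blast
  let ?m0 = "moment (\<lambda>_. 1)" and ?m1 = "moment (\<lambda>\<tau>. 1 - \<tau>)" and ?m2 = "moment (\<lambda>\<tau>. (1 - \<tau>)\<^sup>2 / 2)"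
  have "\<forall>\<^sub>F H in at_right 0. \<forall>i\<in>(UNIV :: unit set). norm (E H H -
     (H ^ 2 * ?m0 u1 + H ^ 3 * (?m1 u1 + ?m0 u2) + H ^ 4 * (?m2 u1 + ?m1 u2))) \<le> (B1 + B2 + \<bar>?m2 u2\<bar>) * H ^ 5"
    using eventually_pos eventually_less[of 1, simplified]
  proof eventually_elim
    case (elim H)
    have B: "B1 \<ge> 0" "B2 \<ge> 0" using B1[of 0] B2[of 0] by auto
    have "continuous_on {0..H} (\<lambda>s. exp (- s) * \<delta> H s)" using cont elim by (intro continuous_intros) auto
    then have "((\<lambda>s. exp (- s) * \<delta> H s) has_integral integral {0..H} (\<lambda>s. exp (- s) * \<delta> H s)) {0..H}"
      by (intro integrable_integral integrable_continuous_real)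
    from has_integral_mult_right[OF this, of "exp H"]
    have I1: "((\<lambda>s. exp (H - s) * \<delta> H s) has_integral E H H) {0..H}"
      by (simp add: E_def exp_diff exp_minus field_simps)
    have cm: "continuous_on {0..1::real} (\<lambda>_. 1::real)" "continuous_on {0..1::real} (\<lambda>\<tau>. 1 - \<tau>)" "continuous_on {0..1::real} (\<lambda>\<tau>. (1 - \<tau>)\<^sup>2 / 2)"
      by (intro continuous_intros; simp)+
    let ?g = "\<lambda>\<tau>. H * (1 * u1 \<tau>) + H\<^sup>2 * ((1 - \<tau>) * u1 \<tau>) + H ^ 3 * ((1 - \<tau>)\<^sup>2 / 2 * u1 \<tau>)
       + H\<^sup>2 * (1 * u2 \<tau>) + H ^ 3 * ((1 - \<tau>) * u2 \<tau>) + H ^ 4 * ((1 - \<tau>)\<^sup>2 / 2 * u2 \<tau>)"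
    let ?i = "H * ?m0 u1 + H\<^sup>2 * ?m1 u1 + H ^ 3 * ?m2 u1 + H\<^sup>2 * ?m0 u2 + H ^ 3 * ?m1 u2 + H ^ 4 * ?m2 u2"
    have "(?g has_integral ?i) {0..1}"
      by (intro has_integral_add has_integral_mult_right has_integral_moment u cm)
    from has_integral_rescale[OF this elim(1)]
    have "((\<lambda>\<theta>. ?g (\<theta> / H)) has_integral H *\<^sub>R ?i) {0..H}" .
    moreover have "?g (\<theta> / H) = (1 + (H - \<theta>) + (H - \<theta>)\<^sup>2 / 2) * \<delta> H \<theta>" for \<theta>
    proof -
      define \<tau> where "\<tau> = \<theta> / H"
      have \<theta>: "\<theta> = H * \<tau>" using elim(1) by (simp add: \<tau>_def)
      show ?thesis unfolding \<delta>_def \<tau>_def[symmetric] unfolding \<theta>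
        by (simp add: power2_eq_square power3_eq_cube eval_nat_numeral) (simp add: field_simps)
    qed
    ultimately have "((\<lambda>\<theta>. (1 + (H - \<theta>) + (H - \<theta>)\<^sup>2 / 2) * \<delta> H \<theta>) has_integral H * ?i) {0..H}" by simp
    from has_integral_diff[OF I1 this]
    have I3: "((\<lambda>\<theta>. (exp (H - \<theta>) - (1 + (H - \<theta>) + (H - \<theta>)\<^sup>2 / 2)) * \<delta> H \<theta>) has_integral E H H - H * ?i) {0..H}"
      by (simp only: left_diff_distrib)
    have "norm (E H H - H * ?i) \<le> (H ^ 3 * (H * (B1 + B2))) * Henstock_Kurzweil_Integration.content {0..H}"
    proof (rule has_integral_bound_real[OF _ finite.emptyI I3])
      show "0 \<le> H ^ 3 * (H * (B1 + B2))" using elim B by simp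
      fix \<theta> assume "\<theta> \<in> {0..H} - {}"
      then have \<theta>: "\<theta> \<in> {0..H}" by simp
      have "\<bar>exp (H - \<theta>) - (1 + (H - \<theta>) + (H - \<theta>)\<^sup>2 / 2)\<bar> \<le> (H - \<theta>) ^ 3"
        using \<theta> elim by (intro exp_quadratic_remainder) auto
      also have "\<dots> \<le> H ^ 3" using \<theta> by (intro power_mono) auto
      finally have e: "\<bar>exp (H - \<theta>) - (1 + (H - \<theta>) + (H - \<theta>)\<^sup>2 / 2)\<bar> \<le> H ^ 3" .
      have \<tau>: "\<theta> / H \<in> {0..1}" using \<theta> elim by auto
      have "\<bar>\<delta> H \<theta>\<bar> \<le> H * \<bar>u1 (\<theta> / H)\<bar> + H\<^sup>2 * \<bar>u2 (\<theta> / H)\<bar>"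
        unfolding \<delta>_def using elim(1) by (intro order_trans[OF abs_triangle_ineq]) (simp add: abs_mult)
      also have "\<dots> \<le> H * B1 + H * B2"
      proof (rule add_mono)
        show "H * \<bar>u1 (\<theta> / H)\<bar> \<le> H * B1" using B1[OF \<tau>] elim(1) by simp
        have "H\<^sup>2 \<le> H" using elim by (simp add: power2_eq_square mult_left_le)
        then show "H\<^sup>2 * \<bar>u2 (\<theta> / H)\<bar> \<le> H * B2" using B2[OF \<tau>] elim(1) by (intro mult_mono) auto
      qed
      finally have d: "\<bar>\<delta> H \<theta>\<bar> \<le> H * (B1 + B2)" by (simp add: distrib_left)
      show "norm ((exp (H - \<theta>) - (1 + (H - \<theta>) + (H - \<theta>)\<^sup>2 / 2)) * \<delta> H \<theta>) \<le> H ^ 3 * (H * (B1 + B2))"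
        unfolding real_norm_def abs_mult using e d elim(1) by (intro mult_mono) auto
    qed
    then have a: "\<bar>E H H - H * ?i\<bar> \<le> (B1 + B2) * H ^ 5" using elim(1) by (simp add: eval_nat_numeral mult_ac)
    define P where "P = H ^ 2 * ?m0 u1 + H ^ 3 * (?m1 u1 + ?m0 u2) + H ^ 4 * (?m2 u1 + ?m1 u2)"
    define r where "r = H ^ 5 * ?m2 u2"
    have i: "H * ?i = P + r"
      unfolding P_def r_def by (simp add: eval_nat_numeral algebra_simps)
    have "\<bar>r\<bar> = \<bar>?m2 u2\<bar> * H ^ 5" using elim(1) by (simp add: r_def abs_mult)
    moreover have "\<bar>E H H - P\<bar> \<le> \<bar>E H H - (P + r)\<bar> + \<bar>r\<bar>" by arith
    moreover have "(B1 + B2 + \<bar>?m2 u2\<bar>) * H ^ 5 = (B1 + B2) * H ^ 5 + \<bar>?m2 u2\<bar> * H ^ 5"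
      by (rule distrib_right)
    ultimately have "\<bar>E H H - P\<bar> \<le> (B1 + B2 + \<bar>?m2 u2\<bar>) * H ^ 5" using a unfolding i by linarith
    then show ?case unfolding P_def real_norm_def by (rule ballI)
  qed
  then have "stepO 5 (\<lambda>H. E H H -
     (H ^ 2 * ?m0 u1 + H ^ 3 * (?m1 u1 + ?m0 u2) + H ^ 4 * (?m2 u1 + ?m1 u2)))" by (rule uOI)
  from that[of E, OF E0 derE[unfolded \<delta>_def] this] show thesis .
qed

lemma three_monomials_vanish:
  fixes x y z :: real
  assumes "stepO 5 (\<lambda>H. H ^ 2 * x + H ^ 3 * y + H ^ 4 * z)"
  shows "x = 0 \<and> y = 0 \<and> z = 0"
proof -
  have y: "stepO 3 (\<lambda>H. H ^ 3 * y)" and z: "stepO 4 (\<lambda>H. H ^ 4 * z)" by (rule uO_monomial)+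
  have z3: "stepO 3 (\<lambda>H. H ^ 4 * z)" by (rule uO_mono[OF z]) simp
  have "stepO 3 (\<lambda>H. (H ^ 2 * x + H ^ 3 * y + H ^ 4 * z) - H ^ 4 * z - H ^ 3 * y)"
    by (rule uO_diff[OF uO_diff[OF uO_mono[OF assms] z3] y]) simp
  then have "stepO (Suc 2) (\<lambda>H. H ^ 2 *\<^sub>R x)" by simp
  then have x0: "x = 0" by (rule uO_monomial_imp_zero)
  have "stepO 4 (\<lambda>H. (H ^ 2 * x + H ^ 3 * y + H ^ 4 * z) - H ^ 4 * z)"
    by (rule uO_diff[OF uO_mono[OF assms] z]) simp
  then have "stepO (Suc 3) (\<lambda>H. H ^ 3 *\<^sub>R y)" by (simp add: x0)
  then have y0: "y = 0" by (rule uO_monomial_imp_zero)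
  have "stepO (Suc 4) (\<lambda>H. H ^ 4 *\<^sub>R z)" using assms by (simp add: x0 y0)
  then have "z = 0" by (rule uO_monomial_imp_zero)
  with x0 y0 show ?thesis by blast
qed

text \<open>
  The fast part x + \<kappa> t^2 u and the slow part (m t^(m - 1) - \<kappa> t^2) u - x have a sum that does not involve the
  state. Hence the stages are explicit and the solution is t^m u, while the inner problem still propagates
  the slow defect by the factor exp (H - s).
\<close>

lemma spc_linear_test:
  fixes A :: "real^'s^'s" and c :: "real^'s" and \<gamma> :: "(real poly)^'s" and \<kappa> :: real
  assumes ord: "spc_has_order TYPE('a::euclidean_space) A c \<gamma> 4" and m: "m \<ge> 1"
    and u: "continuous_on {0..1} u1" "continuous_on {0..1} u2"
    and forcing: "\<And>H \<tau>. 0 < H \<Longrightarrow> (H * \<tau>) ^ m + \<kappa> * (H * \<tau>)\<^sup>2 - real m * (H * \<tau>) ^ (m - 1) +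
       coupling \<gamma> (\<chi> j. real m * (c $ j * H) ^ (m - 1) - \<kappa> * (c $ j * H)\<^sup>2 -
         H * (\<Sum>l\<in>UNIV. A $ j $ l * (real m * (c $ l * H) ^ (m - 1)))) \<tau> = H * u1 \<tau> + H\<^sup>2 * u2 \<tau>"
  shows "moment (\<lambda>_. 1) u1 = 0 \<and>
    moment (\<lambda>\<tau>. 1 - \<tau>) u1 + moment (\<lambda>_. 1) u2 = 0 \<and>
    moment (\<lambda>\<tau>. (1 - \<tau>)\<^sup>2 / 2) u1 + moment (\<lambda>\<tau>. 1 - \<tau>) u2 = 0"
proof -
  obtain m' where m': "m = Suc m'" using m by (cases m) auto
  obtain u :: 'a where u': "u \<in> Basis" using nonempty_Basis by blast
  then have nu: "norm u = 1" by simp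
  obtain k where k: "\<And>(fF :: real \<Rightarrow> 'a \<Rightarrow> 'a) fS t0 y0 T y Y v.
        smooth_class k (\<lambda>(t, x). fF t x) \<Longrightarrow> smooth_class k (\<lambda>(t, x). fS t x) \<Longrightarrow>
        0 < T \<Longrightarrow> ivp_solution (\<lambda>t x. fF t x + fS t x) t0 y0 T y \<Longrightarrow>
        rk_stage_branch A c (\<lambda>t x. fF t x + fS t x) t0 y0 Y \<Longrightarrow>
        (\<forall>\<^sub>F H in at_right 0. spc_inner_solution \<gamma> c fF fS t0 y0 H (Y H) (v H)) \<Longrightarrow>
        (\<lambda>H. norm (v H H - y (t0 + H))) \<in> O[at_right 0](\<lambda>H. H ^ (4 + 1))"
    using ord unfolding spc_has_order_def by blast
  obtain E where E0: "\<And>H. 0 < H \<Longrightarrow> E H 0 = 0"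
    and E: "\<And>H \<theta>. 0 < H \<Longrightarrow> \<theta> \<in> {0..H} \<Longrightarrow>
       (E H has_real_derivative E H \<theta> + (H * u1 (\<theta> / H) + H\<^sup>2 * u2 (\<theta> / H))) (at \<theta> within {0..H})"
    and Eexp: "stepO 5 (\<lambda>H. E H H -
       (H ^ 2 * moment (\<lambda>_. 1) u1 +
        H ^ 3 * (moment (\<lambda>\<tau>. 1 - \<tau>) u1 + moment (\<lambda>_. 1) u2) +
        H ^ 4 * (moment (\<lambda>\<tau>. (1 - \<tau>)\<^sup>2 / 2) u1 + moment (\<lambda>\<tau>. 1 - \<tau>) u2)))"
    by (rule forced_exponential_expansion[OF u]) blast
  define G where "G t x = x + (\<kappa> * t\<^sup>2) *\<^sub>R u" for t :: real and x :: 'a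
  define S where "S t x = (real m * t ^ (m - 1) - \<kappa> * t\<^sup>2) *\<^sub>R u - x" for t :: real and x :: 'a
  define e where "e H i = H * (\<Sum>l\<in>UNIV. A $ i $ l * (real m * (c $ l * H) ^ (m - 1)))" for H i
  define Y where "Y H i = e H i *\<^sub>R u" for H i
  define v where "v H \<theta> = (\<theta> ^ m + E H \<theta>) *\<^sub>R u" for H \<theta>
  have GS: "G t x + S t x = (real m * t ^ (m - 1)) *\<^sub>R u" for t x
    by (simp add: G_def S_def algebra_simps)
  have fst: "smooth_class k (fst :: real \<times> 'a \<Rightarrow> real)" and snd: "smooth_class k (snd :: real \<times> 'a \<Rightarrow> 'a)"
    by (rule smooth_class_bounded_linear bounded_linear_fst bounded_linear_snd)+
  have "smooth_class k (\<lambda>z :: real \<times> 'a. snd z + (\<kappa> *\<^sub>R (fst z)\<^sup>2) *\<^sub>R u)"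
    by (intro smooth_class_add smooth_class_scaleR smooth_class_const smooth_class_power fst snd)
  then have smG: "smooth_class k (\<lambda>(t, x). G t x)" by (simp add: G_def case_prod_unfold)
  have "smooth_class k (\<lambda>z :: real \<times> 'a. (real m *\<^sub>R fst z ^ (m - 1) - \<kappa> *\<^sub>R (fst z)\<^sup>2) *\<^sub>R u - snd z)"
    by (intro smooth_class_diff smooth_class_scaleR smooth_class_const smooth_class_power fst snd)
  then have smS: "smooth_class k (\<lambda>(t, x). S t x)" by (simp add: S_def case_prod_unfold)
  have ivp: "ivp_solution (\<lambda>t x. G t x + S t x) 0 0 1 (\<lambda>t. t ^ m *\<^sub>R u)"
    unfolding ivp_solution_def GS
  proof (intro conjI ballI)
    show "0 ^ m *\<^sub>R u = 0" using m by simp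
    fix t :: real
    have "((\<lambda>t. t ^ m) has_vector_derivative real m * t ^ (m - 1)) (at t within {0..0 + 1})"
      using DERIV_pow[of m t "{0..0 + 1}"] by (simp add: has_real_derivative_iff_has_vector_derivative)
    from bounded_linear.has_vector_derivative[OF bounded_linear_scaleR_left this, of u]
    show "((\<lambda>t. t ^ m *\<^sub>R u) has_vector_derivative (real m * t ^ (m - 1)) *\<^sub>R u) (at t within {0..0 + 1})" .
  qed
  have branch: "rk_stage_branch A c (\<lambda>t x. G t x + S t x) 0 0 Y"
    unfolding rk_stage_branch_def rk_stages_def GS
  proof (intro conjI allI always_eventually)
    fix H i
    show "Y H i = 0 + H *\<^sub>R (\<Sum>j\<in>UNIV. A $ i $ j *\<^sub>R (real m * (0 + c $ j * H) ^ (m - 1)) *\<^sub>R u)"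
      by (simp add: Y_def e_def scaleR_sum_left[symmetric])
  next
    fix i
    have "((\<lambda>H. Y H i) \<longlongrightarrow> (0 * (\<Sum>l\<in>UNIV. A $ i $ l * (real m * (c $ l * 0) ^ (m - 1)))) *\<^sub>R u) (at_right 0)"
      unfolding Y_def e_def by (intro tendsto_intros)
    then show "((\<lambda>H. Y H i) \<longlongrightarrow> 0) (at_right 0)" by simp
  qed
  have inner: "\<forall>\<^sub>F H in at_right 0. spc_inner_solution \<gamma> c G S 0 0 H (Y H) (v H)"
    using eventually_pos
  proof eventually_elim
    case (elim H)
    show ?case unfolding spc_inner_solution_def
    proof (intro conjI ballI)
      show "v H 0 = 0" using E0[OF elim] m by (simp add: v_def)
      fix \<theta> assume \<theta>: "\<theta> \<in> {0..H}"
      let ?F = "coupling \<gamma> (\<chi> j. real m * (c $ j * H) ^ (m - 1) - \<kappa> * (c $ j * H)\<^sup>2 - e H j) (\<theta> / H)"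
      have sum: "(\<Sum>j\<in>UNIV. poly (\<gamma> $ j) (\<theta> / H) *\<^sub>R S (0 + c $ j * H) (Y H j)) = ?F *\<^sub>R u"
        unfolding coupling_scaleR_sum[symmetric] by (simp add: S_def Y_def scaleR_diff_left)
      have "\<theta> ^ m + \<kappa> * \<theta>\<^sup>2 - real m * \<theta> ^ (m - 1) + ?F = H * u1 (\<theta> / H) + H\<^sup>2 * u2 (\<theta> / H)"
        using forcing[OF elim, of "\<theta> / H"] elim by (simp add: e_def)
      then have "real m * \<theta> ^ (m - 1) + (E H \<theta> + (H * u1 (\<theta> / H) + H\<^sup>2 * u2 (\<theta> / H))) =
          (\<theta> ^ m + E H \<theta>) + \<kappa> * \<theta>\<^sup>2 + ?F" by simp
      moreover have "((\<lambda>\<theta>. \<theta> ^ m + E H \<theta>) has_vector_derivative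
          real m * \<theta> ^ (m - 1) + (E H \<theta> + (H * u1 (\<theta> / H) + H\<^sup>2 * u2 (\<theta> / H)))) (at \<theta> within {0..H})"
        using DERIV_add[OF DERIV_pow[of m \<theta>] E[OF elim \<theta>]] by (simp add: has_real_derivative_iff_has_vector_derivative)
      ultimately have "((\<lambda>\<theta>. \<theta> ^ m + E H \<theta>) has_vector_derivative (\<theta> ^ m + E H \<theta>) + \<kappa> * \<theta>\<^sup>2 + ?F) (at \<theta> within {0..H})"
        by (simp only:)
      from bounded_linear.has_vector_derivative[OF bounded_linear_scaleR_left this, of u]
      show "(v H has_vector_derivative G (0 + \<theta>) (v H \<theta>) +
          (\<Sum>j\<in>UNIV. poly (\<gamma> $ j) (\<theta> / H) *\<^sub>R S (0 + c $ j * H) (Y H j))) (at \<theta> within {0..H})"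
        unfolding sum by (simp add: v_def[abs_def] G_def scaleR_add_left)
    qed
  qed
  have "v H H - (0 + H) ^ m *\<^sub>R u = E H H *\<^sub>R u" for H by (simp add: v_def scaleR_add_left)
  with k[OF smG smS zero_less_one ivp branch inner]
  have "stepO 5 (\<lambda>H. E H H)" unfolding uO_iff_bigo by (simp add: nu)
  from uO_diff[OF this Eexp]
  show ?thesis by (intro three_monomials_vanish) (simp add: add.assoc)
qed

lemma coupling_eq_sum_coeff:
  fixes \<gamma> :: "(real poly)^'s"
  defines "N \<equiv> Suc (Max (range (\<lambda>j. degree (\<gamma> $ j))))"
  shows "coupling \<gamma> w \<tau> = (\<Sum>k<N. (gamma_coeff \<gamma> k \<bullet> w) * \<tau> ^ k)"
    and "k \<ge> N \<Longrightarrow> gamma_coeff \<gamma> k = 0"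
proof -
  have deg: "degree (\<gamma> $ j) < N" for j unfolding N_def by (simp add: less_Suc_eq_le)
  have "poly (\<gamma> $ j) \<tau> = (\<Sum>k<N. coeff (\<gamma> $ j) k * \<tau> ^ k)" for j
    unfolding poly_altdef using deg[of j]
    by (intro sum.mono_neutral_left) (auto simp: coeff_eq_0)
  then have "coupling \<gamma> w \<tau> = (\<Sum>j\<in>UNIV. \<Sum>k<N. (coeff (\<gamma> $ j) k * \<tau> ^ k) * w $ j)"
    by (simp add: coupling_def sum_distrib_right)
  also have "\<dots> = (\<Sum>k<N. \<Sum>j\<in>UNIV. (coeff (\<gamma> $ j) k * \<tau> ^ k) * w $ j)" by (rule sum.swap)
  also have "\<dots> = (\<Sum>k<N. (gamma_coeff \<gamma> k \<bullet> w) * \<tau> ^ k)"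
    by (simp add: inner_vec_def gamma_coeff_def sum_distrib_left sum_distrib_right mult_ac)
  finally show "coupling \<gamma> w \<tau> = (\<Sum>k<N. (gamma_coeff \<gamma> k \<bullet> w) * \<tau> ^ k)" .
  show "gamma_coeff \<gamma> k = 0" if "k \<ge> N"
    unfolding gamma_coeff_def vec_eq_iff
    using less_le_trans[OF deg that] by (simp add: coeff_eq_0)
qed

lemma coupling_moment_eq_suminf:
  fixes \<gamma> :: "(real poly)^'s"
  assumes \<mu>: "\<And>k. ((\<lambda>\<tau>. \<phi> \<tau> * \<tau> ^ k) has_integral \<mu> k) {0..1}"
  shows "(\<Sum>k. \<mu> k * (gamma_coeff \<gamma> k \<bullet> w)) = coupling_moment \<phi> \<gamma> w"
proof -
  define N where "N = Suc (Max (range (\<lambda>j. degree (\<gamma> $ j))))"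
  have "((\<lambda>\<tau>. \<Sum>k<N. (gamma_coeff \<gamma> k \<bullet> w) * (\<phi> \<tau> * \<tau> ^ k)) has_integral
      (\<Sum>k<N. (gamma_coeff \<gamma> k \<bullet> w) * \<mu> k)) {0..1}"
    by (intro has_integral_sum has_integral_mult_right \<mu>) auto
  moreover have "(\<Sum>k<N. (gamma_coeff \<gamma> k \<bullet> w) * (\<phi> \<tau> * \<tau> ^ k)) = \<phi> \<tau> * coupling \<gamma> w \<tau>" for \<tau>
    unfolding coupling_eq_sum_coeff(1)[of \<gamma> w \<tau>, folded N_def] by (simp add: sum_distrib_left mult_ac)
  ultimately have "coupling_moment \<phi> \<gamma> w = (\<Sum>k<N. (gamma_coeff \<gamma> k \<bullet> w) * \<mu> k)"
    by (simp add: moment_def integral_unique)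
  also have "\<dots> = (\<Sum>k. \<mu> k * (gamma_coeff \<gamma> k \<bullet> w))"
    using coupling_eq_sum_coeff(2)[of \<gamma>, folded N_def]
    by (subst suminf_finite[of "{..<N}"]) (auto simp: mult.commute not_less)
  finally show ?thesis ..
qed

lemma suminf_zeta: "(\<Sum>k. zeta k * (gamma_coeff \<gamma> k \<bullet> w)) = coupling_moment (\<lambda>\<tau>. 1 - \<tau>) \<gamma> w"
  by (rule coupling_moment_eq_suminf[OF has_integral_zeta])

lemma suminf_omega: "(\<Sum>k. omega k * (gamma_coeff \<gamma> k \<bullet> w)) = coupling_moment (\<lambda>\<tau>. (1 - \<tau>\<^sup>2) / 2) \<gamma> w"
  by (rule coupling_moment_eq_suminf[OF has_integral_omega])

lemma gamma_bar_sum: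
  "(\<Sum>j\<in>UNIV. gamma_bar \<gamma> $ j * w $ j) = coupling_moment (\<lambda>_. 1) \<gamma> w"
proof -
  have "(poly (\<gamma> $ j) has_integral gamma_bar \<gamma> $ j) {0..1}" for j
    by (simp add: gamma_bar_def integrable_integral integrable_continuous_real continuous_intros)
  then have "((\<lambda>\<tau>. \<Sum>j\<in>UNIV. poly (\<gamma> $ j) \<tau> * w $ j) has_integral (\<Sum>j\<in>UNIV. gamma_bar \<gamma> $ j * w $ j)) {0..1}"
    by (intro has_integral_sum has_integral_mult_left) auto
  then show ?thesis by (simp add: moment_def coupling_def integral_unique)
qed

lemma internally_consistent_coupling:
  assumes "internally_consistent \<gamma>"
  shows "coupling \<gamma> 1 \<tau> = 1"
proof -
  have "(gamma_coeff \<gamma> k \<bullet> 1) * \<tau> ^ k = (if k = 0 then 1 else 0)" for k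
    using assms unfolding internally_consistent_def by (cases "k = 0") auto
  then show ?thesis
    unfolding coupling_eq_sum_coeff(1) by (simp add: sum.delta)
qed

text \<open>
  Without a fast part the inner problem is a quadrature, and v(H) is the update of the base method whose
  weights are the means of the coupling polynomials.
\<close>

lemma spc_order_imp_rk_order:
  assumes ord: "spc_has_order TYPE('a::euclidean_space) A c \<gamma> p"
  shows "rk_has_order TYPE('a) A (gamma_bar \<gamma>) c p"
proof -
  obtain k where k: "\<And>(fF :: real \<Rightarrow> 'a \<Rightarrow> 'a) fS t0 y0 T y Y v.
        smooth_class k (\<lambda>(t, x). fF t x) \<Longrightarrow> smooth_class k (\<lambda>(t, x). fS t x) \<Longrightarrow>
        0 < T \<Longrightarrow> ivp_solution (\<lambda>t x. fF t x + fS t x) t0 y0 T y \<Longrightarrow>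
        rk_stage_branch A c (\<lambda>t x. fF t x + fS t x) t0 y0 Y \<Longrightarrow>
        (\<forall>\<^sub>F H in at_right 0. spc_inner_solution \<gamma> c fF fS t0 y0 H (Y H) (v H)) \<Longrightarrow>
        (\<lambda>H. norm (v H H - y (t0 + H))) \<in> O[at_right 0](\<lambda>H. H ^ (p + 1))"
    using ord unfolding spc_has_order_def by blast
  show ?thesis unfolding rk_has_order_def
  proof (intro exI[of _ k] allI impI, elim conjE)
    fix f :: "real \<Rightarrow> 'a \<Rightarrow> 'a" and t0 y0 T y Y
    assume f: "smooth_class k (\<lambda>(t, x). f t x)" and T: "0 < T" and y: "ivp_solution f t0 y0 T y"
      and br: "rk_stage_branch A c f t0 y0 Y"
    define v where "v H \<theta> = y0 + (\<Sum>j\<in>UNIV. integral {0..\<theta>} (\<lambda>s. poly (\<gamma> $ j) (s / H)) *\<^sub>R f (t0 + c $ j * H) (Y H j))"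
      for H \<theta>
    have cont: "continuous_on {0..H} (\<lambda>s. poly (\<gamma> $ j) (s / H))" if "0 < H" for H j
      using that by (intro continuous_intros) auto
    have inner: "\<forall>\<^sub>F H in at_right 0. spc_inner_solution \<gamma> c (\<lambda>t x. 0) f t0 y0 H (Y H) (v H)"
      using eventually_pos
    proof eventually_elim
      case (elim H)
      show ?case unfolding spc_inner_solution_def
      proof (intro conjI ballI)
        show "v H 0 = y0" by (simp add: v_def)
        fix \<theta> assume \<theta>: "\<theta> \<in> {0..H}"
        have "((\<lambda>\<theta>. integral {0..\<theta>} (\<lambda>s. poly (\<gamma> $ j) (s / H)) *\<^sub>R x) has_vector_derivative
            poly (\<gamma> $ j) (\<theta> / H) *\<^sub>R x) (at \<theta> within {0..H})" for j and x :: 'a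
          by (rule bounded_linear.has_vector_derivative[OF bounded_linear_scaleR_left
                integral_has_vector_derivative[OF cont[OF elim] \<theta>]])
        then have "(v H has_vector_derivative 0 + (\<Sum>j\<in>UNIV. poly (\<gamma> $ j) (\<theta> / H) *\<^sub>R f (t0 + c $ j * H) (Y H j)))
            (at \<theta> within {0..H})"
          unfolding v_def[abs_def]
          by (intro has_vector_derivative_add has_vector_derivative_const has_vector_derivative_sum)
        then show "(v H has_vector_derivative 0 + (\<Sum>j\<in>UNIV. poly (\<gamma> $ j) (\<theta> / H) *\<^sub>R f (t0 + c $ j * H) (Y H j)))
            (at \<theta> within {0..H})" .
      qed
    qed
    have "smooth_class k (\<lambda>(t, x). 0 :: 'a)"
      using smooth_class_const[of k "0 :: 'a"] by (simp add: case_prod_unfold)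
    from k[OF this f T _ _ inner] y br
    have "(\<lambda>H. norm (v H H - y (t0 + H))) \<in> O[at_right 0](\<lambda>H. H ^ (p + 1))" by simp
    then have *: "stepO (p + 1) (\<lambda>H. v H H - y (t0 + H))" unfolding uO_iff_bigo .
    have "stepO (p + 1) (\<lambda>H. rk_update (gamma_bar \<gamma>) c f t0 y0 H (Y H) - y (t0 + H))"
    proof (rule uO_cong[OF *])
      show "\<forall>\<^sub>F H in at_right 0. \<forall>i\<in>(UNIV :: unit set).
          rk_update (gamma_bar \<gamma>) c f t0 y0 H (Y H) - y (t0 + H) = v H H - y (t0 + H)"
        using eventually_pos
      proof eventually_elim
        case (elim H)
        have "integral {0..H} (\<lambda>s. poly (\<gamma> $ j) (s / H)) = H * gamma_bar \<gamma> $ j" for j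
        proof -
          have "(poly (\<gamma> $ j) has_integral gamma_bar \<gamma> $ j) {0..1}"
            by (simp add: gamma_bar_def integrable_integral integrable_continuous_real continuous_intros)
          from has_integral_rescale[OF this elim] show ?thesis by (simp add: integral_unique)
        qed
        then show ?case by (simp add: v_def rk_update_def scaleR_sum_right)
      qed
    qed
    then show "(\<lambda>H. norm (rk_update (gamma_bar \<gamma>) c f t0 y0 H (Y H) - y (t0 + H))) \<in> O[at_right 0](\<lambda>H. H ^ (p + 1))"
      unfolding uO_iff_bigo .
  qed
qed

lemma stage_defect_2: "stage_defect A c 2 = 2 *\<^sub>R (A *v c) - (\<chi> i. (c $ i)\<^sup>2)"
  by (simp add: stage_defect_def vec_eq_iff matrix_vector_mult_def)

lemma moment_diff_coupling:
  assumes "continuous_on {0..1} \<phi>" "((\<lambda>\<tau>. \<phi> \<tau> * g \<tau>) has_integral r) {0..1}"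
  shows "moment \<phi> (\<lambda>\<tau>. g \<tau> - coupling \<gamma> w \<tau>) = r - coupling_moment \<phi> \<gamma> w"
  using integral_unique[OF has_integral_diff[OF assms(2) has_integral_coupling_moment[OF assms(1), of \<gamma> w]]]
  by (simp add: moment_def right_diff_distrib)

text \<open>
  The test with m = 1 and \<kappa> = 0 gives the two conditions on c: the second one results because
  (1 - \<tau>^2) / 2 = (1 - \<tau>) - (1 - \<tau>)^2 / 2. The test with m = 1 and \<kappa> = 1 gives the condition on the squares
  of c, and m = 2 with \<kappa> = 0 the condition on A c, which enters through the stage values.
\<close>

lemma spc_order_imp_coupling:
  fixes A :: "real^'s^'s" and c :: "real^'s" and \<gamma> :: "(real poly)^'s"
  assumes c: "\<And>i. (\<Sum>j\<in>UNIV. A $ i $ j) = c $ i"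
    and cons: "\<And>\<tau>. coupling \<gamma> 1 \<tau> = 1"
    and ord: "spc_has_order TYPE('a::euclidean_space) A c \<gamma> 4"
  shows "coupling_moment (\<lambda>\<tau>. 1 - \<tau>) \<gamma> c = 1 / 6" "coupling_moment (\<lambda>\<tau>. (1 - \<tau>\<^sup>2) / 2) \<gamma> c = 1 / 8"
    "coupling_moment (\<lambda>\<tau>. 1 - \<tau>) \<gamma> (\<chi> i. (c $ i)\<^sup>2) = 1 / 12" "coupling_moment (\<lambda>\<tau>. 1 - \<tau>) \<gamma> (A *v c) = 1 / 24"
proof -
  have one: "(\<Sum>j\<in>UNIV. poly (\<gamma> $ j) \<tau>) = 1" for \<tau> using cons[of \<tau>] by (simp add: coupling_def)
  have cm: "continuous_on {0..1::real} (\<lambda>\<tau>. 1 - \<tau>)" "continuous_on {0..1::real} (\<lambda>\<tau>. (1 - \<tau>)\<^sup>2 / 2)"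
    by (intro continuous_intros; simp)+
  define u1 where "u1 \<tau> = \<tau> - coupling \<gamma> c \<tau>" for \<tau>
  have u1: "continuous_on {0..1} u1" unfolding u1_def by (intro continuous_intros)
  \<comment> \<open>\<kappa> = 0 removes u2 and isolates c, then \<kappa> = 1 adds the squares of c\<close>
  have forcing1: "(H * \<tau>) ^ 1 + \<kappa> * (H * \<tau>)\<^sup>2 - real 1 * (H * \<tau>) ^ (1 - 1) +
       coupling \<gamma> (\<chi> j. real 1 * (c $ j * H) ^ (1 - 1) - \<kappa> * (c $ j * H)\<^sup>2 -
         H * (\<Sum>l\<in>UNIV. A $ j $ l * (real 1 * (c $ l * H) ^ (1 - 1)))) \<tau> =
       H * u1 \<tau> + H\<^sup>2 * (\<kappa> * (\<tau>\<^sup>2 - coupling \<gamma> (\<chi> i. (c $ i)\<^sup>2) \<tau>))" for H \<tau> \<kappa>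
    using one[of \<tau>]
    by (simp add: coupling_def u1_def c right_diff_distrib sum_subtractf sum_distrib_left power_mult_distrib mult_ac)
  have forcing2: "(H * \<tau>) ^ 2 + 0 * (H * \<tau>)\<^sup>2 - real 2 * (H * \<tau>) ^ (2 - 1) +
       coupling \<gamma> (\<chi> j. real 2 * (c $ j * H) ^ (2 - 1) - 0 * (c $ j * H)\<^sup>2 -
         H * (\<Sum>l\<in>UNIV. A $ j $ l * (real 2 * (c $ l * H) ^ (2 - 1)))) \<tau> =
       H * (- 2 * u1 \<tau>) + H\<^sup>2 * (\<tau>\<^sup>2 - coupling \<gamma> (2 *\<^sub>R (A *v c)) \<tau>)" for H \<tau>
    by (simp add: coupling_def u1_def matrix_vector_mult_def right_diff_distrib sum_subtractf sum_distrib_left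
        sum_negf power_mult_distrib power2_eq_square mult_ac)
  have test1: "moment (\<lambda>_. 1) u1 = 0 \<and>
    moment (\<lambda>\<tau>. 1 - \<tau>) u1 + moment (\<lambda>_. 1) (\<lambda>\<tau>. \<kappa> * (\<tau>\<^sup>2 - coupling \<gamma> (\<chi> i. (c $ i)\<^sup>2) \<tau>)) = 0 \<and>
    moment (\<lambda>\<tau>. (1 - \<tau>)\<^sup>2 / 2) u1 + moment (\<lambda>\<tau>. 1 - \<tau>) (\<lambda>\<tau>. \<kappa> * (\<tau>\<^sup>2 - coupling \<gamma> (\<chi> i. (c $ i)\<^sup>2) \<tau>)) = 0" for \<kappa>
    by (rule spc_linear_test[OF ord order_refl u1 _ forcing1]) (intro continuous_intros)
  have "moment \<phi> (\<lambda>\<tau>. 0 * u \<tau>) = 0" for \<phi> u by (simp add: moment_def)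
  with test1[of 0] have z1: "moment (\<lambda>\<tau>. 1 - \<tau>) u1 = 0" and z2: "moment (\<lambda>\<tau>. (1 - \<tau>)\<^sup>2 / 2) u1 = 0"
    by simp_all
  have m1: "moment (\<lambda>\<tau>. 1 - \<tau>) u1 = 1 / 6 - coupling_moment (\<lambda>\<tau>. 1 - \<tau>) \<gamma> c"
    unfolding u1_def by (rule moment_diff_coupling[OF cm(1)]) (use has_integral_zeta[of 1] in \<open>simp add: zeta_def\<close>)
  with z1 show c1: "coupling_moment (\<lambda>\<tau>. 1 - \<tau>) \<gamma> c = 1 / 6" by simp
  have m2: "moment (\<lambda>\<tau>. (1 - \<tau>)\<^sup>2 / 2) u1 = 1 / 24 - coupling_moment (\<lambda>\<tau>. (1 - \<tau>)\<^sup>2 / 2) \<gamma> c"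
    unfolding u1_def
  proof (rule moment_diff_coupling[OF cm(2)])
    have "((\<lambda>\<tau>::real. (1 / 2) * ((1 - \<tau>) * \<tau> ^ 1 - (1 - \<tau>) * \<tau> ^ 2)) has_integral
        (1 / 2) * (zeta 1 - zeta 2)) {0..1}"
      by (intro has_integral_mult_right has_integral_diff has_integral_zeta)
    moreover have "(1 / 2) * ((1 - \<tau>) * \<tau> ^ 1 - (1 - \<tau>) * \<tau> ^ 2) = (1 - \<tau>)\<^sup>2 / 2 * \<tau>" for \<tau> :: real
      by (simp add: power2_eq_square field_simps)
    moreover have "(1 / 2) * (zeta 1 - zeta 2) = 1 / 24"
      by (simp add: zeta_def)
    ultimately show "((\<lambda>\<tau>::real. (1 - \<tau>)\<^sup>2 / 2 * \<tau>) has_integral 1 / 24) {0..1}"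
      by (simp only:)
  qed
  show "coupling_moment (\<lambda>\<tau>. (1 - \<tau>\<^sup>2) / 2) \<gamma> c = 1 / 8"
  proof -
    have e: "(1 - \<tau>) * x - (1 - \<tau>)\<^sup>2 / 2 * x = (1 - \<tau>\<^sup>2) / 2 * x" for \<tau> x :: real
      by (simp add: power2_eq_square field_simps)
    have "coupling_moment (\<lambda>\<tau>. (1 - \<tau>\<^sup>2) / 2) \<gamma> c = coupling_moment (\<lambda>\<tau>. 1 - \<tau>) \<gamma> c - coupling_moment (\<lambda>\<tau>. (1 - \<tau>)\<^sup>2 / 2) \<gamma> c"
      using integral_unique[OF has_integral_diff[OF has_integral_coupling_moment[OF cm(1), of \<gamma> c] has_integral_coupling_moment[OF cm(2), of \<gamma> c]]]
      unfolding e by (simp only: moment_def)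
    with c1 m2 z2 show ?thesis by simp
  qed
  have "moment (\<lambda>\<tau>. 1 - \<tau>) (\<lambda>\<tau>. \<tau>\<^sup>2 - coupling \<gamma> w \<tau>) = 1 / 12 - coupling_moment (\<lambda>\<tau>. 1 - \<tau>) \<gamma> w" for w
    by (rule moment_diff_coupling[OF cm(1)]) (use has_integral_zeta[of 2] in \<open>simp add: zeta_def\<close>)
  note sq = this
  show "coupling_moment (\<lambda>\<tau>. 1 - \<tau>) \<gamma> (\<chi> i. (c $ i)\<^sup>2) = 1 / 12"
    using test1[of 1] sq[of "\<chi> i. (c $ i)\<^sup>2"] z2 by simp
  have "moment (\<lambda>\<tau>. (1 - \<tau>)\<^sup>2 / 2) (\<lambda>\<tau>. - 2 * u1 \<tau>) +
      moment (\<lambda>\<tau>. 1 - \<tau>) (\<lambda>\<tau>. \<tau>\<^sup>2 - coupling \<gamma> (2 *\<^sub>R (A *v c)) \<tau>) = 0"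
    using spc_linear_test[OF ord _ _ _ forcing2] u1 by (simp add: continuous_intros)
  moreover have "moment \<phi> (\<lambda>\<tau>. - 2 * u1 \<tau>) = - 2 * moment \<phi> u1" for \<phi>
    unfolding moment_def integral_mult_right[symmetric] by (simp add: mult.left_commute)
  ultimately show "coupling_moment (\<lambda>\<tau>. 1 - \<tau>) \<gamma> (A *v c) = 1 / 24"
    using sq[of "2 *\<^sub>R (A *v c)"] z2 by (simp add: coupling_moment_scaleR)
qed

section \<open>The characterization of order four\<close>

theorem theorem2p6:
  fixes A :: "real^'s^'s" and b c :: "real^'s" and \<gamma> :: "(real poly)^'s"
  assumes "c = A *v 1"
    and "internally_consistent \<gamma>"
    and "b = gamma_bar \<gamma>"
  shows "spc_has_order TYPE(real^'d) A c \<gamma> 4 \<longleftrightarrow>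
    rk_has_order TYPE(real^'d) A b c 4 \<and>
    1 / 6 = (\<Sum>k. zeta k * (gamma_coeff \<gamma> k \<bullet> c)) \<and>
    1 / 8 = (\<Sum>k. omega k * (gamma_coeff \<gamma> k \<bullet> c)) \<and>
    1 / 12 = (\<Sum>k. zeta k * (gamma_coeff \<gamma> k \<bullet> (\<chi> i. (c $ i)\<^sup>2))) \<and>
    1 / 24 = (\<Sum>k. zeta k * (gamma_coeff \<gamma> k \<bullet> (A *v c)))"
proof -
  have c: "(\<Sum>j\<in>UNIV. A $ i $ j) = c $ i" for i
    using assms(1) by (simp add: matrix_vector_mult_def)
  have cons: "coupling \<gamma> 1 \<tau> = 1" for \<tau>
    by (rule internally_consistent_coupling[OF assms(2)])
  have b: "coupling_moment (\<lambda>_. 1) \<gamma> w = (\<Sum>j\<in>UNIV. b $ j * w $ j)" for w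
    by (simp add: assms(3) gamma_bar_sum)
  show ?thesis
    unfolding suminf_zeta suminf_omega
  proof (intro iffI conjI; (elim conjE)?)
    assume ord: "spc_has_order TYPE(real^'d) A c \<gamma> 4"
    show "rk_has_order TYPE(real^'d) A b c 4"
      unfolding assms(3) by (rule spc_order_imp_rk_order[OF ord])
    note coupl = spc_order_imp_coupling[OF c cons ord]
    show "1 / 6 = coupling_moment (\<lambda>\<tau>. 1 - \<tau>) \<gamma> c" "1 / 8 = coupling_moment (\<lambda>\<tau>. (1 - \<tau>\<^sup>2) / 2) \<gamma> c"
      "1 / 12 = coupling_moment (\<lambda>\<tau>. 1 - \<tau>) \<gamma> (\<chi> i. (c $ i)\<^sup>2)" "1 / 24 = coupling_moment (\<lambda>\<tau>. 1 - \<tau>) \<gamma> (A *v c)"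
      using coupl by simp_all
  next
    assume rk: "rk_has_order TYPE(real^'d) A b c 4"
      and coupl: "1 / 6 = coupling_moment (\<lambda>\<tau>. 1 - \<tau>) \<gamma> c" "1 / 8 = coupling_moment (\<lambda>\<tau>. (1 - \<tau>\<^sup>2) / 2) \<gamma> c"
      "1 / 12 = coupling_moment (\<lambda>\<tau>. 1 - \<tau>) \<gamma> (\<chi> i. (c $ i)\<^sup>2)" "1 / 24 = coupling_moment (\<lambda>\<tau>. 1 - \<tau>) \<gamma> (A *v c)"
    have cm: "continuous_on {0..1::real} (\<lambda>\<tau>. 1 - \<tau>)" by (intro continuous_intros)
    show "spc_has_order TYPE(real^'d) A c \<gamma> 4"
    proof (rule spc_order_of_moments[OF c cons])
      show "coupling_moment (\<lambda>_. 1) \<gamma> c = 1 / 2" "coupling_moment (\<lambda>_. 1) \<gamma> (\<chi> j. c $ j ^ 2) = 1 / 3"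
        "coupling_moment (\<lambda>_. 1) \<gamma> (\<chi> j. c $ j ^ 3) = 1 / 4"
        using rk_quadrature[OF rk, of 2] rk_quadrature[OF rk, of 3] rk_quadrature[OF rk, of 4]
        by (simp_all add: b)
      show "coupling_moment (\<lambda>_. 1) \<gamma> (stage_defect A c 2) = 0" "coupling_moment (\<lambda>_. 1) \<gamma> (stage_defect A c 3) = 0"
        "coupling_moment (\<lambda>_. 1) \<gamma> (A *v stage_defect A c 2) = 0"
        "coupling_moment (\<lambda>_. 1) \<gamma> (\<chi> j. c $ j * stage_defect A c 2 $ j) = 0"
        using rk_stage_2[OF rk] rk_stage_3[OF rk] rk_A_stage_2[OF rk] rk_c_stage_2[OF rk] by (simp_all add: b)
      show "coupling_moment (\<lambda>\<tau>. 1 - \<tau>) \<gamma> (stage_defect A c 2) = 0"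
        using coupl(3,4) by (simp add: stage_defect_2 coupling_moment_diff[OF cm] coupling_moment_scaleR)
    qed (use coupl in simp_all)
  qed
qed

end
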